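(* Let $\mathcal V\subset\mathbb R^{n_1+n_2+2}$ be a compact set such that every $h=(X,W,(E_{1,j}),(E_{2,j}))\in\mathcal V$ satisfies $X\in A$, $W\in B$, $E_{i,j}\in C$ for compact sets $A\subset(0,1)$, $B\subset\mathbb R$, $C\subset(0,\kappa(0))$. Then there exists $\delta_0>0$ such that the map $(\delta,h)\mapsto\bar H^\delta(h)$ is $\mathcal C^1$ on $\{(\delta,h):0\le\delta\le\delta_0,\ h\in\mathcal V\}$. Furthermore, for each $T>0$ there exist $K>0$ and $\varepsilon_0>0$ such that for all $\varepsilon\in(0,\varepsilon_0]$, all $\delta\in[0,\delta_0]$ and all initial conditions with $h^\delta_\varepsilon(0)\in\mathcal V$, \[ \sup_{0\le\tau\le T\wedge T^\delta_\varepsilon}\bigl|h^\delta_\varepsilon(\tau/\varepsilon)-\bar h^\delta(\tau)\bigr|\le K\varepsilon . \]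
   Context: Soft core piston system: fix integers $n_1,n_2\ge1$ and masses $m_{1,j},m_{2,j}>0$. Let $\kappa:\mathbb R\to\mathbb R$ be $\mathcal C^2$ with $\kappa(x)=0$ for $x\ge1$ and $\kappa'(x)<0$ for $x<1$; for $\delta>0$ put $\kappa_\delta(x)=\kappa(x/\delta)$, and let $\kappa^{-1}:[0,\kappa(0)]\to[0,1]$ denote the inverse of $\kappa|_{[0,1]}$. A piston (mass $M$, position $X$, velocity $V$), $n_1$ gas particles (positions $x_{1,j}$, velocities $v_{1,j}$) to its left and $n_2$ gas particles (positions $x_{2,j}$, velocities $v_{2,j}$) to its right move on the line under the Hamiltonian $\frac{M V^2}{2}+\sum_{i,j}\frac{m_{i,j}v_{i,j}^2}{2}+\sum_{j=1}^{n_1}[\kappa_\delta(x_{1,j})+\kappa_\delta(X-x_{1,j})]+\sum_{j=1}^{n_2}[\kappa_\delta(x_{2,j}-X)+\kappa_\delta(1-x_{2,j})]$. Set $\varepsilon=M^{-1/2}$, $W=V/\varepsilon$, and define particle energies $E_{1,j}=\frac12m_{1,j}v_{1,j}^2+\kappa_\delta(x_{1,j})+\kappa_\delta(X-x_{1,j})$, $E_{2,j}=\frac12m_{2,j}v_{2,j}^2+\kappa_\delta(x_{2,j}-X)+\kappa_\delta(1-x_{2,j})$. The slow variables are $h=(X,W,(E_{1,j})_j,(E_{2,j})_j)$. For $\delta=0$ the dynamics is by definition the hard core dynamics (piston and gas particles as point particles colliding elastically with each other and with walls at $0$ and $1$; gas particles do not interact among themselves), with $E_{i,j}=m_{i,j}v_{i,j}^2/2$.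 $h^\delta_\varepsilon(t)$ denotes the slow variables at time $t$ for parameters $\varepsilon,\delta$ from a given initial condition. Periods: for $\delta>0$ and $a=\delta\kappa^{-1}(E)$, $T_{1,j}(X,E,\delta)=2\int_a^{X-a}\sqrt{\frac{m_{1,j}/2}{E-\kappa_\delta(s)-\kappa_\delta(X-s)}}\,ds$ and $T_{2,j}(X,E,\delta)=2\int_{X+a}^{1-a}\sqrt{\frac{m_{2,j}/2}{E-\kappa_\delta(s-X)-\kappa_\delta(1-s)}}\,ds$ (periods of the gas particle motions with the piston held fixed); for $\delta=0$, $T_{1,j}(X,E,0)=\sqrt{2m_{1,j}/E}\,X$, $T_{2,j}(X,E,0)=\sqrt{2m_{2,j}/E}\,(1-X)$. Writing $T_{i,j}=T_{i,j}(X,E_{i,j},\delta)$, the averaged vector field $\bar H^\delta$ is \[ \frac{dX}{d\tau}=W,\ \ \frac{dW}{d\tau}=\sum_{j=1}^{n_1}\frac{\sqrt{8m_{1,j}E_{1,j}}}{T_{1,j}}-\sum_{j=1}^{n_2}\frac{\sqrt{8m_{2,j}E_{2,j}}}{T_{2,j}},\ \ \frac{dE_{1,j}}{d\tau}=-W\frac{\sqrt{8m_{1,j}E_{1,j}}}{T_{1,j}},\ \ \frac{dE_{2,j}}{d\tau}=W\frac{\sqrt{8m_{2,j}E_{2,j}}}{T_{2,j}}. \] $\bar h^\delta(\tau)$ is the solution of $d\bar h^\delta/d\tau=\bar H^\delta(\bar h^\delta)$, $\bar h^\delta(0)=h^\delta_\varepsilon(0)$, and $T^\delta_\varepsilon=\inf\{\tau\ge0:\bar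 h^\delta(\tau)\notin\mathcal V\text{ or }h^\delta_\varepsilon(\tau/\varepsilon)\notin\mathcal V\}$. *)

theory Defs
  imports "HOL-Analysis.Analysis"
begin

text \<open>Soft core / hard core piston system.
  Full state: (X, V, x1, v1, x2, v2) where x1, v1 are the positions/velocities of the
  n1 = CARD('n1) left gas particles and x2, v2 those of the n2 = CARD('n2) right ones.
  Slow variables: h = (X, W, E1, E2) in real x real x real^'n1 x real^'n2, a Euclidean
  space of dimension n1 + n2 + 2 with the Euclidean norm.\<close>

type_synonym ('n1, 'n2) pstate =
  "real \<times> real \<times> (real ^ 'n1) \<times> (real ^ 'n1) \<times> (real ^ 'n2) \<times> (real ^ 'n2)"

type_synonym ('n1, 'n2) slowvar = "real \<times> real \<times> (real ^ 'n1) \<times> (real ^ 'n2)"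

definition kappa_ok :: "(real \<Rightarrow> real) \<Rightarrow> bool" where
  "kappa_ok \<kappa> \<longleftrightarrow>
     (\<forall>x. (\<kappa> has_real_derivative deriv \<kappa> x) (at x)) \<and>
     (\<forall>x. (deriv \<kappa> has_real_derivative deriv (deriv \<kappa>) x) (at x)) \<and>
     continuous_on UNIV (deriv (deriv \<kappa>)) \<and>
     (\<forall>x\<ge>1. \<kappa> x = 0) \<and> (\<forall>x<1. deriv \<kappa> x < 0)"

definition kinv :: "(real \<Rightarrow> real) \<Rightarrow> real \<Rightarrow> real" where
  "kinv \<kappa> E = (THE x. x \<in> {0..1} \<and> \<kappa> x = E)"

definition kd :: "(real \<Rightarrow> real) \<Rightarrow> real \<Rightarrow> real \<Rightarrow> real" where
  "kd \<kappa> \<delta> x = \<kappa> (x / \<delta>)"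

definition kd' :: "(real \<Rightarrow> real) \<Rightarrow> real \<Rightarrow> real \<Rightarrow> real" where
  "kd' \<kappa> \<delta> x = deriv \<kappa> (x / \<delta>) / \<delta>"

definition period1 :: "(real \<Rightarrow> real) \<Rightarrow> real \<Rightarrow> real \<Rightarrow> real \<Rightarrow> real \<Rightarrow> real" where
  "period1 \<kappa> m \<delta> X E =
     (if \<delta> = 0 then sqrt (2 * m / E) * X
      else (let a = \<delta> * kinv \<kappa> E in
        2 * integral {a .. X - a}
          (\<lambda>s. sqrt ((m / 2) / (E - kd \<kappa> \<delta> s - kd \<kappa> \<delta> (X - s))))))"

definition period2 :: "(real \<Rightarrow> real) \<Rightarrow> real \<Rightarrow> real \<Rightarrow> real \<Rightarrow> real \<Rightarrow> real" where
  "period2 \<kappa> m \<delta> X E =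
     (if \<delta> = 0 then sqrt (2 * m / E) * (1 - X)
      else (let a = \<delta> * kinv \<kappa> E in
        2 * integral {X + a .. 1 - a}
          (\<lambda>s. sqrt ((m / 2) / (E - kd \<kappa> \<delta> (s - X) - kd \<kappa> \<delta> (1 - s))))))"

definition Hbar :: "(real \<Rightarrow> real) \<Rightarrow> real ^ 'n1 \<Rightarrow> real ^ 'n2 \<Rightarrow> real
    \<Rightarrow> ('n1::finite, 'n2::finite) slowvar \<Rightarrow> ('n1, 'n2) slowvar" where
  "Hbar \<kappa> m1 m2 \<delta> h = (case h of (X, W, E1, E2) \<Rightarrow>
     (let F1 = (\<lambda>j. sqrt (8 * m1$j * E1$j) / period1 \<kappa> (m1$j) \<delta> X (E1$j));
          F2 = (\<lambda>j. sqrt (8 * m2$j * E2$j) / period2 \<kappa> (m2$j) \<delta> X (E2$j))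
      in (W, (\<Sum>j\<in>UNIV. F1 j) - (\<Sum>j\<in>UNIV. F2 j),
          (\<chi> j. - W * F1 j), (\<chi> j. W * F2 j))))"

text \<open>Slow variables of a full state, for parameters eps (M = eps^-2) and delta.
  For delta = 0 the energies are purely kinetic.\<close>
definition slow :: "(real \<Rightarrow> real) \<Rightarrow> real ^ 'n1 \<Rightarrow> real ^ 'n2 \<Rightarrow> real \<Rightarrow> real
    \<Rightarrow> ('n1::finite, 'n2::finite) pstate \<Rightarrow> ('n1, 'n2) slowvar" where
  "slow \<kappa> m1 m2 \<epsilon> \<delta> y = (case y of (X, V, x1, v1, x2, v2) \<Rightarrow>
     (X, V / \<epsilon>,
      (\<chi> j. m1$j * (v1$j)^2 / 2
             + (if \<delta> = 0 then 0 else kd \<kappa> \<delta> (x1$j) + kd \<kappa> \<delta> (X - x1$j))),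
      (\<chi> j. m2$j * (v2$j)^2 / 2
             + (if \<delta> = 0 then 0 else kd \<kappa> \<delta> (x2$j - X) + kd \<kappa> \<delta> (1 - x2$j)))))"

text \<open>Soft core (delta > 0) Hamiltonian vector field, piston mass M = 1/eps^2.\<close>
definition sc_field :: "(real \<Rightarrow> real) \<Rightarrow> real ^ 'n1 \<Rightarrow> real ^ 'n2 \<Rightarrow> real \<Rightarrow> real
    \<Rightarrow> ('n1::finite, 'n2::finite) pstate \<Rightarrow> ('n1, 'n2) pstate" where
  "sc_field \<kappa> m1 m2 \<epsilon> \<delta> y = (case y of (X, V, x1, v1, x2, v2) \<Rightarrow>
     (V,
      \<epsilon>^2 * ((\<Sum>j\<in>UNIV. - kd' \<kappa> \<delta> (X - x1$j)) + (\<Sum>j\<in>UNIV. kd' \<kappa> \<delta> (x2$j - X))),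
      v1,
      (\<chi> j. (- kd' \<kappa> \<delta> (x1$j) + kd' \<kappa> \<delta> (X - x1$j)) / m1$j),
      v2,
      (\<chi> j. (- kd' \<kappa> \<delta> (x2$j - X) + kd' \<kappa> \<delta> (1 - x2$j)) / m2$j)))"

definition hc_pos :: "('n1::finite, 'n2::finite) pstate \<Rightarrow> real \<times> (real ^ 'n1) \<times> (real ^ 'n2)" where
  "hc_pos y = (case y of (X, V, x1, v1, x2, v2) \<Rightarrow> (X, x1, x2))"

definition hc_vel :: "('n1::finite, 'n2::finite) pstate \<Rightarrow> real \<times> (real ^ 'n1) \<times> (real ^ 'n2)" where
  "hc_vel y = (case y of (X, V, x1, v1, x2, v2) \<Rightarrow> (V, v1, v2))"

definition hc_free :: "('n1::finite, 'n2::finite) pstate \<Rightarrow> ('n1, 'n2) pstate" where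
  "hc_free y = (case y of (X, V, x1, v1, x2, v2) \<Rightarrow> (V, 0, v1, 0, v2, 0))"

definition vupd :: "real ^ 'n \<Rightarrow> 'n \<Rightarrow> real \<Rightarrow> real ^ 'n" where
  "vupd v j a = (\<chi> k. if k = j then a else v$k)"

text \<open>One elementary elastic binary collision between a pair in contact that is approaching:
  wall 0 / left particle, left particle / piston, piston / right particle, right particle / wall 1.
  Arguments: masses, piston mass M, positions, pre-collision and post-collision velocities.\<close>
definition hc_step :: "real ^ 'n1 \<Rightarrow> real ^ 'n2 \<Rightarrow> real
    \<Rightarrow> real \<times> (real ^ 'n1::finite) \<times> (real ^ 'n2::finite)
    \<Rightarrow> real \<times> (real ^ 'n1) \<times> (real ^ 'n2)
    \<Rightarrow> real \<times> (real ^ 'n1) \<times> (real ^ 'n2) \<Rightarrow> bool" where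
  "hc_step m1 m2 M p w w' = (case p of (X, x1, x2) \<Rightarrow> case w of (V, v1, v2) \<Rightarrow>
     (\<exists>j. x1$j = 0 \<and> v1$j < 0 \<and> w' = (V, vupd v1 j (- v1$j), v2)) \<or>
     (\<exists>j. x1$j = X \<and> v1$j > V \<and>
        w' = (((M - m1$j) * V + 2 * m1$j * v1$j) / (m1$j + M),
              vupd v1 j (((m1$j - M) * v1$j + 2 * M * V) / (m1$j + M)), v2)) \<or>
     (\<exists>j. x2$j = X \<and> V > v2$j \<and>
        w' = (((M - m2$j) * V + 2 * m2$j * v2$j) / (m2$j + M), v1,
              vupd v2 j (((m2$j - M) * v2$j + 2 * M * V) / (m2$j + M)))) \<or>
     (\<exists>j. x2$j = 1 \<and> v2$j > 0 \<and> w' = (V, v1, vupd v2 j (- v2$j))))"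

definition hc_collide :: "real ^ 'n1 \<Rightarrow> real ^ 'n2 \<Rightarrow> real
    \<Rightarrow> real \<times> (real ^ 'n1::finite) \<times> (real ^ 'n2::finite)
    \<Rightarrow> real \<times> (real ^ 'n1) \<times> (real ^ 'n2)
    \<Rightarrow> real \<times> (real ^ 'n1) \<times> (real ^ 'n2) \<Rightarrow> bool" where
  "hc_collide m1 m2 M p wm wp \<longleftrightarrow>
     (hc_step m1 m2 M p)\<^sup>+\<^sup>+ wm wp \<and> \<not> (\<exists>w. hc_step m1 m2 M p wp w)"

definition hc_traj :: "real ^ 'n1 \<Rightarrow> real ^ 'n2 \<Rightarrow> real \<Rightarrow> real
    \<Rightarrow> (real \<Rightarrow> ('n1::finite, 'n2::finite) pstate) \<Rightarrow> bool" where
  "hc_traj m1 m2 M t1 y \<longleftrightarrow>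
     (\<exists>C. finite C \<and> C \<subseteq> {0<..t1} \<and>
        continuous_on {0..t1} (\<lambda>t. hc_pos (y t)) \<and>
        (\<forall>t\<in>{0..t1} - C. (y has_vector_derivative hc_free (y t)) (at t within {0..t1})) \<and>
        (\<forall>t\<in>C. (y \<longlongrightarrow> y t) (at t within {t..t1}) \<and>
           (\<exists>wm. ((\<lambda>s. hc_vel (y s)) \<longlongrightarrow> wm) (at_left t) \<and>
                 hc_collide m1 m2 M (hc_pos (y t)) wm (hc_vel (y t)))) \<and>
        (\<forall>t\<in>{0..t1}. case y t of (X, V, x1, v1, x2, v2) \<Rightarrow>
           (\<forall>j. 0 \<le> x1$j \<and> x1$j \<le> X) \<and> (\<forall>j. X \<le> x2$j \<and> x2$j \<le> 1)))"

definition piston_traj :: "(real \<Rightarrow> real) \<Rightarrow> real ^ 'n1 \<Rightarrow> real ^ 'n2 \<Rightarrow> real \<Rightarrow> real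
    \<Rightarrow> real \<Rightarrow> (real \<Rightarrow> ('n1::finite, 'n2::finite) pstate) \<Rightarrow> bool" where
  "piston_traj \<kappa> m1 m2 \<epsilon> \<delta> t1 y \<longleftrightarrow>
     (if \<delta> = 0 then hc_traj m1 m2 (1 / \<epsilon>^2) t1 y
      else (\<forall>t\<in>{0..t1}.
              (y has_vector_derivative sc_field \<kappa> m1 m2 \<epsilon> \<delta> (y t)) (at t within {0..t1})))"

end

theory Submission
  imports Defs
begin

text \<open>
  The force on the piston is averaged by an explicit corrector instead of action-angle variables.
  For the hard core the virial identity \<open>d(m v x)/dt = 2 E - X F\<close> shows that \<open>P = - m v x / X\<close>
  satisfies \<open>dP/dt = F - 2 E / X + O(\<epsilon>)\<close>, and \<open>2 E / X\<close> is exactly the averaged force.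
  For \<open>\<delta> > 0\<close> the averaged force is \<open>2 E / (X + \<delta> \<beta>(E))\<close> with a \<open>C\<^sup>1\<close> function \<open>\<beta>\<close>, which gives the
  regularity claim, and the virial is corrected in each boundary layer by \<open>\<delta> \<rho>(x / \<delta>, v)\<close>, where
  \<open>\<rho>\<close> is built from the time since the turning point and vanishes outside the layer.
  Subtracting \<open>\<epsilon>\<close> times the correctors from the slow variables leaves an equation whose error is
  \<open>\<epsilon>\<^sup>2\<close> times the total momentum transfer. This transfer is \<open>O(1 / \<epsilon>)\<close> up to time \<open>T / \<epsilon>\<close>, uniformly
  in \<open>\<delta>\<close>, so Gronwall's inequality gives the bound; collisions of the hard core enter as jumps.
\<close>

subsection \<open>Auxiliary facts from analysis\<close>

text \<open>Two obstacles shape the proof. The contact force is of order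
  \<open>1 / \<delta>\<close>, so pointwise error bounds by constants would not be uniform in
  \<open>\<delta>\<close>. Errors are therefore measured against a clock \<open>N\<close>, twice the
  sum of the correctors plus a multiple of time. Since a corrector has derivative force minus
  averaged force, up to small terms, \<open>N'\<close> is at least one plus the total force, whereas
  \<open>N\<close> grows only by O(\<open>1 / \<epsilon>\<close>), because correctors and averaged
  forces are bounded. The second obstacle is the period integrand, singular at the turning point:
  differentiating it in \<open>E\<close> gives a divergent integral. Near the turning point velocity
  is the better variable, but it needs \<open>\<kappa>' \<noteq> 0\<close> and fails at the outer
  edge of the layer, where position works; hence the cutoff. The form of \<open>beta\<close> is
  forced: crossing a cell takes the time of a free flight over the length
  \<open>L + \<delta> * beta E\<close>. The layer at the piston moves, so relative position and
  velocity enter there. The energy in that frame differs by O(\<open>\<epsilon>\<close>) from the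
  true one, which is why the energy band is wider than the range prescribed by the theorem.\<close>

lemma bounded_real_on_compact:
  fixes f :: "'a::topological_space \<Rightarrow> real"
  assumes "compact S" "continuous_on S f"
  obtains K where "0 \<le> K" "\<And>x. x \<in> S \<Longrightarrow> \<bar>f x\<bar> \<le> K"
proof -
  from compact_imp_bounded[OF compact_continuous_image[OF assms(2,1)]]
  obtain K where "\<forall>x\<in>S. norm (f x) \<le> K" unfolding bounded_iff by blast
  then have "0 \<le> max 0 K" "\<And>x. x \<in> S \<Longrightarrow> \<bar>f x\<bar> \<le> max 0 K" by (auto simp: le_max_iff_disj)
  then show thesis by (rule that)
qed

lemma compact_subset_Icc:
  fixes S :: "real set"
  assumes "compact S" "S \<subseteq> {a<..<b}" "a < b"
  obtains c d where "a < c" "c \<le> d" "d < b" "S \<subseteq> {c..d}"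
proof (cases "S = {}")
  case True
  then show thesis using assms(3) by (intro that[of "(a + b) / 2" "(a + b) / 2"]) auto
next
  case False
  obtain c where c: "c \<in> S" "\<And>x. x \<in> S \<Longrightarrow> c \<le> x" using compact_attains_inf[OF assms(1) False] by blast
  obtain d where d: "d \<in> S" "\<And>x. x \<in> S \<Longrightarrow> x \<le> d" using compact_attains_sup[OF assms(1) False] by blast
  show thesis using assms(2) c d by (intro that[of c d]) auto
qed

text \<open>The hypotheses control the slow variables only strictly before the stopping time.
  Closedness of the region extends the control to the left limit at that time, where a hard core
  velocity may jump.\<close>

lemma left_limit_in_closed:
  fixes f :: "real \<Rightarrow> 'b::topological_space"
  assumes "closed S" "(f \<longlongrightarrow> L) (at_left b)" "0 < b" "\<And>t. 0 \<le> t \<Longrightarrow> t < b \<Longrightarrow> f t \<in> S"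
  shows "L \<in> S"
proof (rule Lim_in_closed_set[OF assms(1) _ _ assms(2)])
  show "\<forall>\<^sub>F t in at_left b. f t \<in> S"
    using assms(3,4) by (auto simp: eventually_at_left_field intro!: exI[of _ 0])
qed simp

lemma sum_fun_upd_UNIV: "(\<Sum>k\<in>UNIV. (f(j := c)) k) = (\<Sum>k\<in>UNIV. f k) - f j + c"
  for f :: "'m::finite \<Rightarrow> real"
proof -
  have "(\<Sum>k\<in>UNIV - {j}. (f(j := c)) k) = (\<Sum>k\<in>UNIV - {j}. f k)" by (rule sum.cong) auto
  then show ?thesis
    using sum.remove[of UNIV j "f(j := c)"] sum.remove[of UNIV j f] by simp
qed

lemma has_vector_derivative_vec_lambda:
  fixes f :: "'m::finite \<Rightarrow> real \<Rightarrow> real"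
  assumes "\<And>j. (f j has_real_derivative f' j) (at t within S)"
  shows "((\<lambda>t. \<chi> j. f j t) has_vector_derivative (\<chi> j. f' j)) (at t within S)"
proof -
  have eq: "(\<chi> j. g j) = (\<Sum>j\<in>UNIV. g j *\<^sub>R axis j 1)" for g :: "'m \<Rightarrow> real"
    using basis_expansion[of "\<chi> j. g j"] by (simp add: scalar_mult_eq_scaleR)
  show ?thesis
    unfolding eq
    by (intro has_vector_derivative_sum
        bounded_linear.has_vector_derivative[OF bounded_linear_scaleR_left])
      (use assms in \<open>simp add: has_real_derivative_iff_has_vector_derivative\<close>)
qed

lemma continuous_on_curried:
  assumes "continuous_on (I \<times> UNIV) (\<lambda>(x, y). f x y)" "continuous_on S g" "continuous_on S h"
    and "\<And>p. p \<in> S \<Longrightarrow> g p \<in> I"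
  shows "continuous_on S (\<lambda>p. f (g p) (h p))"
  using continuous_on_compose2[OF assms(1) continuous_on_Pair[OF assms(2,3)]] assms(4) by auto

subsection \<open>Continuously differentiable maps\<close>

text \<open>The derivative is taken within \<open>S\<close>, so that the one-sided end
  \<open>\<delta> = 0\<close> is included, and as a bounded linear function, so that its continuity
  is continuity in operator norm.\<close>

definition C1_on :: "('a::real_normed_vector \<Rightarrow> 'b::real_normed_vector) \<Rightarrow> 'a set \<Rightarrow> bool" where
  "C1_on f S \<longleftrightarrow> (\<exists>D. (\<forall>x\<in>S. (f has_derivative blinfun_apply (D x)) (at x within S)) \<and> continuous_on S D)"

lemma C1_onI:
  assumes "\<And>x. x \<in> S \<Longrightarrow> (f has_derivative blinfun_apply (D x)) (at x within S)"
    and "continuous_on S D"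
  shows "C1_on f S"
  using assms unfolding C1_on_def by blast

lemma C1_on_imp_continuous_on: "C1_on f S \<Longrightarrow> continuous_on S f"
  unfolding C1_on_def by (metis continuous_on_eq_continuous_within has_derivative_continuous)

lemma C1_on_cong:
  assumes "\<And>x. x \<in> S \<Longrightarrow> f x = g x" and "C1_on g S"
  shows "C1_on f S"
proof -
  obtain D where D: "\<And>x. x \<in> S \<Longrightarrow> (g has_derivative blinfun_apply (D x)) (at x within S)"
      "continuous_on S D"
    using assms(2) unfolding C1_on_def by blast
  show ?thesis
    by (rule C1_onI[OF has_derivative_transform[OF _ assms(1) D(1)] D(2)])
qed

lemma C1_on_subset: "C1_on f S \<Longrightarrow> T \<subseteq> S \<Longrightarrow> C1_on f T"
  unfolding C1_on_def by (meson continuous_on_subset has_derivative_subset subset_iff)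

lemma C1_on_const [simp]: "C1_on (\<lambda>x. c) S"
  by (rule C1_onI[where D = "\<lambda>_. 0"]) (auto simp: zero_blinfun.rep_eq)

lemma C1_on_linear_compose:
  assumes L: "bounded_linear L" and "C1_on f S"
  shows "C1_on (\<lambda>x. L (f x)) S"
proof -
  obtain D where D: "\<And>x. x \<in> S \<Longrightarrow> (f has_derivative blinfun_apply (D x)) (at x within S)"
      "continuous_on S D"
    using assms(2) unfolding C1_on_def by blast
  show ?thesis
  proof (rule C1_onI[where D = "\<lambda>x. Blinfun L o\<^sub>L D x"])
    show "((\<lambda>x. L (f x)) has_derivative blinfun_apply (Blinfun L o\<^sub>L D x)) (at x within S)"
      if "x \<in> S" for x
      using bounded_linear.has_derivative[OF L D(1)[OF that]]
      by (simp add: bounded_linear_Blinfun_apply[OF L] blinfun_compose.rep_eq o_def)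
  qed (intro continuous_intros D(2))
qed

lemma C1_on_linear: "bounded_linear L \<Longrightarrow> C1_on L S"
  by (rule C1_onI[where D = "\<lambda>_. Blinfun L"])
    (auto simp: bounded_linear_Blinfun_apply bounded_linear_imp_has_derivative)

lemma C1_on_add:
  assumes "C1_on f S" "C1_on g S"
  shows "C1_on (\<lambda>x. f x + g x) S"
proof -
  obtain D D' where D: "\<And>x. x \<in> S \<Longrightarrow> (f has_derivative blinfun_apply (D x)) (at x within S)"
      "continuous_on S D"
    and D': "\<And>x. x \<in> S \<Longrightarrow> (g has_derivative blinfun_apply (D' x)) (at x within S)"
      "continuous_on S D'"
    using assms unfolding C1_on_def by metis
  show ?thesis
    by (rule C1_onI[where D = "\<lambda>x. D x + D' x"])
      (auto intro!: continuous_intros D D' has_derivative_eq_rhs[OF has_derivative_add[OF D(1) D'(1)]]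
        simp: blinfun.add_left fun_eq_iff)
qed

lemma C1_on_minus: "C1_on f S \<Longrightarrow> C1_on (\<lambda>x. - f x) S"
  by (rule C1_on_linear_compose[OF bounded_linear_minus[OF bounded_linear_ident]])

lemma C1_on_diff: "C1_on f S \<Longrightarrow> C1_on g S \<Longrightarrow> C1_on (\<lambda>x. f x - g x) S"
  using C1_on_add[OF _ C1_on_minus, of f S g] by simp

lemma C1_on_sum: "(\<And>i. i \<in> I \<Longrightarrow> C1_on (f i) S) \<Longrightarrow> C1_on (\<lambda>x. \<Sum>i\<in>I. f i x) S"
  by (induction I rule: infinite_finite_induct) (auto intro: C1_on_add)

lemma C1_on_mult:
  fixes f g :: "'a::real_normed_vector \<Rightarrow> real"
  assumes "C1_on f S" "C1_on g S"
  shows "C1_on (\<lambda>x. f x * g x) S"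
proof -
  obtain D D' where D: "\<And>x. x \<in> S \<Longrightarrow> (f has_derivative blinfun_apply (D x)) (at x within S)"
      "continuous_on S D"
    and D': "\<And>x. x \<in> S \<Longrightarrow> (g has_derivative blinfun_apply (D' x)) (at x within S)"
      "continuous_on S D'"
    using assms unfolding C1_on_def by metis
  show ?thesis
  proof (rule C1_onI[where D = "\<lambda>x. f x *\<^sub>R D' x + g x *\<^sub>R D x"])
    show "((\<lambda>x. f x * g x) has_derivative blinfun_apply (f x *\<^sub>R D' x + g x *\<^sub>R D x)) (at x within S)"
      if "x \<in> S" for x
      by (rule has_derivative_eq_rhs[OF has_derivative_mult[OF D(1) D'(1)]])
        (use that in \<open>auto simp: blinfun.add_left blinfun.scaleR_left algebra_simps fun_eq_iff\<close>)
  qed (intro continuous_intros D(2) D'(2) C1_on_imp_continuous_on assms)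
qed

lemma C1_on_real_compose:
  fixes f :: "'a::real_normed_vector \<Rightarrow> real"
  assumes f: "C1_on f S" and T: "\<And>x. x \<in> S \<Longrightarrow> f x \<in> T"
    and g: "\<And>y. y \<in> T \<Longrightarrow> (g has_real_derivative g' y) (at y)" "continuous_on T g'"
  shows "C1_on (\<lambda>x. g (f x)) S"
proof -
  obtain D where D: "\<And>x. x \<in> S \<Longrightarrow> (f has_derivative blinfun_apply (D x)) (at x within S)"
      "continuous_on S D"
    using f unfolding C1_on_def by blast
  show ?thesis
  proof (rule C1_onI[where D = "\<lambda>x. g' (f x) *\<^sub>R D x"])
    show "((\<lambda>x. g (f x)) has_derivative blinfun_apply (g' (f x) *\<^sub>R D x)) (at x within S)"
      if "x \<in> S" for x
      by (rule has_derivative_eq_rhs[OF has_derivative_compose[OF D(1)[OF that]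
          g(1)[OF T[OF that], unfolded has_field_derivative_def]]])
        (simp add: blinfun.scaleR_left fun_eq_iff)
    show "continuous_on S (\<lambda>x. g' (f x) *\<^sub>R D x)"
      by (intro continuous_intros D(2) continuous_on_compose2[OF g(2) C1_on_imp_continuous_on[OF f]])
        (use T in auto)
  qed
qed

lemma C1_on_divide:
  fixes f g :: "'a::real_normed_vector \<Rightarrow> real"
  assumes "C1_on f S" "C1_on g S" and nz: "\<And>x. x \<in> S \<Longrightarrow> g x \<noteq> 0"
  shows "C1_on (\<lambda>x. f x / g x) S"
proof -
  have "C1_on (\<lambda>x. inverse (g x)) S"
    by (rule C1_on_real_compose[OF assms(2), where T = "- {0}" and g' = "\<lambda>y. - (inverse y ^ 2)"])
      (use nz in \<open>auto intro!: derivative_eq_intros continuous_intros simp: power2_eq_square\<close>)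
  then show ?thesis
    using C1_on_mult[OF assms(1)] by (simp add: divide_inverse)
qed

lemma C1_on_Pair:
  assumes "C1_on f S" "C1_on g S"
  shows "C1_on (\<lambda>x. (f x, g x)) S"
proof -
  have "C1_on (\<lambda>x. (f x, 0) + (0, g x)) S"
    by (intro C1_on_add C1_on_linear_compose[of "\<lambda>y. (y, 0)"] C1_on_linear_compose[of "\<lambda>y. (0, y)"]
        bounded_linear_Pair bounded_linear_ident bounded_linear_zero assms)
  then show ?thesis by simp
qed

lemma C1_on_vec_lambda:
  fixes f :: "'n::finite \<Rightarrow> 'a::real_normed_vector \<Rightarrow> real"
  assumes "\<And>j. C1_on (f j) S"
  shows "C1_on (\<lambda>x. \<chi> j. f j x) S"
proof -
  have "C1_on (\<lambda>x. \<Sum>j\<in>UNIV. f j x *\<^sub>R axis j 1) S"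
    by (intro C1_on_sum C1_on_linear_compose[OF bounded_linear_scaleR_left] assms)
  moreover have "(\<chi> j. f j x) = (\<Sum>j\<in>UNIV. f j x *\<^sub>R axis j 1)" for x
    using basis_expansion[of "\<chi> j. f j x"] by (simp add: scalar_mult_eq_scaleR)
  ultimately show ?thesis by simp
qed

section \<open>Squared positive parts, and primitives of functions with a parameter\<close>

lemma has_real_derivative_pos_part_sq:
  "((\<lambda>x. (max 0 x)\<^sup>2) has_real_derivative 2 * max 0 x) (at x)" for x :: real
proof -
  consider "x < 0" | "x = 0" | "x > 0" by linarith
  then show ?thesis
  proof cases
    case 1
    have "((\<lambda>x::real. 0) has_real_derivative 2 * max 0 x) (at x)" using 1 by simp
    then show ?thesis
      by (rule has_field_derivative_transform_within_open[of _ _ _ "{..<0}"]) (use 1 in auto)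
  next
    case 2
    have "((\<lambda>h::real. (max 0 h)\<^sup>2 / h) \<longlongrightarrow> 0) (at 0)"
    proof (rule Lim_null_comparison)
      show "\<forall>\<^sub>F h in at 0. norm ((max 0 h)\<^sup>2 / h) \<le> norm (h::real)"
        by (auto simp: eventually_at_filter power2_eq_square max_def)
      show "((\<lambda>h::real. norm h) \<longlongrightarrow> 0) (at 0)"
        by (rule tendsto_eq_intros) auto
    qed
    then show ?thesis using 2 by (simp add: DERIV_def)
  next
    case 3
    have "((\<lambda>x::real. x\<^sup>2) has_real_derivative 2 * max 0 x) (at x)"
      using 3 by (auto intro!: derivative_eq_intros)
    then show ?thesis
      by (rule has_field_derivative_transform_within_open[of _ _ _ "{0<..}"]) (use 3 in auto)
  qed
qed

text \<open>The primitive is taken over the unit interval so that negative \<open>y\<close> need no separate convention.\<close>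

definition prim :: "(real \<Rightarrow> real \<Rightarrow> real) \<Rightarrow> real \<Rightarrow> real \<Rightarrow> real" where
  "prim f x y = y * integral {0..1} (\<lambda>r. f x (y * r))"

lemma prim_vanish: "(\<And>r. r \<in> {0..1} \<Longrightarrow> f x (y * r) = 0) \<Longrightarrow> prim f x y = 0"
  unfolding prim_def using integral_cong[of "{0..1}" "\<lambda>r. f x (y * r)" "\<lambda>_. 0"] by simp

lemma continuous_on_prim:
  assumes f: "continuous_on (I \<times> UNIV) (\<lambda>(x, y). f x y)"
  shows "continuous_on (I \<times> UNIV) (\<lambda>(x, y). prim f x y)"
proof -
  have "continuous_on ((I \<times> UNIV) \<times> cbox 0 1) (\<lambda>((x, y), r). f x (y * r))"
    unfolding split_beta
    by (rule continuous_on_compose2[OF f[unfolded split_beta],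
          where f = "\<lambda>p. (fst (fst p), snd (fst p) * snd p)", simplified])
      (auto intro!: continuous_intros)
  then have "continuous_on (I \<times> UNIV) (\<lambda>p. integral (cbox 0 1) (\<lambda>r. f (fst p) (snd p * r)))"
    by (intro integral_continuous_on_param) (simp add: split_beta)
  then show ?thesis
    unfolding prim_def split_beta by (auto intro!: continuous_intros)
qed

text \<open>The substitution \<open>s = y * r\<close> turns the unit-interval form into a difference
  of ordinary integrals. Starting them at \<open>- c\<close> puts both signs of \<open>y\<close> on
  the same footing.\<close>

lemma prim_eq_integral:
  assumes f: "continuous_on UNIV (f x)" and y: "\<bar>y\<bar> \<le> c"
  shows "prim f x y = integral {- c..y} (f x) - integral {- c..0} (f x)"
proof -
  define G where "G = (\<lambda>y. integral {- c..y} (f x))"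
  have G: "(G has_real_derivative f x t) (at t within {- c..c})" if "t \<in> {- c..c}" for t
    unfolding G_def by (rule integral_has_real_derivative[OF continuous_on_subset[OF f]]) (use that in auto)
  have "((\<lambda>r. y * f x (y * r)) has_integral G (y * 1) - G (y * 0)) {0..1}"
  proof (rule fundamental_theorem_of_calculus)
    fix r :: real assume r: "r \<in> {0..1}"
    have le: "\<bar>y * s\<bar> \<le> c" if "s \<in> {0..1}" for s
      using that y mult_left_le[of "\<bar>s\<bar>" "\<bar>y\<bar>"] by (auto simp: abs_mult)
    have sub: "(\<lambda>r. y * r) ` {0..1} \<subseteq> {- c..c}" using le by (force simp: abs_le_iff)
    \<comment> \<open>A derivative within the image is used, since for
      \<open>\<bar>y\<bar> = c\<close> the argument may reach an endpoint, where only a one-sided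
      derivative of \<open>G\<close> is known.\<close>
    have "(G has_real_derivative f x (y * r)) (at (y * r) within (\<lambda>r. y * r) ` {0..1})"
      by (rule DERIV_subset[OF G sub]) (use sub r in blast)
    moreover have "((\<lambda>r. y * r) has_real_derivative y) (at r within {0..1})"
      by (auto intro!: derivative_eq_intros)
    ultimately have "((\<lambda>r. G (y * r)) has_real_derivative f x (y * r) * y) (at r within {0..1})"
      using DERIV_image_chain[of G _ "\<lambda>r. y * r"] by (simp add: o_def)
    then show "((\<lambda>r. G (y * r)) has_vector_derivative y * f x (y * r)) (at r within {0..1})"
      by (simp add: has_real_derivative_iff_has_vector_derivative mult.commute)
  qed auto
  then have "integral {0..1} (\<lambda>r. y * f x (y * r)) = G (y * 1) - G (y * 0)"
    by (rule integral_unique)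
  then show ?thesis by (simp add: prim_def G_def)
qed

lemma prim_has_real_derivative:
  assumes f: "continuous_on UNIV (f x)"
  shows "((\<lambda>y. prim f x y) has_real_derivative f x y) (at y)"
proof -
  \<comment> \<open>The extra 1 keeps \<open>y\<close> in the interior of the interval, where the
    derivative of the integral becomes two-sided.\<close>
  define c where "c = \<bar>y\<bar> + 1"
  have "((\<lambda>y. integral {- c..y} (f x)) has_real_derivative f x y) (at y within {- c..c})"
    by (rule integral_has_real_derivative[OF continuous_on_subset[OF f]]) (auto simp: c_def)
  moreover have "at y within {- c..c} = at y"
    by (rule at_within_interior) (auto simp: c_def abs_if)
  ultimately have "((\<lambda>y. integral {- c..y} (f x) - integral {- c..0} (f x)) has_real_derivative f x y) (at y)"
    by (auto intro!: derivative_eq_intros)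
  then show ?thesis
    by (rule has_field_derivative_transform_within_open[of _ _ _ "{- c<..<c}"])
      (auto simp: c_def prim_eq_integral[where f = f and x = x and c = "\<bar>y\<bar> + 1", OF f])
qed

text \<open>Partial derivatives suffice because the one in \<open>y\<close>, which is
  \<open>f\<close> itself, is jointly continuous. The one in \<open>x\<close> comes from
  differentiation under the integral and is again a primitive, namely of \<open>fx\<close>.\<close>

lemma prim_has_derivative:
  assumes I: "open I" "convex I" and x: "x \<in> I"
    and f: "continuous_on (I \<times> UNIV) (\<lambda>(x, y). f x y)"
    and fx: "\<And>x y. x \<in> I \<Longrightarrow> ((\<lambda>x. f x y) has_real_derivative fx x y) (at x)"
    and cfx: "continuous_on (I \<times> UNIV) (\<lambda>(x, y). fx x y)"
  shows "((\<lambda>(x, y). prim f x y) has_derivative (\<lambda>(dx, dy). prim fx x y * dx + f x y * dy)) (at (x, y))"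
proof -
  have f_y: "continuous_on UNIV (f x')" if "x' \<in> I" for x'
    by (rule continuous_on_compose2[OF f, where f = "\<lambda>y. (x', y)", simplified])
      (use that in \<open>auto intro!: continuous_intros\<close>)
  have "((\<lambda>x. integral (cbox 0 1) (\<lambda>r. f x (y * r))) has_real_derivative
          integral (cbox 0 1) (\<lambda>r. fx x (y * r))) (at x within I)"
  proof (rule leibniz_rule_field_derivative)
    show "continuous_on (I \<times> cbox 0 1) (\<lambda>(x, r). fx x (y * r))"
      unfolding split_beta
      by (rule continuous_on_compose2[OF cfx[unfolded split_beta], where f = "\<lambda>p. (fst p, y * snd p)", simplified])
        (auto intro!: continuous_intros)
    show "(\<lambda>r. f x' (y * r)) integrable_on cbox 0 1" if "x' \<in> I" for x'
      by (rule integrable_continuous, rule continuous_on_compose2[OF f_y[OF that]])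
        (auto intro!: continuous_intros)
  qed (auto intro!: DERIV_subset[OF fx] x I)
  then have X: "((\<lambda>x. prim f x y) has_real_derivative prim fx x y) (at x within I)"
    unfolding prim_def by (auto intro!: derivative_eq_intros)
  have "((\<lambda>(x, y). prim f x y) has_derivative
      (\<lambda>(dx, dy). prim fx x y * dx + blinfun_apply (blinfun_mult_right (f x y)) dy)) (at (x, y) within I \<times> UNIV)"
  proof (rule has_derivative_partialsI[where fy = "\<lambda>x y. blinfun_mult_right (f x y)"])
    show "((\<lambda>x. prim f x y) has_derivative (*) (prim fx x y)) (at x within I)"
      using X by (simp add: has_field_derivative_def)
    show "((\<lambda>y. prim f x' y) has_derivative blinfun_apply (blinfun_mult_right (f x' y'))) (at y')"
      if "x' \<in> I" for x' y'
      using prim_has_real_derivative[of f x' y', OF f_y[OF that]] by (simp add: has_field_derivative_def)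
    have "continuous_on (I \<times> UNIV) (\<lambda>(x, y). blinfun_mult_right (f x y))"
      using bounded_linear.continuous_on[OF bounded_linear_blinfun_mult_right f] by (simp add: split_beta)
    then show "continuous (at (x, y) within I \<times> UNIV) (\<lambda>(x, y). blinfun_mult_right (f x y))"
      using x by (simp add: continuous_on_eq_continuous_within)
  qed auto
  moreover have "at (x, y) within I \<times> UNIV = at (x, y)"
    by (rule at_within_open) (use I x in \<open>auto intro: open_Times\<close>)
  ultimately show ?thesis by simp
qed

lemma has_real_derivative_prim_compose:
  assumes I: "open I" "convex I" and x: "x t \<in> I"
    and f: "continuous_on (I \<times> UNIV) (\<lambda>(x, y). f x y)"
    and fx: "\<And>x y. x \<in> I \<Longrightarrow> ((\<lambda>x. f x y) has_real_derivative fx x y) (at x)"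
    and cfx: "continuous_on (I \<times> UNIV) (\<lambda>(x, y). fx x y)"
    and dx: "(x has_real_derivative x') (at t within S)"
    and dy: "(y has_real_derivative y') (at t within S)"
  shows "((\<lambda>t. prim f (x t) (y t)) has_real_derivative prim fx (x t) (y t) * x' + f (x t) (y t) * y') (at t within S)"
proof -
  have "((\<lambda>t. (x t, y t)) has_derivative (\<lambda>h. (x' * h, y' * h))) (at t within S)"
    by (intro has_derivative_Pair dx[unfolded has_field_derivative_def] dy[unfolded has_field_derivative_def])
  from has_derivative_compose[OF this, of "\<lambda>(x, y). prim f x y", OF prim_has_derivative[OF I x f fx cfx]]
  show ?thesis
    unfolding has_field_derivative_def split
    by (rule has_derivative_eq_rhs) (auto simp: fun_eq_iff algebra_simps)
qed

subsection \<open>A Gronwall estimate for functions with jumps\<close>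

text \<open>A jump is harmless as long as it goes down. Induction on the number of exceptional
  points in the open interval: an inner one splits the interval, and without any the mean value
  theorem applies. Endpoints may be exceptional as well; the one-sided limits take care of
  them.\<close>

lemma nonincreasing_with_jumps:
  fixes Y :: "real \<Rightarrow> real"
  assumes "finite C" and "a \<le> b"
    and der: "\<And>t. a < t \<Longrightarrow> t < b \<Longrightarrow> t \<notin> C \<Longrightarrow> \<exists>d. (Y has_real_derivative d) (at t) \<and> d \<le> 0"
    and right: "\<And>t. a \<le> t \<Longrightarrow> t < b \<Longrightarrow> (Y \<longlongrightarrow> Y t) (at_right t)"
    and left: "\<And>t. a < t \<Longrightarrow> t \<le> b \<Longrightarrow> \<exists>l. (Y \<longlongrightarrow> l) (at_left t) \<and> Y t \<le> l"
  shows "Y b \<le> Y a"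
  using assms
proof (induction "card (C \<inter> {a<..<b})" arbitrary: a b rule: less_induct)
  case less
  show ?case
  proof (cases "C \<inter> {a<..<b} = {}")
    case True
    show ?thesis
    proof (cases "a = b")
      case False
      then have "a < b" using less.prems by simp
      obtain l where l: "(Y \<longlongrightarrow> l) (at_left b)" "Y b \<le> l"
        using less.prems(5)[of b] \<open>a < b\<close> by auto
      \<comment> \<open>Replacing the end value by the left limit makes the function continuous on
        the closed interval. The jump at \<open>b\<close> itself is downward, so it can be added
        afterwards.\<close>
      define Z where "Z = (\<lambda>t. if t = b then l else Y t)"
      have cont: "continuous_on {a..b} Z"
        unfolding continuous_on_eq_continuous_within
      proof
        fix t assume t: "t \<in> {a..b}"
        consider "t = a" | "t = b" | "a < t" "t < b" using t by force
        then show "continuous (at t within {a..b}) Z"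
        proof cases
          case 1
          have "(Z \<longlongrightarrow> Y a) (at_right a)"
          proof (rule Lim_transform_eventually)
            show "(Y \<longlongrightarrow> Y a) (at_right a)" using less.prems(4)[of a] \<open>a < b\<close> by simp
            show "\<forall>\<^sub>F x in at_right a. Y x = Z x"
              using \<open>a < b\<close> by (auto simp: Z_def eventually_at_right_field intro!: exI[of _ b])
          qed
          moreover have "Z a = Y a" using \<open>a < b\<close> by (simp add: Z_def)
          ultimately show ?thesis
            using 1 \<open>a < b\<close> by (simp add: continuous_within at_within_Icc_at_right)
        next
          case 2
          have "(Z \<longlongrightarrow> l) (at_left b)"
          proof (rule Lim_transform_eventually[OF l(1)])
            show "\<forall>\<^sub>F x in at_left b. Y x = Z x"
              by (auto simp: Z_def eventually_at_filter)
          qed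
          then show ?thesis
            using 2 \<open>a < b\<close> by (simp add: continuous_within at_within_Icc_at_left Z_def)
        next
          case 3
          then have "t \<notin> C" using True by auto
          then obtain d where "(Y has_real_derivative d) (at t)"
            using less.prems(3)[of t] 3 by blast
          then have "(Z has_real_derivative d) (at t)"
            by (rule has_field_derivative_transform_within_open[of _ _ _ "{a<..<b}"])
              (use 3 in \<open>auto simp: Z_def\<close>)
          then show ?thesis
            by (meson DERIV_isCont continuous_at_imp_continuous_at_within)
        qed
      qed
      have "Z b \<le> Z a"
      proof (rule DERIV_nonpos_imp_decreasing_open[OF less_imp_le[OF \<open>a < b\<close>] _ cont])
        fix t assume t: "a < t" "t < b"
        then have "t \<notin> C" using True by auto
        then obtain d where d: "(Y has_real_derivative d) (at t)" "d \<le> 0"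
          using less.prems(3)[of t] t by blast
        have "(Z has_real_derivative d) (at t)"
          by (rule has_field_derivative_transform_within_open[OF d(1), of "{a<..<b}"])
            (use t in \<open>auto simp: Z_def\<close>)
        with d show "\<exists>y. (Z has_real_derivative y) (at t) \<and> y \<le> 0" by blast
      qed
      then show ?thesis using l \<open>a < b\<close> by (simp add: Z_def)
    qed auto
  next
    case False
    then obtain c where c: "c \<in> C" "a < c" "c < b" by auto
    have sub: "C \<inter> {a<..<c} \<subset> C \<inter> {a<..<b}" "C \<inter> {c<..<b} \<subset> C \<inter> {a<..<b}"
      using c by auto
    have "card (C \<inter> {a<..<c}) < card (C \<inter> {a<..<b})" "card (C \<inter> {c<..<b}) < card (C \<inter> {a<..<b})"
      using sub \<open>finite C\<close> by (auto intro!: psubset_card_mono)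
    then have "Y c \<le> Y a" "Y b \<le> Y c"
      using less.hyps[of a c] less.hyps[of c b] less.prems c by auto
    then show ?thesis by simp
  qed
qed

text \<open>\<open>N\<close> is a clock that absorbs both the part of \<open>z'\<close> without a
  uniform bound and the jumps of \<open>z\<close>. The quantity
  \<open>exp (- a * t) * norm (z t) - c * N t\<close> is nonincreasing, up to a regularisation of
  the norm.\<close>

lemma gronwall_with_jumps:
  fixes z :: "real \<Rightarrow> 'a::real_inner" and N :: "real \<Rightarrow> real"
  assumes C: "finite C" and b: "0 \<le> b" and a: "0 \<le> a" and c: "0 \<le> c" and \<eta>: "0 < \<eta>"
    and der: "\<And>t. 0 < t \<Longrightarrow> t < b \<Longrightarrow> t \<notin> C \<Longrightarrow>
      \<exists>z' N'. (z has_vector_derivative z') (at t) \<and> (N has_real_derivative N') (at t) \<and>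
        norm z' \<le> a * norm (z t) + c * N' \<and> 0 \<le> N'"
    and right: "\<And>t. 0 \<le> t \<Longrightarrow> t < b \<Longrightarrow> (z \<longlongrightarrow> z t) (at_right t) \<and> (N \<longlongrightarrow> N t) (at_right t)"
    and left: "\<And>t. 0 < t \<Longrightarrow> t \<le> b \<Longrightarrow>
      \<exists>zl Nl. (z \<longlongrightarrow> zl) (at_left t) \<and> (N \<longlongrightarrow> Nl) (at_left t) \<and> norm (z t - zl) \<le> c * (N t - Nl)"
  shows "norm (z b) \<le> exp (a * b) * (norm (z 0) + \<eta> + c * (N b - N 0))"
proof -
  \<comment> \<open>The norm is not differentiable at 0. With \<open>\<eta>\<close> it becomes the
    norm of \<open>(u, \<eta>)\<close>, which is smooth in \<open>u\<close>, still 1-Lipschitz, and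
    larger by at most \<open>\<eta>\<close>.\<close>
  define y where "y = (\<lambda>u::'a. sqrt (u \<bullet> u + \<eta>\<^sup>2))"
  have y_pos: "0 < u \<bullet> u + \<eta>\<^sup>2" for u :: 'a
    using \<eta> by (simp add: add_nonneg_pos)
  have y_eq: "y u = norm (u, \<eta>)" for u
    by (simp add: y_def norm_Pair power2_norm_eq_inner)
  have y_ge: "norm u \<le> y u" for u
    unfolding y_eq using norm_fst_le[of u \<eta>] by simp
  have y_le: "y u \<le> norm u + \<eta>" for u
    unfolding y_eq using norm_Pair_le[of u \<eta>] \<eta> by simp
  have y_lip: "y u \<le> y v + norm (u - v)" for u v
    unfolding y_eq using norm_triangle_ineq[of "(v, \<eta>)" "(u - v, 0)"] by simp
  define Y where "Y = (\<lambda>t. exp (- a * t) * y (z t) - c * N t)"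
  have tends: "(Y \<longlongrightarrow> exp (- a * t) * y u - c * n) F"
    if "(z \<longlongrightarrow> u) F" "(N \<longlongrightarrow> n) F" "filterlim (\<lambda>x. x) (nhds t) F" for u n t F
    unfolding Y_def y_def by (intro tendsto_intros that)
  have "Y b \<le> Y 0"
  proof (rule nonincreasing_with_jumps[OF C b])
    fix t assume t: "0 < t" "t < b" "t \<notin> C"
    then obtain z' N' where d: "(z has_vector_derivative z') (at t)" "(N has_real_derivative N') (at t)"
        "norm z' \<le> a * norm (z t) + c * N'" "0 \<le> N'"
      using der by blast
    have "((\<lambda>t. z t \<bullet> z t + \<eta>\<^sup>2) has_real_derivative 2 * (z t \<bullet> z')) (at t)"
      unfolding has_field_derivative_def
      by (rule derivative_eq_intros d(1)[unfolded has_vector_derivative_def] refl)+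
        (auto simp: fun_eq_iff inner_commute)
    from DERIV_chain2[OF DERIV_real_sqrt[OF y_pos[of "z t"]] this]
    have yd: "((\<lambda>t. y (z t)) has_real_derivative (z t \<bullet> z') / y (z t)) (at t)"
      by (simp add: y_def field_simps)
    have le: "(z t \<bullet> z') / y (z t) \<le> a * y (z t) + c * N'"
    proof -
      have p: "0 < y (z t)" using y_pos by (simp add: y_def)
      have "z t \<bullet> z' \<le> norm (z t) * norm z'" by (rule norm_cauchy_schwarz)
      also have "\<dots> \<le> y (z t) * norm z'" by (intro mult_right_mono y_ge) auto
      finally have "(z t \<bullet> z') / y (z t) \<le> norm z'" using p by (simp add: field_simps)
      also have "\<dots> \<le> a * y (z t) + c * N'" using d(3) mult_left_mono[OF y_ge[of "z t"] a] by linarith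
      finally show ?thesis .
    qed
    have "(Y has_real_derivative exp (- a * t) * ((z t \<bullet> z') / y (z t)) - a * exp (- a * t) * y (z t) - c * N') (at t)"
      unfolding Y_def by (rule derivative_eq_intros yd d(2) refl)+ (simp add: algebra_simps)
    moreover have "exp (- a * t) * ((z t \<bullet> z') / y (z t)) \<le> exp (- a * t) * (a * y (z t) + c * N')"
      by (intro mult_left_mono le) auto
    \<comment> \<open>The discount is at most 1 and \<open>N'\<close> is nonnegative, so
      \<open>N\<close> may enter \<open>Y\<close> undiscounted.\<close>
    moreover have "exp (- a * t) * (c * N') \<le> 1 * (c * N')"
      by (intro mult_right_mono) (use a t c d(4) in auto)
    ultimately show "\<exists>d. (Y has_real_derivative d) (at t) \<and> d \<le> 0"
      by (intro exI conjI) (auto simp: algebra_simps)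
  next
    fix t assume t: "0 \<le> t" "t < b"
    show "(Y \<longlongrightarrow> Y t) (at_right t)"
      using tends[of "z t" "at_right t" "N t" t] right[OF t] by (simp add: Y_def filterlim_at_within_not_equal tendsto_ident_at)
  next
    fix t assume t: "0 < t" "t \<le> b"
    then obtain zl Nl where l: "(z \<longlongrightarrow> zl) (at_left t)" "(N \<longlongrightarrow> Nl) (at_left t)" "norm (z t - zl) \<le> c * (N t - Nl)"
      using left by blast
    have "exp (- a * t) * y (z t) \<le> exp (- a * t) * (y zl + norm (z t - zl))"
      by (intro mult_left_mono y_lip) auto
    also have "\<dots> \<le> exp (- a * t) * y zl + 1 * norm (z t - zl)"
      unfolding distrib_left by (intro add_left_mono mult_right_mono) (use a t in auto)
    finally have "Y t \<le> exp (- a * t) * y zl - c * Nl"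
      using l(3) by (simp add: Y_def algebra_simps)
    moreover have "(Y \<longlongrightarrow> exp (- a * t) * y zl - c * Nl) (at_left t)"
      using tends[OF l(1,2)] by (simp add: tendsto_ident_at)
    ultimately show "\<exists>l. (Y \<longlongrightarrow> l) (at_left t) \<and> Y t \<le> l" by blast
  qed
  then have "exp (- a * b) * y (z b) - c * N b \<le> y (z 0) - c * N 0"
    by (simp add: Y_def)
  then have "exp (- a * b) * norm (z b) - c * N b \<le> norm (z 0) + \<eta> - c * N 0"
    using y_le[of "z 0"] mult_left_mono[OF y_ge[of "z b"], of "exp (- a * b)", OF exp_ge_zero]
    by linarith
  then have "exp (- a * b) * norm (z b) \<le> norm (z 0) + \<eta> + c * (N b - N 0)"
    by (simp add: algebra_simps)
  from mult_left_mono[OF this exp_ge_zero[of "a * b"]] show ?thesis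
    by (simp add: exp_minus field_simps)
qed

text \<open>\<open>z\<close> is a corrected copy of \<open>h\<close> at distance
  O(\<open>\<epsilon>\<close>). Its drift differs from \<open>\<epsilon> * H (h t)\<close> by
  O(\<open>\<epsilon>\<^sup>2\<close>) per unit of the clock \<open>N\<close>, and the clock
  advances by O(\<open>1 / \<epsilon>\<close>), so the accumulated error is again
  O(\<open>\<epsilon>\<close>).\<close>

lemma averaging_estimate:
  fixes h z :: "real \<Rightarrow> 'a::real_inner"
  assumes \<Lambda>: "0 \<le> \<Lambda>" and lip: "\<And>h h'. h \<in> G \<Longrightarrow> h' \<in> G \<Longrightarrow> norm (H h - H h') \<le> \<Lambda> * norm (h - h')"
    and \<epsilon>: "0 < \<epsilon>" and \<tau>: "0 \<le> \<tau>" "\<tau> \<le> T" and C: "finite C"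
    and K: "0 \<le> K1" "0 \<le> K2"
    and hG: "\<And>t. 0 \<le> t \<Longrightarrow> t < \<tau> / \<epsilon> \<Longrightarrow> h t \<in> G"
    and hbG: "\<And>\<sigma>. 0 \<le> \<sigma> \<Longrightarrow> \<sigma> < \<tau> \<Longrightarrow> hb \<sigma> \<in> G"
    and hb: "\<And>\<sigma>. \<sigma> \<in> {0..\<tau>} \<Longrightarrow> (hb has_vector_derivative H (hb \<sigma>)) (at \<sigma> within {0..\<tau>})"
    and hb0: "hb 0 = h 0"
    and near: "\<And>t. 0 \<le> t \<Longrightarrow> t \<le> \<tau> / \<epsilon> \<Longrightarrow> norm (z t - h t) \<le> \<epsilon> * K1"
    and der: "\<And>t. 0 < t \<Longrightarrow> t < \<tau> / \<epsilon> \<Longrightarrow> t \<notin> C \<Longrightarrow> \<exists>z' N'. (z has_vector_derivative z') (at t) \<and>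
      (N has_real_derivative N') (at t) \<and> 1 \<le> N' \<and> norm (z' - \<epsilon> *\<^sub>R H (h t)) \<le> \<epsilon>\<^sup>2 * K2 * N'"
    and right: "\<And>t. 0 \<le> t \<Longrightarrow> t < \<tau> / \<epsilon> \<Longrightarrow> (z \<longlongrightarrow> z t) (at_right t) \<and> (N \<longlongrightarrow> N t) (at_right t)"
    and left: "\<And>t. 0 < t \<Longrightarrow> t \<le> \<tau> / \<epsilon> \<Longrightarrow> \<exists>zl Nl. (z \<longlongrightarrow> zl) (at_left t) \<and> (N \<longlongrightarrow> Nl) (at_left t) \<and>
       norm (z t - zl) \<le> \<epsilon>\<^sup>2 * K2 * (N t - Nl) \<and> Nl \<le> N t"
    and N: "N (\<tau> / \<epsilon>) - N 0 \<le> K3 / \<epsilon>"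
  shows "norm (h (\<tau> / \<epsilon>) - hb \<tau>) \<le> (exp (\<Lambda> * T) * (K1 + 1 + (\<Lambda> * K1 + K2) * \<bar>K3\<bar>) + K1) * \<epsilon>"
proof -
  define u where "u t = z t - hb (\<epsilon> * t)" for t
  \<comment> \<open>The part \<open>\<Lambda> * K1\<close> pays for evaluating \<open>H\<close> at
    \<open>h\<close> instead of \<open>z\<close>, whereas \<open>K2\<close> comes from the equation
    for \<open>z\<close>.\<close>
  define cc where "cc = \<epsilon>\<^sup>2 * (\<Lambda> * K1 + K2)"
  have cc: "0 \<le> cc" "\<epsilon>\<^sup>2 * K2 \<le> cc" using \<Lambda> K by (auto simp: cc_def intro!: mult_left_mono)
  have mul: "\<epsilon> * t \<in> {0..\<tau>}" if "0 \<le> t" "t \<le> \<tau> / \<epsilon>" for t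
    using that \<epsilon> by (simp add: field_simps)
  have hbc: "continuous_on {0..\<tau> / \<epsilon>} (\<lambda>t. hb (\<epsilon> * t))"
  proof (rule continuous_on_compose2[where g = hb and t = "{0..\<tau>}"])
    show "continuous_on {0..\<tau>} hb"
      using hb continuous_on_eq_continuous_within has_vector_derivative_continuous by blast
  qed (use mul in \<open>auto intro!: continuous_intros\<close>)
  have hbl: "((\<lambda>t. hb (\<epsilon> * t)) \<longlongrightarrow> hb (\<epsilon> * t)) (at_left t)" if "0 < t" "t \<le> \<tau> / \<epsilon>" for t
  proof -
    have "((\<lambda>t. hb (\<epsilon> * t)) \<longlongrightarrow> hb (\<epsilon> * t)) (at t within {0..t})"
      using continuous_on_subset[OF hbc, of "{0..t}"] that by (auto simp: continuous_on_def)
    then show ?thesis using that by (simp add: at_within_Icc_at_left)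
  qed
  have hbr: "((\<lambda>t. hb (\<epsilon> * t)) \<longlongrightarrow> hb (\<epsilon> * t)) (at_right t)" if "0 \<le> t" "t < \<tau> / \<epsilon>" for t
  proof -
    have "((\<lambda>t. hb (\<epsilon> * t)) \<longlongrightarrow> hb (\<epsilon> * t)) (at t within {t..\<tau> / \<epsilon>})"
      using continuous_on_subset[OF hbc, of "{t..\<tau> / \<epsilon>}"] that by (auto simp: continuous_on_def)
    then show ?thesis using that by (simp add: at_within_Icc_at_right)
  qed
  \<comment> \<open>Gronwall is applied with \<open>\<eta> = \<epsilon>\<close>, the origin of the
    summand 1 next to \<open>K1\<close> in the conclusion.\<close>
  have gron: "norm (u (\<tau> / \<epsilon>)) \<le> exp (\<epsilon> * \<Lambda> * (\<tau> / \<epsilon>)) * (norm (u 0) + \<epsilon> + cc * (N (\<tau> / \<epsilon>) - N 0))"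
  proof (rule gronwall_with_jumps[OF C])
    fix t assume t: "0 < t" "t < \<tau> / \<epsilon>" "t \<notin> C"
    obtain z' N' where d: "(z has_vector_derivative z') (at t)" "(N has_real_derivative N') (at t)" "1 \<le> N'"
      "norm (z' - \<epsilon> *\<^sub>R H (h t)) \<le> \<epsilon>\<^sup>2 * K2 * N'"
      using der[OF t] by blast
    have et: "0 < \<epsilon> * t" "\<epsilon> * t < \<tau>" using t \<epsilon> by (auto simp: field_simps)
    have "(hb has_vector_derivative H (hb (\<epsilon> * t))) (at (\<epsilon> * t))"
      using hb[of "\<epsilon> * t"] et at_within_interior[of "\<epsilon> * t" "{0..\<tau>}"] by simp
    then have "((\<lambda>t. hb (\<epsilon> * t)) has_vector_derivative \<epsilon> *\<^sub>R H (hb (\<epsilon> * t))) (at t)"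
      using vector_diff_chain_at[of "\<lambda>t. \<epsilon> * t" \<epsilon> t hb] has_vector_derivative_mult_right[of "\<lambda>t. t" 1 "at t" \<epsilon>]
      by (simp add: o_def)
    then have "(u has_vector_derivative z' - \<epsilon> *\<^sub>R H (hb (\<epsilon> * t))) (at t)"
      unfolding u_def by (intro has_vector_derivative_diff d(1))
    moreover have "norm (z' - \<epsilon> *\<^sub>R H (hb (\<epsilon> * t))) \<le> \<epsilon> * \<Lambda> * norm (u t) + cc * N'"
    proof -
      have "norm (h t - hb (\<epsilon> * t)) \<le> norm (z t - h t) + norm (u t)"
        unfolding u_def using norm_triangle_ineq4[of "z t - hb (\<epsilon> * t)" "z t - h t"] by simp
      then have hh: "norm (h t - hb (\<epsilon> * t)) \<le> norm (u t) + \<epsilon> * K1"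
        using near[of t] t by simp
      have "norm (H (h t) - H (hb (\<epsilon> * t))) \<le> \<Lambda> * norm (h t - hb (\<epsilon> * t))"
        by (rule lip) (use hG[of t] hbG[of "\<epsilon> * t"] t et in auto)
      also have "\<dots> \<le> \<Lambda> * (norm (u t) + \<epsilon> * K1)" by (rule mult_left_mono[OF hh \<Lambda>])
      finally have "\<epsilon> * norm (H (h t) - H (hb (\<epsilon> * t))) \<le> \<epsilon> * (\<Lambda> * (norm (u t) + \<epsilon> * K1))"
        using \<epsilon> by simp
      moreover have "norm (z' - \<epsilon> *\<^sub>R H (hb (\<epsilon> * t))) \<le> norm (z' - \<epsilon> *\<^sub>R H (h t)) + \<epsilon> * norm (H (h t) - H (hb (\<epsilon> * t)))"
      proof -
        have "z' - \<epsilon> *\<^sub>R H (hb (\<epsilon> * t)) = (z' - \<epsilon> *\<^sub>R H (h t)) + \<epsilon> *\<^sub>R (H (h t) - H (hb (\<epsilon> * t)))"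
          by (simp add: algebra_simps)
        then show ?thesis
          using norm_triangle_ineq[of "z' - \<epsilon> *\<^sub>R H (h t)" "\<epsilon> *\<^sub>R (H (h t) - H (hb (\<epsilon> * t)))"] \<epsilon>
          by (simp only: norm_scaleR abs_of_pos)
      qed
      \<comment> \<open>\<open>1 \<le> N'\<close> lets the clock also pay for an error that is just
        \<open>\<epsilon>\<^sup>2\<close> times a constant.\<close>
      moreover have "\<epsilon> * \<Lambda> * (\<epsilon> * K1) \<le> \<epsilon>\<^sup>2 * (\<Lambda> * K1) * N'"
        using mult_left_mono[OF d(3), of "\<epsilon>\<^sup>2 * (\<Lambda> * K1)"] \<Lambda> K by (simp add: power2_eq_square mult_ac)
      ultimately show ?thesis using d(4) by (simp add: cc_def algebra_simps)
    qed
    ultimately show "\<exists>z' N'. (u has_vector_derivative z') (at t) \<and> (N has_real_derivative N') (at t) \<and>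
        norm z' \<le> \<epsilon> * \<Lambda> * norm (u t) + cc * N' \<and> 0 \<le> N'"
      using d by (intro exI[of _ "z' - \<epsilon> *\<^sub>R H (hb (\<epsilon> * t))"] exI[of _ N']) auto
  next
    fix t assume t: "0 \<le> t" "t < \<tau> / \<epsilon>"
    show "(u \<longlongrightarrow> u t) (at_right t) \<and> (N \<longlongrightarrow> N t) (at_right t)"
      unfolding u_def using right[OF t] hbr[OF t] by (auto intro: tendsto_diff)
  next
    fix t assume t: "0 < t" "t \<le> \<tau> / \<epsilon>"
    obtain zl Nl where j: "(z \<longlongrightarrow> zl) (at_left t)" "(N \<longlongrightarrow> Nl) (at_left t)" "norm (z t - zl) \<le> \<epsilon>\<^sup>2 * K2 * (N t - Nl)" "Nl \<le> N t"
      using left[OF t] by blast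
    have "\<epsilon>\<^sup>2 * K2 * (N t - Nl) \<le> cc * (N t - Nl)"
      by (rule mult_right_mono[OF cc(2)]) (use j in simp)
    then show "\<exists>zl Nl. (u \<longlongrightarrow> zl) (at_left t) \<and> (N \<longlongrightarrow> Nl) (at_left t) \<and> norm (u t - zl) \<le> cc * (N t - Nl)"
      unfolding u_def using j hbl[OF t]
      by (intro exI[of _ "zl - hb (\<epsilon> * t)"] exI[of _ Nl]) (auto intro!: tendsto_diff)
  qed (use \<epsilon> \<tau> \<Lambda> cc in auto)
  note gron
  also have "exp (\<epsilon> * \<Lambda> * (\<tau> / \<epsilon>)) * (norm (u 0) + \<epsilon> + cc * (N (\<tau> / \<epsilon>) - N 0)) \<le> exp (\<Lambda> * T) * (\<epsilon> * K1 + \<epsilon> + \<epsilon> * ((\<Lambda> * K1 + K2) * \<bar>K3\<bar>))"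
  proof (rule mult_mono)
    have "\<epsilon> * \<Lambda> * (\<tau> / \<epsilon>) = \<Lambda> * \<tau>" using \<epsilon> by simp
    then show "exp (\<epsilon> * \<Lambda> * (\<tau> / \<epsilon>)) \<le> exp (\<Lambda> * T)"
      using \<Lambda> \<tau> by (simp add: mult_left_mono)
    have u0: "norm (u 0) \<le> \<epsilon> * K1" using near[of 0] \<epsilon> \<tau> by (simp add: u_def hb0)
    have "cc * (N (\<tau> / \<epsilon>) - N 0) \<le> cc * (\<bar>K3\<bar> / \<epsilon>)"
      using N \<epsilon> cc(1) by (intro mult_left_mono) (auto intro!: order_trans[OF N] divide_right_mono)
    also have "\<dots> = \<epsilon> * ((\<Lambda> * K1 + K2) * \<bar>K3\<bar>)" using \<epsilon> by (simp add: cc_def power2_eq_square)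
    finally show "norm (u 0) + \<epsilon> + cc * (N (\<tau> / \<epsilon>) - N 0) \<le> \<epsilon> * K1 + \<epsilon> + \<epsilon> * ((\<Lambda> * K1 + K2) * \<bar>K3\<bar>)"
      using u0 by simp
    \<comment> \<open>Nonnegativity of the bracket comes for free from the Gronwall bound, whose
      left side is a norm; the increment of \<open>N\<close> need not be examined.\<close>
    have "0 \<le> norm (u (\<tau> / \<epsilon>))" by simp
    then have "0 \<le> exp (\<epsilon> * \<Lambda> * (\<tau> / \<epsilon>)) * (norm (u 0) + \<epsilon> + cc * (N (\<tau> / \<epsilon>) - N 0))"
      using gron by (rule order_trans)
    then show "0 \<le> norm (u 0) + \<epsilon> + cc * (N (\<tau> / \<epsilon>) - N 0)"
      by (simp add: zero_le_mult_iff)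
  qed auto
  finally have u: "norm (u (\<tau> / \<epsilon>)) \<le> exp (\<Lambda> * T) * (K1 + 1 + (\<Lambda> * K1 + K2) * \<bar>K3\<bar>) * \<epsilon>"
    by (simp add: algebra_simps)
  have "norm (h (\<tau> / \<epsilon>) - hb \<tau>) \<le> norm (u (\<tau> / \<epsilon>)) + norm (z (\<tau> / \<epsilon>) - h (\<tau> / \<epsilon>))"
    unfolding u_def using \<epsilon> norm_triangle_ineq4[of "z (\<tau> / \<epsilon>) - hb \<tau>" "z (\<tau> / \<epsilon>) - h (\<tau> / \<epsilon>)"] by simp
  also have "\<dots> \<le> exp (\<Lambda> * T) * (K1 + 1 + (\<Lambda> * K1 + K2) * \<bar>K3\<bar>) * \<epsilon> + \<epsilon> * K1"
    using near[of "\<tau> / \<epsilon>"] \<epsilon> \<tau> by (intro add_mono u) auto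
  finally show ?thesis by (simp add: algebra_simps)
qed

subsection \<open>The time map of the potential\<close>

locale soft_core =
  fixes \<kappa> :: "real \<Rightarrow> real"
  assumes ok: "kappa_ok \<kappa>"
begin

abbreviation dk :: "real \<Rightarrow> real" where "dk \<equiv> deriv \<kappa>"
abbreviation ddk :: "real \<Rightarrow> real" where "ddk \<equiv> deriv (deriv \<kappa>)"

lemma DERIV_kappa: "(\<kappa> has_real_derivative dk x) (at x)"
  and DERIV_dk: "(dk has_real_derivative ddk x) (at x)"
  and continuous_on_ddk: "continuous_on UNIV ddk"
  and kappa_zero: "1 \<le> x \<Longrightarrow> \<kappa> x = 0"
  and dk_neg: "x < 1 \<Longrightarrow> dk x < 0"
  using ok unfolding kappa_ok_def by auto

lemma continuous_on_kappa: "continuous_on S \<kappa>"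
  using DERIV_kappa DERIV_isCont continuous_at_imp_continuous_on by blast

lemma continuous_on_dk: "continuous_on S dk"
  using DERIV_dk DERIV_isCont continuous_at_imp_continuous_on by blast

lemma has_real_derivative_kappa_compose:
  "(f has_real_derivative f') (at t within S) \<Longrightarrow>
    ((\<lambda>t. \<kappa> (f t)) has_real_derivative dk (f t) * f') (at t within S)"
  by (rule DERIV_chain2[OF DERIV_kappa])

lemma kappa_less:
  assumes "x < y" "x < 1" shows "\<kappa> y < \<kappa> x"
proof -
  \<comment> \<open>The derivative is strictly negative only below 1, and past 1 the function stays
    0; hence the comparison at \<open>min y 1\<close>.\<close>
  have *: "\<kappa> (min y 1) < \<kappa> x"
    by (rule DERIV_neg_imp_decreasing_open) (use assms DERIV_kappa dk_neg continuous_on_kappa in force)+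
  show ?thesis
  proof (cases "y \<le> 1")
    case False
    then show ?thesis using * kappa_zero[of y] kappa_zero[of 1] by (simp add: min_def)
  qed (use * in \<open>simp add: min_def\<close>)
qed

lemma kappa_antimono: "x \<le> y \<Longrightarrow> \<kappa> y \<le> \<kappa> x"
  using kappa_less[of x y] kappa_zero[of x] kappa_zero[of y] by (cases "x < 1"; cases "x = y") auto

lemma kappa_nonneg: "0 \<le> \<kappa> x"
  using kappa_antimono[of x "max x 1"] kappa_zero[of "max x 1"] by simp

lemma kappa_pos: "x < 1 \<Longrightarrow> 0 < \<kappa> x"
  using kappa_less[of x 1] kappa_zero[of 1] by simp

text \<open>Every such point is a global minimum of the nonnegative \<open>\<kappa>\<close>. This
  includes \<open>x = 1\<close>, where the sign condition on the derivative is silent.\<close>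

lemma dk_zero: "1 \<le> x \<Longrightarrow> dk x = 0"
  by (rule DERIV_local_min[OF DERIV_kappa zero_less_one]) (simp add: kappa_zero kappa_nonneg)

lemma dk_nonpos: "dk x \<le> 0"
  using dk_zero[of x] dk_neg[of x] by (cases "x < 1") auto

lemma kinv_kappa: "0 \<le> q \<Longrightarrow> q \<le> 1 \<Longrightarrow> kinv \<kappa> (\<kappa> q) = q"
  unfolding kinv_def
proof (rule the_equality)
  fix x assume "0 \<le> q" "q \<le> 1" "x \<in> {0..1} \<and> \<kappa> x = \<kappa> q"
  then show "x = q"
    using kappa_less[of x q] kappa_less[of q x] by (cases x q rule: linorder_cases) auto
qed auto

lemma kinv_bounds:
  assumes "0 < E" "E < \<kappa> 0"
  shows "0 < kinv \<kappa> E" "kinv \<kappa> E < 1" "\<kappa> (kinv \<kappa> E) = E"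
proof -
  obtain x where x: "0 \<le> x" "x \<le> 1" "\<kappa> x = E"
    using IVT2'[of \<kappa> 1 E 0] assms kappa_zero[of 1] continuous_on_kappa by auto
  then have "kinv \<kappa> E = x" using kinv_kappa by auto
  moreover have "x \<noteq> 0" "x \<noteq> 1" using x assms kappa_zero[of 1] by auto
  ultimately show "0 < kinv \<kappa> E" "kinv \<kappa> E < 1" "\<kappa> (kinv \<kappa> E) = E"
    using x by auto
qed

text \<open>For positive energy the turning point lies below 1, where the derivative of
  \<open>\<kappa>\<close> is nonzero. As \<open>E\<close> tends to 0 the turning point tends to 1
  and the formula degenerates, which is why \<open>hh\<close> carries a cutoff.\<close>

lemma DERIV_kinv:
  assumes E: "0 < E" "E < \<kappa> 0"
  shows "(kinv \<kappa> has_real_derivative inverse (dk (kinv \<kappa> E))) (at E)"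
proof (rule DERIV_inverse_function[where f = \<kappa> and a = 0 and b = "\<kappa> 0"])
  define q where "q = kinv \<kappa> E"
  have q: "0 < q" "q < 1" "\<kappa> q = E" using kinv_bounds[OF E] by (auto simp: q_def)
  have "isCont (kinv \<kappa>) (\<kappa> q)"
  proof (rule isCont_inverse_function[where f = \<kappa> and x = q])
    show "0 < min q (1 - q)" using q by simp
    show "kinv \<kappa> (\<kappa> z) = z" if "\<bar>z - q\<bar> \<le> min q (1 - q)" for z
      by (rule kinv_kappa) (use that in auto)
    show "isCont \<kappa> z" for z using DERIV_kappa DERIV_isCont by blast
  qed
  then show "isCont (kinv \<kappa>) E" using q by simp
qed (use E kinv_bounds dk_neg DERIV_kappa in \<open>force\<close>)+

end

section \<open>The cutoff and the two parts of the time since the turning point\<close>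

locale soft_core_band = soft_core +
  fixes e0 e1 :: real
  assumes e0: "0 < e0" and e01: "e0 \<le> e1" and e1: "e1 < \<kappa> 0"
begin

text \<open>A quadratic spline in the potential energy: 0 up to \<open>e0 / 3\<close>, 1 from
  \<open>2 * e0 / 3\<close> on. Value 1 marks the surroundings of the turning point, value 0 the
  outer part of the layer. Squared positive parts make it C1, its derivative being a hat
  function.\<close>

definition cut :: "real \<Rightarrow> real" where
  "cut e = (let u = 3 * e / e0 - 1 in 2 * ((max 0 u)\<^sup>2 - 2 * (max 0 (u - 1/2))\<^sup>2 + (max 0 (u - 1))\<^sup>2))"

definition cut' :: "real \<Rightarrow> real" where
  "cut' e = (let u = 3 * e / e0 - 1 in 12 / e0 * (max 0 u - 2 * max 0 (u - 1/2) + max 0 (u - 1)))"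

lemma DERIV_cut: "(cut has_real_derivative cut' e) (at e)"
proof -
  have p: "((\<lambda>e. (max 0 (3 * e / e0 - 1 - a))\<^sup>2) has_real_derivative 2 * max 0 (3 * e / e0 - 1 - a) * (3 / e0)) (at e)" for a
    by (rule DERIV_chain2[OF has_real_derivative_pos_part_sq]) (use e0 in \<open>auto intro!: derivative_eq_intros\<close>)
  show ?thesis
    unfolding cut_def cut'_def Let_def
    by (rule DERIV_cong[OF DERIV_cmult[OF DERIV_add[OF DERIV_diff[OF p[of 0, simplified] DERIV_cmult[OF p[of "1/2"]]] p[of 1]]]])
      (simp add: algebra_simps)
qed

lemma continuous_on_cut: "continuous_on S cut"
  using DERIV_cut DERIV_isCont continuous_at_imp_continuous_on by blast

lemma continuous_on_cut': "continuous_on S cut'"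
  unfolding cut'_def Let_def by (intro continuous_intros) (use e0 in auto)

lemma cut_zero: "e \<le> e0 / 3 \<Longrightarrow> cut e = 0" and cut'_zero: "e \<le> e0 / 3 \<Longrightarrow> cut' e = 0"
  using e0 by (auto simp: cut_def cut'_def Let_def max_def field_simps)

lemma cut_one:
  assumes "2 * e0 / 3 \<le> e" shows "cut e = 1"
proof -
  define u where "u = 3 * e / e0 - 1"
  have "1 \<le> u" using assms e0 by (simp add: u_def field_simps)
  then show ?thesis
    by (simp add: cut_def Let_def flip: u_def) (simp add: max_def power2_eq_square algebra_simps)
qed

text \<open>The density of time with respect to the velocity, as a function of the potential energy
  and localised by \<open>cut\<close>. It vanishes up to \<open>e0 / 3\<close> and so extends by 0
  to nonpositive arguments, where the derivative of \<open>\<kappa>\<close> vanishes at the turning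
  point or \<open>kinv\<close> has no meaning.\<close>

definition hh :: "real \<Rightarrow> real" where
  "hh e = (if e \<le> 0 then 0 else - 2 * cut e / dk (kinv \<kappa> e))"

definition hh' :: "real \<Rightarrow> real" where
  "hh' e = (if e \<le> 0 then 0 else
     - 2 * cut' e / dk (kinv \<kappa> e) + 2 * cut e * ddk (kinv \<kappa> e) / dk (kinv \<kappa> e) ^ 3)"

lemma hh_zero: "e \<le> e0 / 3 \<Longrightarrow> hh e = 0" and hh'_zero: "e \<le> e0 / 3 \<Longrightarrow> hh' e = 0"
  by (auto simp: hh_def hh'_def cut_zero cut'_zero)

lemma DERIV_hh:
  assumes "e < \<kappa> 0"
  shows "(hh has_real_derivative hh' e) (at e)"
proof (cases "0 < e")
  case True
  note q = kinv_bounds[OF True assms]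
  have "((\<lambda>e. - 2 * cut e / dk (kinv \<kappa> e)) has_real_derivative hh' e) (at e)"
    apply (rule derivative_eq_intros DERIV_cut DERIV_chain2[OF DERIV_dk] DERIV_kinv True assms refl)+
    using dk_neg[OF q(2)] True
    by (auto simp: hh'_def divide_simps power2_eq_square power3_eq_cube)
  then show ?thesis
    by (rule has_field_derivative_transform_within_open[of _ _ _ "{0<..}"]) (use True in \<open>auto simp: hh_def\<close>)
next
  case False
  have "((\<lambda>e. 0) has_real_derivative hh' e) (at e)" using False by (simp add: hh'_def)
  then show ?thesis
    by (rule has_field_derivative_transform_within_open[of _ _ _ "{..<e0 / 3}"])
      (use False e0 in \<open>auto simp: hh_zero\<close>)
qed

text \<open>Two overlapping open sets cover the domain: on one the explicit formula is continuous,
  on the other everything is 0.\<close>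

lemma continuous_on_hh': "continuous_on {..<\<kappa> 0} hh'"
proof -
  have kc: "continuous_on {0<..<\<kappa> 0} (kinv \<kappa>)"
    by (rule continuous_at_imp_continuous_on) (use DERIV_kinv DERIV_isCont in force)
  have nz: "\<forall>e\<in>{0<..<\<kappa> 0}. dk (kinv \<kappa> e) \<noteq> 0"
    using kinv_bounds(2) dk_neg by force
  have "continuous_on {0<..<\<kappa> 0} (\<lambda>e. dk (kinv \<kappa> e))" "continuous_on {0<..<\<kappa> 0} (\<lambda>e. ddk (kinv \<kappa> e))"
    by (rule continuous_on_compose2[OF continuous_on_dk[of UNIV] kc] continuous_on_compose2[OF continuous_on_ddk kc], simp)+
  then have "continuous_on {0<..<\<kappa> 0} (\<lambda>e. - 2 * cut' e / dk (kinv \<kappa> e) + 2 * cut e * ddk (kinv \<kappa> e) / dk (kinv \<kappa> e) ^ 3)"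
    by (intro continuous_on_add continuous_on_divide continuous_on_mult continuous_on_power continuous_on_const
        continuous_on_cut continuous_on_cut') (use nz in auto)
  then have 1: "continuous_on {0<..<\<kappa> 0} hh'"
    by (rule continuous_on_eq) (auto simp: hh'_def)
  have 2: "continuous_on {..<e0 / 3} hh'"
    by (rule continuous_on_eq[of _ "\<lambda>_. 0"]) (auto simp: hh'_zero)
  have "{..<\<kappa> 0} = {0<..<\<kappa> 0} \<union> {..<e0 / 3}"
    using e0 e01 e1 by auto
  then show ?thesis
    using continuous_on_open_Un[OF _ _ 1 2] by simp
qed

lemma continuous_on_hh: "continuous_on {..<\<kappa> 0} hh"
  by (rule continuous_at_imp_continuous_on) (auto intro: DERIV_isCont[OF DERIV_hh])

lemma hh_kappa: "0 < q \<Longrightarrow> q < 1 \<Longrightarrow> hh (\<kappa> q) * dk q = - 2 * cut (\<kappa> q)"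
  using kappa_pos[of q] kinv_kappa[of q] dk_neg[of q] by (simp add: hh_def)

text \<open>At energy \<open>E\<close> this is \<open>(1 - cut) / \<bar>w\<bar>\<close>. Where the
  \<open>min\<close> takes effect the numerator is 0; it merely keeps the root away from 0 for
  \<open>E > 2 * e0 / 3\<close>. Its kink in \<open>q\<close> is harmless, since differentiability
  is required in \<open>E\<close> only.\<close>

definition Psi :: "real \<Rightarrow> real \<Rightarrow> real" where
  "Psi E q = (1 - cut (\<kappa> q)) / sqrt (E - min (\<kappa> q) (2 * e0 / 3))"

definition Psi' :: "real \<Rightarrow> real \<Rightarrow> real" where
  "Psi' E q = - (1 - cut (\<kappa> q)) / (2 * sqrt (E - min (\<kappa> q) (2 * e0 / 3)) ^ 3)"

text \<open>In the units \<open>w = sqrt (m / 2) v\<close>, \<open>q = x / \<delta>\<close> the energy is \<open>E = w\<^sup>2 + \<kappa>(q)\<close> and the motion is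
  \<open>q' = w\<close>, \<open>w' = - \<kappa>'(q) / 2\<close>, whatever the mass and \<open>\<delta>\<close>.
  The time \<open>\<theta>\<close> since the turning point is split by the cutoff: \<open>tA\<close> integrates \<open>dq/w\<close> away from the
  turning point, \<open>tB\<close> integrates \<open>-2 dw/\<kappa>'(q)\<close> away from \<open>q = 1\<close>; both are smooth in the energy.\<close>

definition "tA = prim Psi"
definition "tA' = prim Psi'"
definition "tB = prim (\<lambda>E r. hh (E - r\<^sup>2))"
definition "tB' = prim (\<lambda>E r. hh' (E - r\<^sup>2))"

lemma Psi_pos: "2 * e0 / 3 < E \<Longrightarrow> 0 < E - min (\<kappa> q) (2 * e0 / 3)" by auto

lemma continuous_on_Psi:
  "continuous_on ({2 * e0 / 3<..} \<times> UNIV) (\<lambda>(E, q). Psi E q)"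
  "continuous_on ({2 * e0 / 3<..} \<times> UNIV) (\<lambda>(E, q). Psi' E q)"
  unfolding Psi_def Psi'_def split_beta
  by (intro continuous_intros continuous_on_compose2[OF continuous_on_cut[of UNIV]]
      continuous_on_compose2[OF continuous_on_kappa[of UNIV]]; use Psi_pos in force)+

lemma DERIV_Psi: 
  assumes "2 * e0 / 3 < E"
  shows "((\<lambda>E. Psi E q) has_real_derivative Psi' E q) (at E)"
  unfolding Psi_def Psi'_def
  using Psi_pos[OF assms, of q]
  by (auto intro!: derivative_eq_intros simp: divide_simps power3_eq_cube)

lemma has_real_derivative_tA:
  assumes "2 * e0 / 3 < E t" "(E has_real_derivative E') (at t within S)" "(q has_real_derivative q') (at t within S)"
  shows "((\<lambda>t. tA (E t) (q t)) has_real_derivative tA' (E t) (q t) * E' + Psi (E t) (q t) * q') (at t within S)"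
  unfolding tA_def tA'_def
  by (rule has_real_derivative_prim_compose[where I = "{2 * e0 / 3<..}"])
    (use assms continuous_on_Psi DERIV_Psi in auto)

lemma continuous_on_hh_sq:
  "continuous_on ({..<\<kappa> 0} \<times> UNIV) (\<lambda>(E, r). hh (E - r\<^sup>2))"
  "continuous_on ({..<\<kappa> 0} \<times> UNIV) (\<lambda>(E, r). hh' (E - r\<^sup>2))"
  unfolding split_beta
  by (auto intro!: continuous_intros continuous_on_compose2[OF continuous_on_hh]
      continuous_on_compose2[OF continuous_on_hh'] intro: le_less_trans[rotated])

lemma has_real_derivative_tB:
  assumes "E t < \<kappa> 0" "(E has_real_derivative E') (at t within S)" "(w has_real_derivative w') (at t within S)"
  shows "((\<lambda>t. tB (E t) (w t)) has_real_derivative tB' (E t) (w t) * E' + hh (E t - (w t)\<^sup>2) * w') (at t within S)"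
  unfolding tB_def tB'_def
proof (rule has_real_derivative_prim_compose[where I = "{..<\<kappa> 0}"])
  fix E y assume "E \<in> {..<\<kappa> 0}"
  then have "E - y\<^sup>2 < \<kappa> 0" using zero_le_power2[of y] unfolding lessThan_iff by linarith
  then have "((\<lambda>E. hh (E - y\<^sup>2)) has_real_derivative hh' (E - y\<^sup>2) * 1) (at E)"
    by (intro DERIV_chain2[where f = hh] DERIV_hh) (auto intro!: derivative_eq_intros)
  then show "((\<lambda>E. hh (E - y\<^sup>2)) has_real_derivative hh' (E - y\<^sup>2)) (at E)"
    by simp
qed (use assms continuous_on_hh_sq in auto)

lemma continuous_on_tAB:
  "continuous_on ({2 * e0 / 3<..} \<times> UNIV) (\<lambda>(E, q). tA E q)"
  "continuous_on ({2 * e0 / 3<..} \<times> UNIV) (\<lambda>(E, q). tA' E q)"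
  "continuous_on ({..<\<kappa> 0} \<times> UNIV) (\<lambda>(E, q). tB E q)"
  "continuous_on ({..<\<kappa> 0} \<times> UNIV) (\<lambda>(E, q). tB' E q)"
  unfolding tA_def tA'_def tB_def tB'_def
  by (intro continuous_on_prim continuous_on_Psi continuous_on_hh_sq)+

text \<open>Where the cutoff is 1 the integrand vanishes. Integrating from \<open>q = 0\<close> is
  therefore as good as integrating from the turning point, which would move with
  \<open>E\<close>.\<close>

lemma tA_zero:
  assumes "0 \<le> q" "2 * e0 / 3 \<le> \<kappa> q"
  shows "tA E q = 0" "tA' E q = 0"
proof -
  have "cut (\<kappa> (q * r)) = 1" if "r \<in> {0..1}" for r
    using assms kappa_antimono[of "q * r" q] that by (intro cut_one) (auto simp: mult_left_le)
  then show "tA E q = 0" "tA' E q = 0"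
    unfolding tA_def tA'_def by (auto intro!: prim_vanish simp: Psi_def Psi'_def)
qed

lemma tB_minus: "tB E (- w) = - tB E w"
  by (simp add: tB_def prim_def)

text \<open>Signed time since the turning point, negative on the way in. \<open>tB\<close> is odd in
  \<open>w\<close> by itself; \<open>tA\<close> needs the factor \<open>sgn w\<close>, whose
  discontinuity does no harm at energies of the band, since \<open>tA\<close> vanishes where
  \<open>w\<close> is close to 0.\<close>

definition theta :: "real \<Rightarrow> real \<Rightarrow> real" where
  "theta q w = sgn w * tA (w\<^sup>2 + \<kappa> q) q + tB (w\<^sup>2 + \<kappa> q) w"

text \<open>The partial derivative of \<open>theta\<close> in \<open>w\<close> with \<open>q\<close>
  held fixed, the energy varying along with \<open>w\<close>.\<close>

definition theta' :: "real \<Rightarrow> real \<Rightarrow> real" where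
  "theta' q w = 2 * \<bar>w\<bar> * tA' (w\<^sup>2 + \<kappa> q) q + 2 * w * tB' (w\<^sup>2 + \<kappa> q) w + hh (\<kappa> q)"

text \<open>Here \<open>s\<close> is a clock rate and \<open>\<alpha>\<close> a perturbing
  acceleration. The energy changes only through \<open>\<alpha>\<close>; without it the two parts of
  \<open>theta\<close> advance at the rates \<open>cut * s\<close> and \<open>(1 - cut) * s\<close>,
  together \<open>s\<close>.\<close>

lemma has_real_derivative_theta:
  assumes q: "(q has_real_derivative w t * s) (at t within S)"
    and w: "(w has_real_derivative - dk (q t) / 2 * s + \<alpha>) (at t within S)"
    and t: "t \<in> S"
    and E: "2 * e0 / 3 < (w t)\<^sup>2 + \<kappa> (q t)" "(w t)\<^sup>2 + \<kappa> (q t) < \<kappa> 0"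
  shows "((\<lambda>t. theta (q t) (w t)) has_real_derivative s + \<alpha> * theta' (q t) (w t)) (at t within S)"
proof -
  define E where "E t = (w t)\<^sup>2 + \<kappa> (q t)" for t
  have dE: "(E has_real_derivative 2 * w t * \<alpha>) (at t within S)"
    unfolding E_def
    by (rule derivative_eq_intros w has_real_derivative_kappa_compose[OF q] refl)+ (simp add: algebra_simps)
  have qpos: "0 < q t"
  proof (rule ccontr)
    assume "\<not> 0 < q t"
    then have "\<kappa> 0 \<le> \<kappa> (q t)" by (intro kappa_antimono) simp
    then show False using E(2) zero_le_power2[of "w t"] by linarith
  qed
  have qc: "(q \<longlongrightarrow> q t) (at t within S)" and wc: "(w \<longlongrightarrow> w t) (at t within S)"
    using DERIV_continuous[OF q] DERIV_continuous[OF w] by (simp_all add: continuous_within)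
  have tB: "((\<lambda>t. tB (E t) (w t)) has_real_derivative
      tB' (E t) (w t) * (2 * w t * \<alpha>) + hh (\<kappa> (q t)) * (- dk (q t) / 2 * s + \<alpha>)) (at t within S)"
    using has_real_derivative_tB[of E t, OF _ dE w] E by (simp add: E_def)
  \<comment> \<open>Outside the layer the potential vanishes and with it both sides, so the identity
    holds along the whole path.\<close>
  have hk: "hh (\<kappa> (q t)) * dk (q t) = - 2 * cut (\<kappa> (q t))"
    using hh_kappa[OF qpos] kappa_zero[of "q t"] hh_zero[of 0] cut_zero[of 0] e0 by (cases "q t < 1") auto
  have tA: "((\<lambda>t. sgn (w t) * tA (E t) (q t)) has_real_derivative
      2 * \<bar>w t\<bar> * tA' (E t) (q t) * \<alpha> + (1 - cut (\<kappa> (q t))) * s) (at t within S)"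
  \<comment> \<open>Where the potential energy exceeds \<open>2 * e0 / 3\<close> the term is locally
    0. Elsewhere the total energy forces \<open>w t \<noteq> 0\<close>, and the sign of
    \<open>w\<close> is locally constant.\<close>
  proof (cases "2 * e0 / 3 < \<kappa> (q t)")
    case True
    have "\<forall>\<^sub>F x in at t within S. 0 < q x" "\<forall>\<^sub>F x in at t within S. 2 * e0 / 3 < \<kappa> (q x)"
      using order_tendstoD(1)[OF qc qpos]
        order_tendstoD(1)[OF isCont_tendsto_compose[OF DERIV_isCont[OF DERIV_kappa] qc] True] by auto
    then have ev: "\<forall>\<^sub>F x in at t within S. sgn (w x) * tA (E x) (q x) = 0"
      by eventually_elim (simp add: tA_zero)
    have "((\<lambda>_. 0) has_real_derivative 0) (at t within S)" by simp
    then have "((\<lambda>t. sgn (w t) * tA (E t) (q t)) has_real_derivative 0) (at t within S)"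
      unfolding has_field_derivative_def
      by (rule has_derivative_transform_eventually[where ?x = t])
        (use ev qpos True t in \<open>auto simp: tA_zero elim: eventually_mono\<close>)
    then show ?thesis using True qpos by (simp add: tA_zero cut_one)
  next
    case False
    then have "w t \<noteq> 0" using E by auto
    have ev: "\<forall>\<^sub>F x in at t within S. sgn (w x) = sgn (w t)"
    proof (cases "w t > 0")
      case True
      show ?thesis using order_tendstoD(1)[OF wc True] by eventually_elim (use True in auto)
    next
      case False
      then have neg: "w t < 0" using \<open>w t \<noteq> 0\<close> by simp
      show ?thesis using order_tendstoD(2)[OF wc neg] by eventually_elim (use \<open>w t < 0\<close> in auto)
    qed
    have P: "Psi (E t) (q t) = (1 - cut (\<kappa> (q t))) / \<bar>w t\<bar>"
      using False by (simp add: Psi_def E_def min_def)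
    have "((\<lambda>x. sgn (w t) * tA (E x) (q x)) has_real_derivative
        sgn (w t) * (tA' (E t) (q t) * (2 * w t * \<alpha>) + Psi (E t) (q t) * (w t * s))) (at t within S)"
      using has_real_derivative_tA[of E t, OF _ dE q] E by (intro DERIV_cmult) (simp add: E_def)
    also have "sgn (w t) * (tA' (E t) (q t) * (2 * w t * \<alpha>) + Psi (E t) (q t) * (w t * s))
      = 2 * \<bar>w t\<bar> * tA' (E t) (q t) * \<alpha> + (1 - cut (\<kappa> (q t))) * s"
      unfolding P using \<open>w t \<noteq> 0\<close> by (auto simp: abs_if sgn_if field_simps)
    finally show ?thesis
      unfolding has_field_derivative_def
      by (rule has_derivative_transform_eventually[where ?x = t])
        (use ev t in \<open>auto elim: eventually_mono\<close>)
  qed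
  show ?thesis
    unfolding theta_def theta'_def E_def[symmetric]
    by (rule DERIV_cong[OF DERIV_add[OF tA tB]]) (use hk in \<open>simp add: algebra_simps\<close>)
qed

section \<open>The effective length of a cell\<close>

definition gam :: "real \<Rightarrow> real" where "gam E = tA E 1 + tB E (sqrt E)"
definition gam' :: "real \<Rightarrow> real" where "gam' E = tA' E 1 + tB' E (sqrt E)"
text \<open>Crossing a cell of length \<open>L\<close> takes the scaled time
  \<open>2 * gam E + (L / \<delta> - 2) / sqrt E\<close>: two layers and a free flight in between.
  This equals \<open>(L / \<delta> + beta E) / sqrt E\<close>, so \<open>beta\<close> is a
  correction to the length in units of \<open>\<delta>\<close>.\<close>

definition beta :: "real \<Rightarrow> real" where "beta E = 2 * sqrt E * gam E - 2"
definition beta' :: "real \<Rightarrow> real" where "beta' E = gam E / sqrt E + 2 * sqrt E * gam' E"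

text \<open>The upper limit \<open>sqrt E\<close> moves with \<open>E\<close>, but it contributes
  the factor \<open>hh (E - E) = 0\<close>.\<close>

lemma DERIV_beta:
  assumes "2 * e0 / 3 < E" "E < \<kappa> 0"
  shows "(beta has_real_derivative beta' E) (at E)"
proof -
  have "0 < E" using assms e0 by auto
  have "(gam has_real_derivative gam' E) (at E)"
    unfolding gam_def gam'_def
    using has_real_derivative_tA[of "\<lambda>E. E" E 1 UNIV "\<lambda>_. 1" 0]
      has_real_derivative_tB[of "\<lambda>E. E" E 1 UNIV sqrt, OF _ _ DERIV_real_sqrt[OF \<open>0 < E\<close>]]
      assms \<open>0 < E\<close> hh_zero[of 0] e0
    by (auto intro!: derivative_eq_intros)
  then show ?thesis
    unfolding beta_def beta'_def using \<open>0 < E\<close>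
    by (auto intro!: derivative_eq_intros simp: field_simps)
qed

lemma continuous_on_beta': "continuous_on {2 * e0 / 3<..<\<kappa> 0} beta'"
proof -
  let ?I = "{2 * e0 / 3<..<\<kappa> 0}"
  have "continuous_on ?I (\<lambda>E. tA E 1)" "continuous_on ?I (\<lambda>E. tA' E 1)"
      "continuous_on ?I (\<lambda>E. tB E (sqrt E))" "continuous_on ?I (\<lambda>E. tB' E (sqrt E))"
    by (intro continuous_on_tAB[THEN continuous_on_curried] continuous_intros; simp)+
  then show ?thesis
    unfolding beta'_def gam_def gam'_def
    by (intro continuous_intros) (use e0 in auto)
qed

section \<open>Free motion outside the layer, and the boundary layer corrector\<close>

lemma tA_free:
  assumes E: "2 * e0 / 3 < E" and q: "1 \<le> q"
  shows "tA E q = tA E 1 + (q - 1) / sqrt E"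
proof (cases "q = 1")
  case False
  then have "1 < q" using q by simp
  have c: "continuous_on UNIV (Psi E)"
    by (intro continuous_on_Psi(1)[THEN continuous_on_curried] continuous_intros) (use E in simp)
  have d: "((\<lambda>q. tA E q - q / sqrt E) has_real_derivative Psi E x - 1 / sqrt E) (at x)" for x
    unfolding tA_def
    by (rule DERIV_diff[OF prim_has_real_derivative[where f = Psi and x = E, OF c]]) (rule DERIV_cdivide[OF DERIV_ident])
  have "tA E q - q / sqrt E = tA E 1 - 1 / sqrt E"
  proof (rule DERIV_isconst_end[OF \<open>1 < q\<close>])
    show "continuous_on {1..q} (\<lambda>q. tA E q - q / sqrt E)"
      using d DERIV_isCont continuous_at_imp_continuous_on by blast
    show "((\<lambda>q. tA E q - q / sqrt E) has_real_derivative 0) (at x)" if "1 < x" "x < q" for x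
      using d[of x] that e0 by (simp add: Psi_def kappa_zero cut_zero)
  qed
  then show ?thesis by (simp add: diff_divide_distrib)
qed simp

text \<open>Chosen so that along the unperturbed motion its derivative is
  \<open>2 * \<kappa> q + q * dk q + beta / 2 * dk q\<close>, which is what the virial identity
  lacks inside the layer. Setting it to 0 for \<open>q > 1\<close> frees later bounds from any
  condition on states outside the layer.\<close>

definition rho :: "real \<Rightarrow> real \<Rightarrow> real" where
  "rho q w = (if q \<le> 1 then 2 * (w\<^sup>2 + \<kappa> q) * theta q w - w * (2 * q + beta (w\<^sup>2 + \<kappa> q)) else 0)"

definition rho' :: "real \<Rightarrow> real \<Rightarrow> real" where
  "rho' q w = (if q \<le> 1 then 4 * w * theta q w + 2 * (w\<^sup>2 + \<kappa> q) * theta' q w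
     - (2 * q + beta (w\<^sup>2 + \<kappa> q)) - 2 * w\<^sup>2 * beta' (w\<^sup>2 + \<kappa> q) else 0)"

text \<open>This is the matching condition that determines \<open>beta\<close>: after the exit the
  time is \<open>gam + (q - 1) / \<bar>w\<bar>\<close> up to sign, and with this \<open>beta\<close>
  the two terms of \<open>rho\<close> cancel. Hence the truncation in \<open>rho\<close> creates no
  jump.\<close>

lemma rho_free:
  assumes q: "1 \<le> q" and E: "2 * e0 / 3 < w\<^sup>2"
  shows "2 * w\<^sup>2 * theta q w - w * (2 * q + beta (w\<^sup>2)) = 0"
proof -
  have w: "w \<noteq> 0" using E e0 by auto
  have "tB (w\<^sup>2) w = sgn w * tB (w\<^sup>2) \<bar>w\<bar>"
    using tB_minus[of "w\<^sup>2" "\<bar>w\<bar>"] w by (cases "w < 0") (auto simp: sgn_if)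
  then have "theta q w = sgn w * (gam (w\<^sup>2) + (q - 1) / \<bar>w\<bar>)"
    using q by (simp add: theta_def kappa_zero tA_free[OF E q] gam_def algebra_simps)
  moreover have "w\<^sup>2 * sgn w = w * \<bar>w\<bar>" by (simp add: sgn_if abs_if power2_eq_square)
  ultimately have "2 * w\<^sup>2 * theta q w = 2 * w * \<bar>w\<bar> * (gam (w\<^sup>2) + (q - 1) / \<bar>w\<bar>)"
    by (simp flip: mult.assoc)
  also have "\<dots> = w * (2 * q + beta (w\<^sup>2))"
    using w by (simp add: beta_def field_simps)
  finally show ?thesis by simp
qed

lemma has_real_derivative_rho:
  assumes q: "(q has_real_derivative w t * s) (at t within S)"
    and w: "(w has_real_derivative - dk (q t) / 2 * s + \<alpha>) (at t within S)"
    and t: "t \<in> S"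
    and E: "q t \<le> 1 \<Longrightarrow> e0 \<le> (w t)\<^sup>2 + \<kappa> (q t) \<and> (w t)\<^sup>2 + \<kappa> (q t) \<le> e1"
  shows "((\<lambda>t. rho (q t) (w t)) has_real_derivative
    s * (2 * \<kappa> (q t) + q t * dk (q t) + beta ((w t)\<^sup>2 + \<kappa> (q t)) / 2 * dk (q t)) + \<alpha> * rho' (q t) (w t))
    (at t within S)"
proof (cases "q t \<le> 1")
  case False
  have "(q \<longlongrightarrow> q t) (at t within S)"
    using DERIV_continuous[OF q] by (simp add: continuous_within)
  then have "\<forall>\<^sub>F x in at t within S. 1 < q x"
    using False by (intro order_tendstoD) auto
  then have ev: "\<forall>\<^sub>F x in at t within S. 0 = rho (q x) (w x)"
    by eventually_elim (simp add: rho_def)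
  have "((\<lambda>_. 0) has_real_derivative 0) (at t within S)" by simp
  then have "((\<lambda>t. rho (q t) (w t)) has_real_derivative 0) (at t within S)"
    unfolding has_field_derivative_def
    by (rule has_derivative_transform_eventually[where ?x = t, OF _ ev]) (use False t in \<open>auto simp: rho_def\<close>)
  then show ?thesis
    using False kappa_zero[of "q t"] dk_zero[of "q t"] by (simp add: rho'_def)
next
  case True
  define E where "E t = (w t)\<^sup>2 + \<kappa> (q t)" for t
  have dE: "(E has_real_derivative 2 * w t * \<alpha>) (at t within S)"
    unfolding E_def
    by (rule derivative_eq_intros w has_real_derivative_kappa_compose[OF q] refl)+ (simp add: algebra_simps)
  have Et: "2 * e0 / 3 < E t" "E t < \<kappa> 0" using E[OF True] e0 e1 by (auto simp: E_def)
  have th: "((\<lambda>t. theta (q t) (w t)) has_real_derivative s + \<alpha> * theta' (q t) (w t)) (at t within S)"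
    by (rule has_real_derivative_theta[OF q w t]) (use Et in \<open>auto simp: E_def\<close>)
  have be: "((\<lambda>t. beta (E t)) has_real_derivative beta' (E t) * (2 * w t * \<alpha>)) (at t within S)"
    by (rule DERIV_chain2[OF DERIV_beta[OF Et] dE])
  have "((\<lambda>t. 2 * E t * theta (q t) (w t) - w t * (2 * q t + beta (E t))) has_real_derivative
      s * (2 * \<kappa> (q t) + q t * dk (q t) + beta (E t) / 2 * dk (q t)) + \<alpha> * rho' (q t) (w t)) (at t within S)"
    by (rule derivative_eq_intros th be dE q w refl)+
      (use True in \<open>simp add: rho'_def flip: E_def\<close>, simp add: E_def power2_eq_square algebra_simps)
  \<comment> \<open>At \<open>q t = 1\<close> nearby points may lie outside the layer. By
    \<open>rho_free\<close> the untruncated expression vanishes there too, so near \<open>t\<close>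
    a single formula can be differentiated.\<close>
  moreover have "\<forall>\<^sub>F x in at t within S. 2 * E x * theta (q x) (w x) - w x * (2 * q x + beta (E x)) = rho (q x) (w x)"
  proof -
    have "(E \<longlongrightarrow> E t) (at t within S)"
      using DERIV_continuous[OF dE] by (simp add: continuous_within)
    from order_tendstoD(1)[OF this Et(1)] show ?thesis
    proof eventually_elim
      case (elim x)
      then show ?case
        using rho_free[of "q x" "w x"] kappa_zero[of "q x"] by (cases "q x \<le> 1") (auto simp: rho_def E_def)
    qed
  qed
  ultimately show ?thesis
    unfolding has_field_derivative_def E_def
    by (rule has_derivative_transform_eventually[where ?x = t]) (use t True in \<open>auto simp: rho_def\<close>)
qed

text \<open>The Lipschitz bound will compare the energies of the resting frame and of the piston's
  frame.\<close>

lemma beta_bounds: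
  obtains K where "0 \<le> K" "\<And>E. E \<in> {e0..e1} \<Longrightarrow> \<bar>beta E\<bar> \<le> K" "\<And>E. E \<in> {e0..e1} \<Longrightarrow> \<bar>beta' E\<bar> \<le> K"
    "\<And>E E'. E \<in> {e0..e1} \<Longrightarrow> E' \<in> {e0..e1} \<Longrightarrow> \<bar>beta E - beta E'\<bar> \<le> K * \<bar>E - E'\<bar>"
proof -
  have sub: "{e0..e1} \<subseteq> {2 * e0 / 3<..<\<kappa> 0}" using e0 e1 by auto
  have "continuous_on {e0..e1} beta"
    by (rule continuous_at_imp_continuous_on) (use sub in \<open>auto intro!: DERIV_isCont[OF DERIV_beta]\<close>)
  then obtain K1 where K1: "0 \<le> K1" "\<And>E. E \<in> {e0..e1} \<Longrightarrow> \<bar>beta E\<bar> \<le> K1"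
    using bounded_real_on_compact[OF compact_Icc] by blast
  obtain K2 where K2: "0 \<le> K2" "\<And>E. E \<in> {e0..e1} \<Longrightarrow> \<bar>beta' E\<bar> \<le> K2"
    using bounded_real_on_compact[OF compact_Icc continuous_on_subset[OF continuous_on_beta' sub]] by blast
  have L: "\<bar>beta E - beta E'\<bar> \<le> K2 * \<bar>E - E'\<bar>" if "E \<in> {e0..e1}" "E' \<in> {e0..e1}" for E E'
  proof -
    have "(beta has_real_derivative beta' x) (at x within {e0..e1})" if "x \<in> {e0..e1}" for x
      using that sub by (intro DERIV_subset[OF DERIV_beta]) auto
    then show ?thesis
      using field_differentiable_bound[of "{e0..e1}" beta beta' K2 E E'] K2 that by simp
  qed
  have "\<bar>beta E - beta E'\<bar> \<le> max K1 K2 * \<bar>E - E'\<bar>" if "E \<in> {e0..e1}" "E' \<in> {e0..e1}" for E E'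
    by (rule order_trans[OF L[OF that] mult_right_mono]) auto
  with K1 K2 show thesis
    by (intro that[of "max K1 K2"])
      (auto simp: le_max_iff_disj max_mult_distrib_right)
qed

text \<open>An energy below \<open>\<kappa> 0\<close> forces \<open>q \<ge> 0\<close>, so inside the
  layer \<open>(E, q, w)\<close> ranges over a compact set; outside, both functions are 0.\<close>

lemma rho_bounds:
  obtains K where "0 \<le> K"
    "\<And>q w. (q \<le> 1 \<Longrightarrow> e0 \<le> w\<^sup>2 + \<kappa> q \<and> w\<^sup>2 + \<kappa> q \<le> e1) \<Longrightarrow> \<bar>rho q w\<bar> \<le> K \<and> \<bar>rho' q w\<bar> \<le> K"
proof -
  define r where "r = sqrt e1"
  let ?S = "{e0..e1} \<times> {0..1::real} \<times> {- r..r}"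
  \<comment> \<open>\<open>theta\<close> contains \<open>sgn w\<close> and is not visibly
    continuous. Compactness is therefore applied to majorants built from continuous
    functions.\<close>
  let ?G = "\<lambda>(E, q, w). 2 * E * (\<bar>tA E q\<bar> + \<bar>tB E w\<bar>) + \<bar>w\<bar> * (2 * \<bar>q\<bar> + \<bar>beta E\<bar>)"
  let ?H = "\<lambda>(E, q, w). 4 * \<bar>w\<bar> * (\<bar>tA E q\<bar> + \<bar>tB E w\<bar>)
      + 2 * E * (2 * \<bar>w\<bar> * \<bar>tA' E q\<bar> + 2 * \<bar>w\<bar> * \<bar>tB' E w\<bar> + \<bar>hh (E - w\<^sup>2)\<bar>)
      + (2 * \<bar>q\<bar> + \<bar>beta E\<bar>) + 2 * w\<^sup>2 * \<bar>beta' E\<bar>"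
  have sub: "{e0..e1} \<subseteq> {2 * e0 / 3<..<\<kappa> 0}" using e0 e1 by auto
  have cA: "continuous_on ?S (\<lambda>p. tA (fst p) (fst (snd p)))" "continuous_on ?S (\<lambda>p. tA' (fst p) (fst (snd p)))"
    and cB: "continuous_on ?S (\<lambda>p. tB (fst p) (snd (snd p)))" "continuous_on ?S (\<lambda>p. tB' (fst p) (snd (snd p)))"
    and ch: "continuous_on ?S (\<lambda>p. hh (fst p - (snd (snd p))\<^sup>2))"
    by (intro continuous_on_tAB[THEN continuous_on_curried] continuous_on_hh_sq(1)[THEN continuous_on_curried]
        continuous_intros; use sub in force)+
  have "continuous_on {e0..e1} beta"
    by (rule continuous_at_imp_continuous_on) (use sub in \<open>auto intro!: DERIV_isCont[OF DERIV_beta]\<close>)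
  then have cb: "continuous_on ?S (\<lambda>p. beta (fst p))"
    by (rule continuous_on_compose2) (auto intro!: continuous_intros)
  have cb': "continuous_on ?S (\<lambda>p. beta' (fst p))"
    by (rule continuous_on_compose2[OF continuous_on_subset[OF continuous_on_beta' sub]]) (auto intro!: continuous_intros)
  have comp: "compact ?S" by (intro compact_Times compact_Icc)
  have "continuous_on ?S ?G"
    unfolding split_beta by (intro continuous_intros cA cB cb)
  then obtain K1 where K1: "0 \<le> K1" "\<And>p. p \<in> ?S \<Longrightarrow> \<bar>?G p\<bar> \<le> K1"
    using bounded_real_on_compact[OF comp] by blast
  have "continuous_on ?S ?H"
    unfolding split_beta by (intro continuous_intros cA cB ch cb cb')
  then obtain K2 where K2: "0 \<le> K2" "\<And>p. p \<in> ?S \<Longrightarrow> \<bar>?H p\<bar> \<le> K2"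
    using bounded_real_on_compact[OF comp] by blast
  have "\<bar>rho q w\<bar> \<le> max K1 K2 \<and> \<bar>rho' q w\<bar> \<le> max K1 K2"
    if qw: "q \<le> 1 \<Longrightarrow> e0 \<le> w\<^sup>2 + \<kappa> q \<and> w\<^sup>2 + \<kappa> q \<le> e1" for q w
  proof (cases "q \<le> 1")
    case True
    define E where "E = w\<^sup>2 + \<kappa> q"
    have E: "e0 \<le> E" "E \<le> e1" using qw[OF True] by (auto simp: E_def)
    have q0: "0 \<le> q"
    proof (rule ccontr)
      assume "\<not> 0 \<le> q"
      then have "\<kappa> 0 \<le> \<kappa> q" by (intro kappa_antimono) simp
      then show False using E e1 zero_le_power2[of w] unfolding E_def by linarith
    qed
    have "w\<^sup>2 \<le> e1" using E kappa_nonneg[of q] by (simp add: E_def)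
    then have "\<bar>w\<bar> \<le> r" unfolding r_def by (rule real_le_rsqrt[of "\<bar>w\<bar>", simplified])
    then have mem: "(E, q, w) \<in> ?S" using E q0 True by auto
    have E0: "0 < E" using E e0 by simp
    have th: "\<bar>theta q w\<bar> \<le> \<bar>tA E q\<bar> + \<bar>tB E w\<bar>"
      unfolding theta_def E_def[symmetric]
      by (rule order_trans[OF abs_triangle_ineq]) (auto simp: abs_mult sgn_if)
    have "\<bar>rho q w\<bar> \<le> 2 * E * \<bar>theta q w\<bar> + \<bar>w\<bar> * \<bar>2 * q + beta E\<bar>"
      unfolding rho_def E_def[symmetric] using True E0
      by (auto intro!: order_trans[OF abs_triangle_ineq4] simp: abs_mult)
    also have "\<dots> \<le> ?G (E, q, w)"
      unfolding prod.case
      by (intro add_mono mult_left_mono th order_trans[OF abs_triangle_ineq]) (use E0 in \<open>auto simp: abs_mult\<close>)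
    also have "\<dots> \<le> K1" using K1(2)[OF mem] by (rule order_trans[OF abs_ge_self])
    finally have 1: "\<bar>rho q w\<bar> \<le> K1" .
    have hk: "hh (\<kappa> q) = hh (E - w\<^sup>2)" by (simp add: E_def)
    have th': "\<bar>theta' q w\<bar> \<le> 2 * \<bar>w\<bar> * \<bar>tA' E q\<bar> + 2 * \<bar>w\<bar> * \<bar>tB' E w\<bar> + \<bar>hh (E - w\<^sup>2)\<bar>"
      unfolding theta'_def E_def[symmetric] hk
      by (rule order_trans[OF abs_triangle_ineq] add_mono)+ (auto simp: abs_mult)
    have "\<bar>rho' q w\<bar> \<le> 4 * \<bar>w\<bar> * \<bar>theta q w\<bar> + 2 * E * \<bar>theta' q w\<bar> + \<bar>2 * q + beta E\<bar> + 2 * w\<^sup>2 * \<bar>beta' E\<bar>"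
      unfolding rho'_def E_def[symmetric] using True E0
      by (auto intro!: order_trans[OF abs_triangle_ineq4] order_trans[OF abs_triangle_ineq] add_mono simp: abs_mult)
    also have "\<dots> \<le> ?H (E, q, w)"
      unfolding prod.case
      by (intro add_mono mult_left_mono th th' order_trans[OF abs_triangle_ineq]) (use E0 in \<open>auto simp: abs_mult\<close>)
    also have "\<dots> \<le> K2" using K2(2)[OF mem] by (rule order_trans[OF abs_ge_self])
    finally show ?thesis using 1 by (meson max.coboundedI1 max.coboundedI2)
  qed (use K1 in \<open>auto simp: rho_def rho'_def le_max_iff_disj\<close>)
  then show thesis using that[of "max K1 K2"] K1(1) by (auto simp: le_max_iff_disj)
qed

subsection \<open>The period\<close>

text \<open>The integrand is singular at the turning point, but \<open>theta\<close> on the outgoing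
  branch is a primitive that is continuous up to that point and vanishes there. The fundamental
  theorem with derivatives in the interior then suffices.\<close>

lemma has_integral_time:
  assumes E: "e0 \<le> E" "E \<le> e1" and Q: "1 \<le> Q"
  shows "((\<lambda>q. 1 / sqrt (E - \<kappa> q)) has_integral gam E + (Q - 1) / sqrt E) {kinv \<kappa> E..Q}"
proof -
  have E': "0 < E" "E < \<kappa> 0" "2 * e0 / 3 < E" using E e0 e1 by auto
  note k = kinv_bounds[OF E'(1,2)]
  define F where "F = (\<lambda>q. tA E q + tB E (sqrt (E - \<kappa> q)))"
  have "((\<lambda>q. 1 / sqrt (E - \<kappa> q)) has_integral F Q - F (kinv \<kappa> E)) {kinv \<kappa> E..Q}"
  proof (rule fundamental_theorem_of_calculus_interior)
    have "continuous_on {kinv \<kappa> E..Q} (\<lambda>q. tA E q)"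
        "continuous_on {kinv \<kappa> E..Q} (\<lambda>q. tB E (sqrt (E - \<kappa> q)))"
      by (intro continuous_on_tAB[THEN continuous_on_curried] continuous_intros continuous_on_kappa; use E' in simp)+
    then show "continuous_on {kinv \<kappa> E..Q} F"
      unfolding F_def by (intro continuous_intros)
  next
    fix x assume x: "x \<in> {kinv \<kappa> E<..<Q}"
    have pos: "0 < E - \<kappa> y" if "kinv \<kappa> E < y" for y
      using kappa_less[OF that k(2)] k(3) by simp
    define w where "w = (\<lambda>q. sqrt (E - \<kappa> q))"
    have wp: "0 < w x" "(w x)\<^sup>2 + \<kappa> x = E" using pos[of x] x by (auto simp: w_def)
    \<comment> \<open>Position itself serves as the time parameter: with clock rate
      \<open>1 / w\<close> the equations of motion give \<open>q' = 1\<close>, and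
      \<open>theta\<close> grows at the rate \<open>1 / w\<close>.\<close>
    have "(w has_real_derivative - dk x / 2 * (1 / w x) + 0) (at x)"
      unfolding w_def using pos[of x] x
      by (auto intro!: derivative_eq_intros has_real_derivative_kappa_compose simp: field_simps)
    then have "((\<lambda>q. theta q (w q)) has_real_derivative 1 / w x + 0 * theta' x (w x)) (at x)"
      by (intro has_real_derivative_theta) (use wp E' in auto)
    then have "((\<lambda>q. theta q (w q)) has_real_derivative 1 / w x) (at x)"
      by simp
    then have "(F has_real_derivative 1 / w x) (at x)"
      by (rule has_field_derivative_transform_within_open[of _ _ _ "{kinv \<kappa> E<..}"])
        (use x pos in \<open>force simp: F_def theta_def w_def\<close>)+
    then show "(F has_vector_derivative 1 / sqrt (E - \<kappa> x)) (at x)"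
      by (simp add: has_real_derivative_iff_has_vector_derivative w_def)
  qed (use k Q in simp)
  moreover have "F (kinv \<kappa> E) = 0"
    using k E' e0 by (simp add: F_def tA_zero) (simp add: tB_def prim_def)
  moreover have "F Q = gam E + (Q - 1) / sqrt E"
    using Q by (simp add: F_def kappa_zero gam_def tA_free[OF E'(3) Q])
  ultimately show ?thesis by simp
qed

text \<open>For \<open>Q = 1\<close> the time integral equals \<open>gam E\<close>, which is thus
  nonnegative. The effective length consequently falls short of \<open>L\<close> by at most
  \<open>2 * \<delta>\<close>.\<close>

lemma beta_ge: "e0 \<le> E \<Longrightarrow> E \<le> e1 \<Longrightarrow> - 2 \<le> beta E"
  using has_integral_nonneg[OF has_integral_time[of E 1]] kappa_antimono kinv_bounds[of E] e0 e1
  by (force simp: beta_def)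

text \<open>Only \<open>\<bar>c\<bar>\<close> is prescribed: slope \<open>1 / \<delta>\<close>
  serves the half next to the left end of a cell, slope \<open>- 1 / \<delta>\<close> the mirrored
  half.\<close>

lemma half_period:
  assumes E: "e0 \<le> E" "E \<le> e1" and \<delta>: "0 < \<delta>" "2 * \<delta> \<le> L" and c: "\<bar>c\<bar> = 1 / \<delta>"
  shows "((\<lambda>s. sqrt (m / 2) * (1 / sqrt (E - \<kappa> (c * s + d)))) has_integral
      sqrt (m / 2) * (\<delta> * (gam E + (L / (2 * \<delta>) - 1) / sqrt E)))
    ((\<lambda>q. (q - d) / c) ` {kinv \<kappa> E..L / (2 * \<delta>)})"
proof -
  have "1 \<le> L / (2 * \<delta>)" "c \<noteq> 0" using \<delta> c by (auto simp: field_simps)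
  from has_integral_affinity[OF has_integral_time[OF E this(1), unfolded cbox_interval[symmetric]] this(2), of d]
  have "((\<lambda>s. 1 / sqrt (E - \<kappa> (c * s + d))) has_integral \<delta> * (gam E + (L / (2 * \<delta>) - 1) / sqrt E))
    ((\<lambda>q. (q - d) / c) ` {kinv \<kappa> E..L / (2 * \<delta>)})"
    by (simp add: c diff_divide_distrib)
  then show ?thesis by (rule has_integral_mult_right)
qed

text \<open>With \<open>2 * \<delta> \<le> L\<close> the layers do not overlap, so in each half of
  the cell only the nearer potential is felt. The offset \<open>c\<close> covers both sides of the
  piston, 0 for the left and \<open>X\<close> for the right.\<close>

lemma period_integral:
  assumes E: "e0 \<le> E" "E \<le> e1" and \<delta>: "0 < \<delta>" "2 * \<delta> \<le> L"
  defines "a \<equiv> \<delta> * kinv \<kappa> E"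
  shows "integral {c + a..c + L - a} (\<lambda>s. sqrt ((m / 2) / (E - kd \<kappa> \<delta> (s - c) - kd \<kappa> \<delta> (c + L - s))))
    = 2 * sqrt (m / 2) * (\<delta> * (gam E + (L / (2 * \<delta>) - 1) / sqrt E))"
proof -
  let ?f = "\<lambda>s. sqrt ((m / 2) / (E - kd \<kappa> \<delta> (s - c) - kd \<kappa> \<delta> (c + L - s)))"
  let ?I = "sqrt (m / 2) * (\<delta> * (gam E + (L / (2 * \<delta>) - 1) / sqrt E))"
  have E': "0 < E" "E < \<kappa> 0" using E e0 e1 by auto
  note k = kinv_bounds[OF E']
  have aL: "a \<le> L / 2" using \<delta> mult_left_mono[of "kinv \<kappa> E" 1 \<delta>] k(2) unfolding a_def by linarith
  have sq: "sqrt (m / 2) * (1 / sqrt x) = sqrt (m / 2 / x)" for x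
    by (simp only: real_sqrt_divide times_divide_eq_right mult_1_right)
  have "(\<lambda>q. (q - - c / \<delta>) / (1 / \<delta>)) ` {kinv \<kappa> E..L / (2 * \<delta>)} = {c + a..c + L / 2}"
  proof -
    have "(\<lambda>q. (q - - c / \<delta>) / (1 / \<delta>)) = (\<lambda>q. \<delta> * q + c)" using \<delta> by (auto simp: field_simps)
    moreover have "kinv \<kappa> E \<le> L / (2 * \<delta>)" "\<delta> * (L / (2 * \<delta>)) = L / 2"
      using aL \<delta> by (auto simp: a_def field_simps)
    ultimately show ?thesis
      using \<delta> by (simp only: image_affinity_atLeastAtMost) (simp add: a_def add.commute)
  qed
  then have l: "((\<lambda>s. sqrt (m / 2) * (1 / sqrt (E - \<kappa> (1 / \<delta> * s + - c / \<delta>)))) has_integral ?I) {c + a..c + L / 2}"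
    using half_period[OF E \<delta>, of "1 / \<delta>" m "- c / \<delta>"] \<delta> by simp
  have "(?f has_integral ?I) {c + a..c + L / 2}"
  proof (rule has_integral_eq[OF _ l])
    fix s assume "s \<in> {c + a..c + L / 2}"
    then have "1 \<le> (c + L - s) / \<delta>" using \<delta> by (simp add: field_simps)
    then show "sqrt (m / 2) * (1 / sqrt (E - \<kappa> (1 / \<delta> * s + - c / \<delta>))) = ?f s"
      using kappa_zero[of "(c + L - s) / \<delta>"] sq[of "E - \<kappa> ((s - c) / \<delta>)"]
      by (simp add: kd_def) (simp add: diff_divide_distrib)
  qed
  moreover
  have "(\<lambda>q. (q - (c + L) / \<delta>) / (- 1 / \<delta>)) ` {kinv \<kappa> E..L / (2 * \<delta>)} = {c + L / 2..c + L - a}"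
  proof -
    have "(\<lambda>q. (q - (c + L) / \<delta>) / (- 1 / \<delta>)) = (\<lambda>q. (- \<delta>) * q + (c + L))" using \<delta> by (auto simp: field_simps)
    moreover have "kinv \<kappa> E \<le> L / (2 * \<delta>)" "\<delta> * (L / (2 * \<delta>)) = L / 2"
      using aL \<delta> by (auto simp: a_def field_simps)
    ultimately show ?thesis
      using \<delta> by (simp only: image_affinity_atLeastAtMost) (simp add: a_def)
  qed
  then have r: "((\<lambda>s. sqrt (m / 2) * (1 / sqrt (E - \<kappa> (- 1 / \<delta> * s + (c + L) / \<delta>)))) has_integral ?I) {c + L / 2..c + L - a}"
    using half_period[OF E \<delta>, of "- 1 / \<delta>" m "(c + L) / \<delta>"] \<delta> by simp
  have "(?f has_integral ?I) {c + L / 2..c + L - a}"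
  proof (rule has_integral_eq[OF _ r])
    fix s assume "s \<in> {c + L / 2..c + L - a}"
    then have "1 \<le> (s - c) / \<delta>" using \<delta> by (simp add: field_simps)
    then show "sqrt (m / 2) * (1 / sqrt (E - \<kappa> (- 1 / \<delta> * s + (c + L) / \<delta>))) = ?f s"
      using kappa_zero[of "(s - c) / \<delta>"] sq[of "E - \<kappa> ((c + L - s) / \<delta>)"]
      by (simp add: kd_def) (simp add: diff_divide_distrib)
  qed
  ultimately have "(?f has_integral ?I + ?I) {c + a..c + L - a}"
    by (rule has_integral_combine[rotated 2]) (use aL in auto)
  then show ?thesis by (simp add: integral_unique)
qed

text \<open>\<open>sqrt (8 * m * E)\<close> is the momentum handed over per period. The period is
  proportional to \<open>sqrt m\<close> as well, so the mass cancels in the mean force.\<close>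

lemma mean_force_eq:
  assumes m: "0 < m" and E: "e0 \<le> E" "E \<le> e1" and \<delta>: "0 < \<delta>"
  shows "sqrt (8 * m * E) / (2 * (2 * sqrt (m / 2) * (\<delta> * (gam E + (L / (2 * \<delta>) - 1) / sqrt E)))) = 2 * E / (L + \<delta> * beta E)"
proof -
  have E0: "0 < E" using E e0 by simp
  have s: "sqrt (8 * m * E) = 4 * sqrt (m / 2) * sqrt E"
    using m E0 by (intro real_sqrt_unique) (auto simp: power_mult_distrib)
  have d: "2 * sqrt E * (\<delta> * (gam E + (L / (2 * \<delta>) - 1) / sqrt E)) = L + \<delta> * beta E"
    using \<delta> E0 by (simp add: beta_def field_simps)
  have "sqrt (8 * m * E) / (2 * (2 * sqrt (m / 2) * (\<delta> * (gam E + (L / (2 * \<delta>) - 1) / sqrt E))))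
     = sqrt E / (\<delta> * (gam E + (L / (2 * \<delta>) - 1) / sqrt E))"
    unfolding s using m by simp
  also have "\<dots> = (2 * sqrt E * sqrt E) / (2 * sqrt E * (\<delta> * (gam E + (L / (2 * \<delta>) - 1) / sqrt E)))"
    using E0 by simp
  also have "\<dots> = 2 * E / (L + \<delta> * beta E)" unfolding d using E0 by simp
  finally show ?thesis .
qed

lemma sqrt_ratio:
  assumes "0 < m" "0 < E"
  shows "sqrt (8 * m * E) / (sqrt (2 * m / E) * L) = 2 * E / L"
proof -
  have "sqrt (8 * m * E) = 2 * E * sqrt (2 * m / E)"
    using assms by (intro real_sqrt_unique) (auto simp: power_mult_distrib power2_eq_square)
  then show ?thesis using assms by simp
qed

lemma mean_force1:
  assumes "0 < m" "e0 \<le> E" "E \<le> e1" "0 \<le> \<delta>" "2 * \<delta> \<le> X"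
  shows "sqrt (8 * m * E) / period1 \<kappa> m \<delta> X E = 2 * E / (X + \<delta> * beta E)"
proof (cases "\<delta> = 0")
  case False
  then show ?thesis
    using period_integral[of E \<delta> X 0 m] mean_force_eq[of m E \<delta> X] assms by (simp add: period1_def Let_def)
qed (use sqrt_ratio[of m E X] assms e0 in \<open>simp add: period1_def\<close>)

lemma mean_force2:
  assumes "0 < m" "e0 \<le> E" "E \<le> e1" "0 \<le> \<delta>" "2 * \<delta> \<le> 1 - X"
  shows "sqrt (8 * m * E) / period2 \<kappa> m \<delta> X E = 2 * E / (1 - X + \<delta> * beta E)"
proof (cases "\<delta> = 0")
  case False
  then show ?thesis
    using period_integral[of E \<delta> "1 - X" X m] mean_force_eq[of m E \<delta> "1 - X"] assms by (simp add: period2_def Let_def)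
qed (use sqrt_ratio[of m E "1 - X"] assms e0 in \<open>simp add: period2_def\<close>)

end

subsection \<open>The corrector of a single gas particle\<close>

context soft_core
begin

lemma has_real_derivative_kd:
  "(f has_real_derivative f') (at t within S) \<Longrightarrow>
    ((\<lambda>t. kd \<kappa> \<delta> (f t)) has_real_derivative kd' \<kappa> \<delta> (f t) * f') (at t within S)"
  unfolding kd_def kd'_def
  by (rule DERIV_cong[OF has_real_derivative_kappa_compose[OF DERIV_cdivide]]) auto

lemma kd_zero: "0 < \<delta> \<Longrightarrow> \<delta> \<le> x \<Longrightarrow> kd \<kappa> \<delta> x = 0"
  and kd'_zero: "0 < \<delta> \<Longrightarrow> \<delta> \<le> x \<Longrightarrow> kd' \<kappa> \<delta> x = 0"
  by (auto simp: kd_def kd'_def kappa_zero dk_zero)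

lemma kd_nonneg: "0 \<le> kd \<kappa> \<delta> x"
  by (simp add: kd_def kappa_nonneg)

lemma kd'_nonpos: "0 < \<delta> \<Longrightarrow> kd' \<kappa> \<delta> x \<le> 0"
  using dk_nonpos[of "x / \<delta>"] by (simp add: kd'_def divide_nonpos_pos)

lemma kd_less_imp_pos:
  assumes "0 < \<delta>" "kd \<kappa> \<delta> x < \<kappa> 0" shows "0 < x"
proof (rule ccontr)
  assume "\<not> 0 < x"
  then have "\<kappa> 0 \<le> \<kappa> (x / \<delta>)" using assms by (intro kappa_antimono) (auto simp: divide_nonpos_pos)
  then show False using assms by (simp add: kd_def)
qed

text \<open>One cell with a fixed wall at 0 and a moving wall at \<open>L\<close>. The case
  \<open>\<delta> = 0\<close> is separate because division by zero would turn \<open>kd\<close> into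
  the constant \<open>\<kappa> 0\<close>.\<close>

definition energy :: "real \<Rightarrow> real \<Rightarrow> real \<Rightarrow> real \<Rightarrow> real \<Rightarrow> real" where
  "energy m \<delta> L x v = m * v\<^sup>2 / 2 + (if \<delta> = 0 then 0 else kd \<kappa> \<delta> x + kd \<kappa> \<delta> (L - x))"

text \<open>The fixed wall does no work, so the power is the force of the moving wall on the
  particle times the velocity of that wall.\<close>

lemma has_real_derivative_energy:
  assumes m: "0 < m" and \<delta>: "0 < \<delta>"
    and L: "(L has_real_derivative U) (at t within S)" and x: "(x has_real_derivative v t) (at t within S)"
    and v: "(v has_real_derivative (- kd' \<kappa> \<delta> (x t) + kd' \<kappa> \<delta> (L t - x t)) / m) (at t within S)"
  shows "((\<lambda>t. energy m \<delta> (L t) (x t) (v t)) has_real_derivative kd' \<kappa> \<delta> (L t - x t) * U) (at t within S)"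
proof -
  let ?v' = "(- kd' \<kappa> \<delta> (x t) + kd' \<kappa> \<delta> (L t - x t)) / m"
  have "((\<lambda>t. m * (v t)\<^sup>2 / 2 + (kd \<kappa> \<delta> (x t) + kd \<kappa> \<delta> (L t - x t))) has_real_derivative
      m * (2 * ?v' * v t) / 2 + (kd' \<kappa> \<delta> (x t) * v t + kd' \<kappa> \<delta> (L t - x t) * (U - v t))) (at t within S)"
    by (intro DERIV_add has_real_derivative_kd L x DERIV_diff)
      (use v in \<open>auto intro!: derivative_eq_intros\<close>)
  moreover have "m * (2 * ?v' * v t) / 2 + (kd' \<kappa> \<delta> (x t) * v t + kd' \<kappa> \<delta> (L t - x t) * (U - v t))
      = kd' \<kappa> \<delta> (L t - x t) * U"
    using m by (simp add: field_simps)
  ultimately show ?thesis unfolding energy_def using \<delta> by simp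
qed

lemma energy_ge_kinetic: "m * v\<^sup>2 / 2 \<le> energy m \<delta> L x v"
  using kd_nonneg[of \<delta>] by (simp add: energy_def)

end

context soft_core_band
begin

text \<open>The virial \<open>m v x\<close> is an exact corrector for the hard core; the \<open>rho\<close> and \<open>beta\<close> terms repair
  it in the layers of width \<open>\<delta>\<close>. For \<open>\<delta> = 0\<close> they vanish because of the prefactor \<open>\<delta>\<close>.\<close>

definition corr_num :: "real \<Rightarrow> real \<Rightarrow> real \<Rightarrow> real \<Rightarrow> real \<Rightarrow> real \<Rightarrow> real" where
  "corr_num m \<delta> L U x v = m * v * x
     + \<delta> * sqrt (m / 2) * (rho (x / \<delta>) (sqrt (m / 2) * v) + rho ((L - x) / \<delta>) (sqrt (m / 2) * (U - v)))
     + \<delta> / 2 * beta (energy m \<delta> L x v) * (m * v)"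

definition eff_len :: "real \<Rightarrow> real \<Rightarrow> real \<Rightarrow> real" where
  "eff_len \<delta> L E = L + \<delta> * beta E"

definition corr :: "real \<Rightarrow> real \<Rightarrow> real \<Rightarrow> real \<Rightarrow> real \<Rightarrow> real \<Rightarrow> real" where
  "corr m \<delta> L U x v = - corr_num m \<delta> L U x v / eff_len \<delta> L (energy m \<delta> L x v)"

definition mean_force :: "real \<Rightarrow> real \<Rightarrow> real \<Rightarrow> real" where
  "mean_force \<delta> L E = 2 * E / eff_len \<delta> L E"

text \<open>\<open>beta \<ge> - 2\<close> costs at most
  \<open>2 * \<delta> \<le> l / 2\<close>.\<close>

lemma eff_len_ge:
  assumes "e0 \<le> E" "E \<le> e1" "0 \<le> \<delta>" "4 * \<delta> \<le> l" "l \<le> L"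
  shows "l / 2 \<le> eff_len \<delta> L E"
  using mult_left_mono[OF beta_ge[OF assms(1,2)] assms(3)] assms by (simp add: eff_len_def)

text \<open>The numerator has derivative \<open>2 * E - (L + \<delta> * beta E) * F\<close> plus
  errors, so division by the effective length isolates \<open>F\<close> minus the mean force. At the
  piston \<open>rho\<close> takes relative position and velocity, which brings in the energy
  \<open>Er\<close> of the moving frame and the acceleration \<open>a\<close> as a perturbation;
  \<open>err\<close> collects these effects and the drift of \<open>L\<close> and
  \<open>E\<close>.\<close>

lemma has_real_derivative_corr:
  fixes m l \<delta> t S
  assumes m: "0 < m" and \<delta>: "0 < \<delta>" "4 * \<delta> \<le> l" and t: "t \<in> S"
    and L: "(L has_real_derivative U t) (at t within S)"
    and U: "(U has_real_derivative a) (at t within S)"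
    and x: "(x has_real_derivative v t) (at t within S)"
    and v: "(v has_real_derivative (- kd' \<kappa> \<delta> (x t) + kd' \<kappa> \<delta> (L t - x t)) / m) (at t within S)"
    and l: "l \<le> L t"
    and E: "e0 \<le> energy m \<delta> (L t) (x t) (v t)" "energy m \<delta> (L t) (x t) (v t) \<le> e1"
    and Er: "L t - x t \<le> \<delta> \<Longrightarrow>
       e0 \<le> m / 2 * (U t - v t)\<^sup>2 + kd \<kappa> \<delta> (L t - x t) \<and> m / 2 * (U t - v t)\<^sup>2 + kd \<kappa> \<delta> (L t - x t) \<le> e1"
  defines "E \<equiv> energy m \<delta> (L t) (x t) (v t)"
    and "Er \<equiv> m / 2 * (U t - v t)\<^sup>2 + kd \<kappa> \<delta> (L t - x t)"
    and "F \<equiv> - kd' \<kappa> \<delta> (L t - x t)"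
  defines "R \<equiv> rho' ((L t - x t) / \<delta>) (sqrt (m / 2) * (U t - v t))"
  defines "err \<equiv> - (\<delta> / 2 * (beta E - beta Er) * F + \<delta> * (m / 2) * a * R - \<delta> / 2 * beta' E * (F * U t) * (m * v t)) / eff_len \<delta> (L t) E
     + corr_num m \<delta> (L t) (U t) (x t) (v t) * (U t - \<delta> * beta' E * (F * U t)) / (eff_len \<delta> (L t) E)\<^sup>2"
  shows "((\<lambda>t. corr m \<delta> (L t) (U t) (x t) (v t)) has_real_derivative F - 2 * E / eff_len \<delta> (L t) E + err) (at t within S)"
proof -
  define \<sigma> where "\<sigma> = sqrt (m / 2)"
  have \<sigma>: "0 < \<sigma>" "\<sigma> * \<sigma> = m / 2" using m by (auto simp: \<sigma>_def)
  \<comment> \<open>In the variables \<open>x / \<delta>\<close> and \<open>\<sigma> * v\<close> the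
    mass-free equations of motion run at this clock rate.\<close>
  define s where "s = 1 / (\<delta> * \<sigma>)"
  define fl where "fl = kd' \<kappa> \<delta> (x t)"
  define fr where "fr = kd' \<kappa> \<delta> (L t - x t)"
  define En where "En = (\<lambda>t. energy m \<delta> (L t) (x t) (v t))"
  have z: "((\<lambda>t. L t - x t) has_real_derivative U t - v t) (at t within S)"
    by (intro DERIV_diff L x)
  have v': "(v has_real_derivative (- fl + fr) / m) (at t within S)"
    using v by (simp add: fl_def fr_def)
  have dE: "(En has_real_derivative - (F * U t)) (at t within S)"
    unfolding En_def F_def using has_real_derivative_energy[OF m \<delta>(1) L x v] by simp
  \<comment> \<open>The cell is at least four layers long, so a particle is never in both layers at
    once: the force of one wall vanishes wherever the \<open>rho\<close> term of the other is
    active.\<close>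
  have layers: "fl = 0 \<or> fr = 0" "\<delta> < x t \<or> kd \<kappa> \<delta> (L t - x t) = 0 \<and> fr = 0" "\<delta> < L t - x t \<or> fl = 0"
    using kd'_zero[of \<delta> "x t"] kd'_zero[of \<delta> "L t - x t"] kd_zero[of \<delta> "L t - x t"] \<delta> l
    by (force simp: fl_def fr_def)+
  have dk_eq: "dk (x t / \<delta>) = \<delta> * fl" "dk ((L t - x t) / \<delta>) = \<delta> * fr"
    using \<delta> by (auto simp: fl_def fr_def kd'_def)
  have inv: "\<sigma> / m = 1 / (2 * \<sigma>)"
    using \<sigma> m by (simp add: field_simps)
  have El: "(\<sigma> * v t)\<^sup>2 + \<kappa> (x t / \<delta>) = m * (v t)\<^sup>2 / 2 + kd \<kappa> \<delta> (x t)"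
    using \<sigma> by (simp add: kd_def power2_eq_square algebra_simps)
  have Er_eq: "(\<sigma> * (U t - v t))\<^sup>2 + \<kappa> ((L t - x t) / \<delta>) = Er"
  proof -
    have "(\<sigma> * (U t - v t))\<^sup>2 = \<sigma> * \<sigma> * (U t - v t)\<^sup>2" by (simp add: power2_eq_square)
    then show ?thesis by (simp add: \<sigma>(2) kd_def Er_def)
  qed
  have E_def': "E = m * (v t)\<^sup>2 / 2 + kd \<kappa> \<delta> (x t) + kd \<kappa> \<delta> (L t - x t)"
    using \<delta> by (simp add: E_def energy_def)
  have "((\<lambda>t. rho (x t / \<delta>) (\<sigma> * v t)) has_real_derivative
      s * (2 * \<kappa> (x t / \<delta>) + x t / \<delta> * dk (x t / \<delta>) + beta ((\<sigma> * v t)\<^sup>2 + \<kappa> (x t / \<delta>)) / 2 * dk (x t / \<delta>))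
      + \<sigma> * fr / m * rho' (x t / \<delta>) (\<sigma> * v t)) (at t within S)"
  proof (rule has_real_derivative_rho[OF _ _ t])
    show "((\<lambda>t. x t / \<delta>) has_real_derivative \<sigma> * v t * s) (at t within S)"
      by (rule DERIV_cong[OF DERIV_cdivide[OF x]]) (use \<sigma> in \<open>simp add: s_def\<close>)
    show "((\<lambda>t. \<sigma> * v t) has_real_derivative - dk (x t / \<delta>) / 2 * s + \<sigma> * fr / m) (at t within S)"
    proof (rule DERIV_cong[OF DERIV_cmult[OF v']])
      have "\<sigma> * ((- fl + fr) / m) = (\<sigma> / m) * (- fl) + \<sigma> * fr / m" by (simp add: diff_divide_distrib algebra_simps)
      then show "\<sigma> * ((- fl + fr) / m) = - dk (x t / \<delta>) / 2 * s + \<sigma> * fr / m"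
        using \<delta> by (simp only: inv dk_eq s_def) simp
    qed
    show "e0 \<le> (\<sigma> * v t)\<^sup>2 + \<kappa> (x t / \<delta>) \<and> (\<sigma> * v t)\<^sup>2 + \<kappa> (x t / \<delta>) \<le> e1" if "x t / \<delta> \<le> 1"
    proof -
      have "kd \<kappa> \<delta> (L t - x t) = 0" using that layers \<delta> by auto
      then show ?thesis using E \<delta> unfolding El by (simp add: energy_def)
    qed
  qed
  moreover have "\<sigma> * fr / m * rho' (x t / \<delta>) (\<sigma> * v t) = 0"
    using layers(2) \<delta> by (auto simp: rho'_def)
  moreover have "beta ((\<sigma> * v t)\<^sup>2 + \<kappa> (x t / \<delta>)) * fl = beta E * fl"
    using layers(2) kd'_zero[of \<delta> "x t"] \<delta> unfolding El E_def' by (force simp: fl_def)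
  moreover have "beta ((\<sigma> * v t)\<^sup>2 + \<kappa> (x t / \<delta>)) / 2 * (\<delta> * fl) = \<delta> / 2 * (beta ((\<sigma> * v t)\<^sup>2 + \<kappa> (x t / \<delta>)) * fl)"
    by simp
  ultimately have rl: "((\<lambda>t. rho (x t / \<delta>) (\<sigma> * v t)) has_real_derivative
      s * (2 * kd \<kappa> \<delta> (x t) + x t * fl + \<delta> * beta E / 2 * fl)) (at t within S)"
    using \<delta> by (simp only: dk_eq) (simp add: kd_def mult.assoc)
  have "((\<lambda>t. rho ((L t - x t) / \<delta>) (\<sigma> * (U t - v t))) has_real_derivative
      s * (2 * \<kappa> ((L t - x t) / \<delta>) + (L t - x t) / \<delta> * dk ((L t - x t) / \<delta>)
        + beta ((\<sigma> * (U t - v t))\<^sup>2 + \<kappa> ((L t - x t) / \<delta>)) / 2 * dk ((L t - x t) / \<delta>))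
      + \<sigma> * (a + fl / m) * rho' ((L t - x t) / \<delta>) (\<sigma> * (U t - v t))) (at t within S)"
  proof (rule has_real_derivative_rho[OF _ _ t])
    show "((\<lambda>t. (L t - x t) / \<delta>) has_real_derivative \<sigma> * (U t - v t) * s) (at t within S)"
      by (rule DERIV_cong[OF DERIV_cdivide[OF z]]) (use \<sigma> in \<open>simp add: s_def\<close>)
    show "((\<lambda>t. \<sigma> * (U t - v t)) has_real_derivative - dk ((L t - x t) / \<delta>) / 2 * s + \<sigma> * (a + fl / m)) (at t within S)"
    proof (rule DERIV_cong[OF DERIV_cmult[OF DERIV_diff[OF U v']]])
      have "\<sigma> * (a - (- fl + fr) / m) = (\<sigma> / m) * (- fr) + \<sigma> * (a + fl / m)"
        by (simp add: diff_divide_distrib algebra_simps)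
      then show "\<sigma> * (a - (- fl + fr) / m) = - dk ((L t - x t) / \<delta>) / 2 * s + \<sigma> * (a + fl / m)"
        using \<delta> by (simp only: inv dk_eq s_def) simp
    qed
    show "e0 \<le> (\<sigma> * (U t - v t))\<^sup>2 + \<kappa> ((L t - x t) / \<delta>) \<and> (\<sigma> * (U t - v t))\<^sup>2 + \<kappa> ((L t - x t) / \<delta>) \<le> e1"
      if "(L t - x t) / \<delta> \<le> 1"
      using Er that \<delta> unfolding Er_eq Er_def by simp
  qed
  \<comment> \<open>\<open>R\<close> vanishes outside the right layer and \<open>fl\<close> inside
    it, so only the acceleration of the piston perturbs the relative motion.\<close>
  moreover have "\<sigma> * (a + fl / m) * rho' ((L t - x t) / \<delta>) (\<sigma> * (U t - v t)) = \<sigma> * a * R"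
    using layers(3) \<delta> by (auto simp: rho'_def R_def \<sigma>_def)
  ultimately have rr: "((\<lambda>t. rho ((L t - x t) / \<delta>) (\<sigma> * (U t - v t))) has_real_derivative
      s * (2 * kd \<kappa> \<delta> (L t - x t) + (L t - x t) * fr + \<delta> * beta Er / 2 * fr) + \<sigma> * a * R) (at t within S)"
    unfolding Er_eq using \<delta> by (simp only: dk_eq) (simp add: kd_def mult.assoc mult.left_commute)
  have Eb: "2 * e0 / 3 < En t" "En t < \<kappa> 0" using E e0 e1 by (auto simp: En_def)
  have be: "((\<lambda>t. beta (En t)) has_real_derivative beta' E * (- (F * U t))) (at t within S)"
    using DERIV_chain2[OF DERIV_beta[OF Eb] dE] by (simp add: En_def E_def)
  have EnE: "En t = E" by (simp add: En_def E_def)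
  let ?e = "\<delta> / 2 * (beta E - beta Er) * F + \<delta> * (m / 2) * a * R - \<delta> / 2 * beta' E * (F * U t) * (m * v t)"
  have num: "((\<lambda>t. corr_num m \<delta> (L t) (U t) (x t) (v t)) has_real_derivative
      2 * E - (L t + \<delta> * beta E) * F + ?e) (at t within S)"
  proof -
    have "((\<lambda>t. m * v t * x t + \<delta> * \<sigma> * (rho (x t / \<delta>) (\<sigma> * v t) + rho ((L t - x t) / \<delta>) (\<sigma> * (U t - v t)))
        + \<delta> / 2 * beta (En t) * (m * v t)) has_real_derivative
       (m * ((- fl + fr) / m) * x t + m * v t * v t)
       + \<delta> * \<sigma> * (s * (2 * kd \<kappa> \<delta> (x t) + x t * fl + \<delta> * beta E / 2 * fl)
          + (s * (2 * kd \<kappa> \<delta> (L t - x t) + (L t - x t) * fr + \<delta> * beta Er / 2 * fr) + \<sigma> * a * R))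
       + (\<delta> / 2 * (beta' E * (- (F * U t))) * (m * v t) + \<delta> / 2 * beta E * (m * ((- fl + fr) / m)))) (at t within S)"
      by (rule derivative_eq_intros rl rr be x v' refl)+ (simp add: EnE algebra_simps)
    \<comment> \<open>Each layer supplies half of the \<open>beta\<close> term. The summand
      \<open>\<delta> / 2 * beta * (m * v)\<close> cancels the half at the fixed wall and supplies
      the missing half at the piston, so that \<open>F\<close> alone survives, with the factor
      \<open>L + \<delta> * beta\<close>.\<close>
    moreover have "(m * ((- fl + fr) / m) * x t + m * v t * v t)
       + \<delta> * \<sigma> * (s * (2 * kd \<kappa> \<delta> (x t) + x t * fl + \<delta> * beta E / 2 * fl)
          + (s * (2 * kd \<kappa> \<delta> (L t - x t) + (L t - x t) * fr + \<delta> * beta Er / 2 * fr) + \<sigma> * a * R))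
       + (\<delta> / 2 * (beta' E * (- (F * U t))) * (m * v t) + \<delta> / 2 * beta E * (m * ((- fl + fr) / m)))
      = 2 * E - (L t + \<delta> * beta E) * F + ?e"
    proof -
      have 1: "m * ((- fl + fr) / m) = - fl + fr" using m by simp
      have 2: "\<delta> * \<sigma> * (s * y + (s * y' + \<sigma> * a * R)) = y + y' + \<delta> * (m / 2) * a * R" for y y'
      proof -
        have "\<delta> * \<sigma> * s = 1" using \<delta> \<sigma> by (simp add: s_def)
        then have "\<delta> * \<sigma> * (s * y + (s * y' + \<sigma> * a * R)) = 1 * y + 1 * y' + \<delta> * (\<sigma> * \<sigma>) * a * R"
          by (metis (no_types, opaque_lifting) distrib_left mult.assoc mult.left_commute add.assoc)
        then show ?thesis using \<sigma> by simp
      qed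
      show ?thesis
        unfolding 1 2 E_def' F_def fr_def[symmetric] by (simp add: field_simps power2_eq_square)
    qed
    ultimately show ?thesis
      unfolding corr_num_def \<sigma>_def[symmetric] En_def by simp
  qed
  have len: "((\<lambda>t. eff_len \<delta> (L t) (En t)) has_real_derivative U t - \<delta> * beta' E * (F * U t)) (at t within S)"
    unfolding eff_len_def by (rule derivative_eq_intros L be refl)+ (simp add: algebra_simps)
  have pos: "0 < eff_len \<delta> (L t) (En t)"
    using eff_len_ge[of "En t" \<delta> l "L t"] E \<delta> l by (simp add: En_def)
  have "((\<lambda>t. - corr_num m \<delta> (L t) (U t) (x t) (v t) / eff_len \<delta> (L t) (En t)) has_real_derivative
     F - 2 * E / eff_len \<delta> (L t) E + err) (at t within S)"
  proof (rule DERIV_cong[OF DERIV_divide[OF DERIV_minus[OF num] len]])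
    show "eff_len \<delta> (L t) (En t) \<noteq> 0" using pos by simp
    have p: "0 < L t + \<delta> * beta E" using pos by (simp add: eff_len_def EnE)
    show "(- (2 * E - (L t + \<delta> * beta E) * F + ?e) * eff_len \<delta> (L t) (En t)
         - - corr_num m \<delta> (L t) (U t) (x t) (v t) * (U t - \<delta> * beta' E * (F * U t)))
         / (eff_len \<delta> (L t) (En t) * eff_len \<delta> (L t) (En t)) = F - 2 * E / eff_len \<delta> (L t) E + err"
      unfolding err_def EnE eff_len_def using p
      by (simp add: divide_simps power2_eq_square) (simp add: algebra_simps)
  qed
  then show ?thesis unfolding corr_def En_def by simp
qed

text \<open>The constants do not depend on \<open>\<delta>\<close>. As the force is of order
  \<open>1 / \<delta>\<close>, the error is bounded relative to one plus the force. The speed limit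
  \<open>\<nu>\<close> keeps the energy of the piston's frame inside the band. Confinement is
  demanded for \<open>\<delta> = 0\<close> only; the soft core potential enforces it by
  itself.\<close>

definition corr_est :: "real \<Rightarrow> real \<Rightarrow> real \<Rightarrow> real \<Rightarrow> real \<Rightarrow> real \<Rightarrow> bool" where
  "corr_est l c0 c1 m K \<nu> \<longleftrightarrow> 0 \<le> K \<and> 0 < \<nu> \<and>
    (\<forall>\<delta> L U x v. 0 \<le> \<delta> \<longrightarrow> 4 * \<delta> \<le> l \<longrightarrow> l \<le> L \<longrightarrow> L \<le> 1 \<longrightarrow> c0 \<le> energy m \<delta> L x v \<longrightarrow> energy m \<delta> L x v \<le> c1 \<longrightarrow>
      \<bar>U\<bar> \<le> \<nu> \<longrightarrow> (\<delta> = 0 \<longrightarrow> 0 \<le> x \<and> x \<le> L) \<longrightarrow> \<bar>corr m \<delta> L U x v\<bar> \<le> K) \<and>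
    (\<forall>\<delta> L U x v t S a. 0 < \<delta> \<longrightarrow> 4 * \<delta> \<le> l \<longrightarrow> t \<in> S \<longrightarrow>
        (L has_real_derivative U t) (at t within S) \<longrightarrow> (U has_real_derivative a) (at t within S) \<longrightarrow>
        (x has_real_derivative v t) (at t within S) \<longrightarrow>
        (v has_real_derivative (- kd' \<kappa> \<delta> (x t) + kd' \<kappa> \<delta> (L t - x t)) / m) (at t within S) \<longrightarrow>
        l \<le> L t \<longrightarrow> L t \<le> 1 \<longrightarrow> c0 \<le> energy m \<delta> (L t) (x t) (v t) \<longrightarrow> energy m \<delta> (L t) (x t) (v t) \<le> c1 \<longrightarrow> \<bar>U t\<bar> \<le> \<nu>
      \<longrightarrow> (\<exists>err. ((\<lambda>t. corr m \<delta> (L t) (U t) (x t) (v t)) has_real_derivative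
             - kd' \<kappa> \<delta> (L t - x t) - mean_force \<delta> (L t) (energy m \<delta> (L t) (x t) (v t)) + err) (at t within S)
           \<and> \<bar>err\<bar> \<le> K * (\<bar>a\<bar> + \<bar>U t\<bar> * (1 - kd' \<kappa> \<delta> (L t - x t)))))"

lemma corr_est_bound:
  assumes "corr_est l c0 c1 m K \<nu>" "0 \<le> \<delta>" "4 * \<delta> \<le> l" "l \<le> L" "L \<le> 1" "c0 \<le> energy m \<delta> L x v" "energy m \<delta> L x v \<le> c1"
    "\<bar>U\<bar> \<le> \<nu>" "\<delta> = 0 \<Longrightarrow> 0 \<le> x \<and> x \<le> L"
  shows "\<bar>corr m \<delta> L U x v\<bar> \<le> K"
proof -
  note e = assms(1)[unfolded corr_est_def, THEN conjunct2, THEN conjunct2, THEN conjunct1, rule_format]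
  show ?thesis by (rule e) (use assms(2-) in auto)
qed

lemma corr_est_deriv:
  assumes "corr_est l c0 c1 m K \<nu>" "0 < \<delta>" "4 * \<delta> \<le> l" "t \<in> S"
    "(L has_real_derivative U t) (at t within S)" "(U has_real_derivative a) (at t within S)"
    "(x has_real_derivative v t) (at t within S)"
    "(v has_real_derivative (- kd' \<kappa> \<delta> (x t) + kd' \<kappa> \<delta> (L t - x t)) / m) (at t within S)"
    "l \<le> L t" "L t \<le> 1" "c0 \<le> energy m \<delta> (L t) (x t) (v t)" "energy m \<delta> (L t) (x t) (v t) \<le> c1" "\<bar>U t\<bar> \<le> \<nu>"
  obtains err where "((\<lambda>t. corr m \<delta> (L t) (U t) (x t) (v t)) has_real_derivative
      - kd' \<kappa> \<delta> (L t - x t) - mean_force \<delta> (L t) (energy m \<delta> (L t) (x t) (v t)) + err) (at t within S)"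
    "\<bar>err\<bar> \<le> K * (\<bar>a\<bar> + \<bar>U t\<bar> * (1 - kd' \<kappa> \<delta> (L t - x t)))"
proof -
  note e = assms(1)[unfolded corr_est_def, THEN conjunct2, THEN conjunct2, THEN conjunct2, rule_format, OF assms(2-)]
  then show thesis using that by blast
qed

lemma corr_est_mono:
  assumes e: "corr_est l c0 c1 m K \<nu>" and K: "K \<le> K'" and \<nu>: "0 < \<nu>'" "\<nu>' \<le> \<nu>"
  shows "corr_est l c0 c1 m K' \<nu>'"
proof -
  have "0 \<le> K'" using e K by (simp add: corr_est_def)
  moreover have "\<bar>corr m \<delta> L U x v\<bar> \<le> K'"
    if h: "0 \<le> \<delta>" "4 * \<delta> \<le> l" "l \<le> L" "L \<le> 1" "c0 \<le> energy m \<delta> L x v" "energy m \<delta> L x v \<le> c1"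
      "\<bar>U\<bar> \<le> \<nu>'" "\<delta> = 0 \<longrightarrow> 0 \<le> x \<and> x \<le> L" for \<delta> L U x v
    by (rule order_trans[OF corr_est_bound[OF e h(1-6)] K]) (use h \<nu> in auto)
  moreover have "\<exists>err. ((\<lambda>t. corr m \<delta> (L t) (U t) (x t) (v t)) has_real_derivative
             - kd' \<kappa> \<delta> (L t - x t) - mean_force \<delta> (L t) (energy m \<delta> (L t) (x t) (v t)) + err) (at t within S)
           \<and> \<bar>err\<bar> \<le> K' * (\<bar>a\<bar> + \<bar>U t\<bar> * (1 - kd' \<kappa> \<delta> (L t - x t)))"
    if h: "0 < \<delta>" "4 * \<delta> \<le> l" "t \<in> S"
        "(L has_real_derivative U t) (at t within S)" "(U has_real_derivative a) (at t within S)"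
        "(x has_real_derivative v t) (at t within S)"
        "(v has_real_derivative (- kd' \<kappa> \<delta> (x t) + kd' \<kappa> \<delta> (L t - x t)) / m) (at t within S)"
        "l \<le> L t" "L t \<le> 1" "c0 \<le> energy m \<delta> (L t) (x t) (v t)" "energy m \<delta> (L t) (x t) (v t) \<le> c1" "\<bar>U t\<bar> \<le> \<nu>'"
    for \<delta> L U x v t S a
  proof -
    have "\<bar>U t\<bar> \<le> \<nu>" using h(12) \<nu> by simp
    from corr_est_deriv[OF e h(1-11) this] obtain err where
      d: "((\<lambda>t. corr m \<delta> (L t) (U t) (x t) (v t)) has_real_derivative
             - kd' \<kappa> \<delta> (L t - x t) - mean_force \<delta> (L t) (energy m \<delta> (L t) (x t) (v t)) + err) (at t within S)"
      "\<bar>err\<bar> \<le> K * (\<bar>a\<bar> + \<bar>U t\<bar> * (1 - kd' \<kappa> \<delta> (L t - x t)))" by blast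
    have "0 \<le> \<bar>a\<bar> + \<bar>U t\<bar> * (1 - kd' \<kappa> \<delta> (L t - x t))"
      using kd'_nonpos[OF h(1), of "L t - x t"] by simp
    from mult_right_mono[OF K this] d show ?thesis by (meson order_trans)
  qed
  ultimately show ?thesis unfolding corr_est_def using \<nu>(1) by (intro conjI allI impI) blast+
qed

lemma corr_estimates:
  assumes m: "0 < m" and l: "0 < l" "l \<le> 1" and c: "e0 < c0" "c1 < e1"
  shows "\<exists>K \<nu>. corr_est l c0 c1 m K \<nu>"
proof -
  obtain Kb where Kb: "0 \<le> Kb" "\<And>E. E \<in> {e0..e1} \<Longrightarrow> \<bar>beta E\<bar> \<le> Kb" "\<And>E. E \<in> {e0..e1} \<Longrightarrow> \<bar>beta' E\<bar> \<le> Kb"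
    "\<And>E E'. E \<in> {e0..e1} \<Longrightarrow> E' \<in> {e0..e1} \<Longrightarrow> \<bar>beta E - beta E'\<bar> \<le> Kb * \<bar>E - E'\<bar>"
    by (rule beta_bounds) blast
  obtain Kr where Kr: "0 \<le> Kr"
    "\<And>q w. (q \<le> 1 \<Longrightarrow> e0 \<le> w\<^sup>2 + \<kappa> q \<and> w\<^sup>2 + \<kappa> q \<le> e1) \<Longrightarrow> \<bar>rho q w\<bar> \<le> Kr \<and> \<bar>rho' q w\<bar> \<le> Kr"
    by (rule rho_bounds) blast
  define vm where "vm = sqrt (2 * e1 / m)"
  have e1p: "0 < e1" using e0 e01 by simp
  have vm: "0 \<le> vm" using m e1p by (simp add: vm_def)
  \<comment> \<open>In the piston's layer the energies of the two frames differ by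
    \<open>m / 2 * (U * (U - 2 * v))\<close>, at most \<open>Ke * \<bar>U\<bar>\<close> when
    \<open>\<bar>U\<bar> \<le> 1\<close>; \<open>vm\<close> is the largest speed allowed by the
    kinetic energy.\<close>
  define Ke where "Ke = m / 2 * (1 + 2 * vm)"
  have Ke: "0 < Ke" using m vm by (simp add: Ke_def add_pos_nonneg)
  \<comment> \<open>Chosen so that this difference fits into the margins between \<open>c0\<close>,
    \<open>c1\<close> and \<open>e0\<close>, \<open>e1\<close>.\<close>
  define \<nu> where "\<nu> = min 1 (min (c0 - e0) (e1 - c1) / Ke)"
  have \<nu>: "0 < \<nu>" "\<nu> \<le> 1" "Ke * \<nu> \<le> c0 - e0" "Ke * \<nu> \<le> e1 - c1"
    using c Ke by (auto simp: \<nu>_def min_def field_simps)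
  define KJ where "KJ = m * vm + sqrt (m / 2) * (2 * Kr) + Kb * (m * vm)"
  have KJ: "0 \<le> KJ" using m vm Kr Kb by (simp add: KJ_def)
  define K where "K = KJ * (2 / l) + ((1/2 * Kb * Ke + m / 2 * Kr + 1/2 * Kb * (m * vm)) * (2 / l) + KJ * (1 + Kb) * (2 / l)\<^sup>2)"
  have vbound: "\<bar>v\<bar> \<le> vm" if "energy m \<delta> L x v \<le> c1" for \<delta> L x v
  proof -
    have "m * v\<^sup>2 / 2 \<le> e1" using energy_ge_kinetic[of m v \<delta> L x] that c by linarith
    then have "v\<^sup>2 \<le> 2 * e1 / m" using m by (simp add: field_simps)
    then show ?thesis unfolding vm_def by (rule real_le_rsqrt[of "\<bar>v\<bar>", simplified])
  qed
  \<comment> \<open>At a wall the potential alone would reach \<open>\<kappa> 0\<close>, more than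
    the available energy.\<close>
  have pos: "0 < x \<and> x < L" if "0 < \<delta>" "energy m \<delta> L x v \<le> c1" for \<delta> L x v
  proof -
    have "0 \<le> m * v\<^sup>2 / 2" using m by simp
    moreover have "m * v\<^sup>2 / 2 + (kd \<kappa> \<delta> x + kd \<kappa> \<delta> (L - x)) \<le> c1" using that by (simp add: energy_def)
    ultimately have "kd \<kappa> \<delta> x + kd \<kappa> \<delta> (L - x) < \<kappa> 0" using c e1 by linarith
    then have "kd \<kappa> \<delta> x < \<kappa> 0" "kd \<kappa> \<delta> (L - x) < \<kappa> 0"
      using kd_nonneg[of \<delta> x] kd_nonneg[of \<delta> "L - x"] by linarith+
    then show ?thesis using kd_less_imp_pos[OF that(1)] by force
  qed
  have near: "\<bar>m / 2 * (U - v)\<^sup>2 + kd \<kappa> \<delta> (L - x) - energy m \<delta> L x v\<bar> \<le> Ke * \<bar>U\<bar>"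
    if "0 < \<delta>" "4 * \<delta> \<le> l" "l \<le> L" "energy m \<delta> L x v \<le> c1" "\<bar>U\<bar> \<le> \<nu>" "L - x \<le> \<delta>" for \<delta> L U x v
  proof -
    have "\<delta> \<le> x" using that by linarith
    then have "m / 2 * (U - v)\<^sup>2 + kd \<kappa> \<delta> (L - x) - energy m \<delta> L x v = m / 2 * (U * (U - 2 * v))"
      using that kd_zero[of \<delta> x] by (simp add: energy_def power2_eq_square field_simps)
    also have "\<bar>\<dots>\<bar> = m / 2 * (\<bar>U\<bar> * \<bar>U - 2 * v\<bar>)" using m by (simp add: abs_mult)
    also have "\<dots> \<le> m / 2 * (\<bar>U\<bar> * (1 + 2 * vm))"
      by (intro mult_left_mono) (use vbound[OF that(4)] that(5) \<nu> m in auto)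
    finally show ?thesis by (simp add: Ke_def algebra_simps)
  qed
  have Er: "e0 \<le> m / 2 * (U - v)\<^sup>2 + kd \<kappa> \<delta> (L - x) \<and> m / 2 * (U - v)\<^sup>2 + kd \<kappa> \<delta> (L - x) \<le> e1"
    if "0 < \<delta>" "4 * \<delta> \<le> l" "l \<le> L" "c0 \<le> energy m \<delta> L x v" "energy m \<delta> L x v \<le> c1" "\<bar>U\<bar> \<le> \<nu>" "L - x \<le> \<delta>" for \<delta> L U x v
  proof -
    have "Ke * \<bar>U\<bar> \<le> Ke * \<nu>" using that Ke by simp
    then show ?thesis
      using near[OF that(1-3) that(5-7)] that(4,5) \<nu> unfolding abs_le_iff by linarith
  qed
  have sq: "(sqrt (m / 2) * y)\<^sup>2 = m / 2 * y\<^sup>2" for y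
    using m by (simp add: power_mult_distrib)
  have num: "\<bar>corr_num m \<delta> L U x v\<bar> \<le> KJ"
    if h: "0 \<le> \<delta>" "4 * \<delta> \<le> l" "l \<le> L" "L \<le> 1" "c0 \<le> energy m \<delta> L x v" "energy m \<delta> L x v \<le> c1" "\<bar>U\<bar> \<le> \<nu>"
      "0 \<le> x" "x \<le> L" for \<delta> L U x v
  proof -
    have v: "\<bar>v\<bar> \<le> vm" by (rule vbound[OF h(6)])
    have \<delta>1: "\<delta> \<le> 1" using h l by simp
    have b: "\<bar>beta (energy m \<delta> L x v)\<bar> \<le> Kb" using h c by (intro Kb) auto
    have 1: "\<bar>m * v * x\<bar> \<le> m * vm"
      using mult_mono[OF v, of x 1] h m vm by (simp add: abs_mult mult.assoc)
    have "\<bar>\<delta> / 2\<bar> * \<bar>beta (energy m \<delta> L x v)\<bar> * (\<bar>m\<bar> * \<bar>v\<bar>) \<le> (1 * Kb) * (m * vm)"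
      by (intro mult_mono b v) (use h \<delta>1 m Kb vm in auto)
    then have 3: "\<bar>\<delta> / 2 * beta (energy m \<delta> L x v) * (m * v)\<bar> \<le> Kb * (m * vm)"
      by (simp add: abs_mult)
    have 2: "\<bar>\<delta> * sqrt (m / 2) * (rho (x / \<delta>) (sqrt (m / 2) * v) + rho ((L - x) / \<delta>) (sqrt (m / 2) * (U - v)))\<bar>
       \<le> sqrt (m / 2) * (2 * Kr)"
    proof (cases "\<delta> = 0")
      case False
      then have \<delta>0: "0 < \<delta>" using h by simp
      have "\<bar>rho (x / \<delta>) (sqrt (m / 2) * v)\<bar> \<le> Kr"
      proof (rule Kr(2)[THEN conjunct1])
        assume "x / \<delta> \<le> 1"
        then have "kd \<kappa> \<delta> (L - x) = 0" using h \<delta>0 by (intro kd_zero) (auto simp: field_simps)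
        then show "e0 \<le> (sqrt (m / 2) * v)\<^sup>2 + \<kappa> (x / \<delta>) \<and> (sqrt (m / 2) * v)\<^sup>2 + \<kappa> (x / \<delta>) \<le> e1"
          using h c \<delta>0 unfolding sq by (simp add: energy_def kd_def)
      qed
      moreover have "\<bar>rho ((L - x) / \<delta>) (sqrt (m / 2) * (U - v))\<bar> \<le> Kr"
        using Er[of \<delta> L x v U] h \<delta>0 by (intro Kr(2)[THEN conjunct1]) (simp add: sq kd_def)
      ultimately have "\<bar>rho (x / \<delta>) (sqrt (m / 2) * v) + rho ((L - x) / \<delta>) (sqrt (m / 2) * (U - v))\<bar> \<le> 2 * Kr"
        by linarith
      then have "\<delta> * (sqrt (m / 2) * \<bar>rho (x / \<delta>) (sqrt (m / 2) * v) + rho ((L - x) / \<delta>) (sqrt (m / 2) * (U - v))\<bar>)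
          \<le> 1 * (sqrt (m / 2) * (2 * Kr))"
        by (intro mult_mono \<delta>1 order_refl) (use m Kr in auto)
      then show ?thesis using \<delta>0 m by (simp add: abs_mult mult.assoc)
    qed (use m Kr in simp)
    show ?thesis unfolding corr_num_def KJ_def using 1 2 3 by linarith
  qed
  have len: "l / 2 \<le> eff_len \<delta> L E" if "c0 \<le> E" "E \<le> c1" "0 \<le> \<delta>" "4 * \<delta> \<le> l" "l \<le> L" for \<delta> L E
    using that c by (intro eff_len_ge) auto
  have K0: "0 \<le> (1/2 * Kb * Ke + m / 2 * Kr + 1/2 * Kb * (m * vm)) * (2 / l)" "0 \<le> KJ * (1 + Kb) * (2 / l)\<^sup>2" "0 \<le> KJ * (2 / l)"
    using Kb Ke m Kr vm KJ l by simp_all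
  show ?thesis
    unfolding corr_est_def
  proof (rule exI[of _ K], rule exI[of _ \<nu>], intro conjI allI impI)
    show "0 \<le> K" "0 < \<nu>" using K0 \<nu> by (auto simp: K_def)
  next
    fix \<delta> L U x v
    assume h: "0 \<le> \<delta>" "4 * \<delta> \<le> l" "l \<le> L" "L \<le> 1" "c0 \<le> energy m \<delta> L x v" "energy m \<delta> L x v \<le> c1" "\<bar>U\<bar> \<le> \<nu>"
      and x: "\<delta> = 0 \<longrightarrow> 0 \<le> x \<and> x \<le> L"
    have x': "0 \<le> x" "x \<le> L" using x pos[of \<delta> L x v] h by (cases "\<delta> = 0"; force)+
    have "l / 2 \<le> eff_len \<delta> L (energy m \<delta> L x v)" using h by (intro len) auto
    then have "\<bar>corr m \<delta> L U x v\<bar> \<le> KJ / (l / 2)"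
      unfolding corr_def abs_divide abs_minus_cancel using l KJ by (intro frac_le num h x') auto
    then show "\<bar>corr m \<delta> L U x v\<bar> \<le> K" using K0 by (simp add: K_def)
  next
    fix \<delta> and L U x v :: "real \<Rightarrow> real" and t :: real and S and a :: real
    assume \<delta>: "0 < \<delta>" "4 * \<delta> \<le> l" and t: "t \<in> S"
      and ds: "(L has_real_derivative U t) (at t within S)" "(U has_real_derivative a) (at t within S)"
        "(x has_real_derivative v t) (at t within S)"
        "(v has_real_derivative (- kd' \<kappa> \<delta> (x t) + kd' \<kappa> \<delta> (L t - x t)) / m) (at t within S)"
      and L: "l \<le> L t" "L t \<le> 1"
      and E: "c0 \<le> energy m \<delta> (L t) (x t) (v t)" "energy m \<delta> (L t) (x t) (v t) \<le> c1" and U: "\<bar>U t\<bar> \<le> \<nu>"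
    define E where "E = energy m \<delta> (L t) (x t) (v t)"
    define Er' where "Er' = m / 2 * (U t - v t)\<^sup>2 + kd \<kappa> \<delta> (L t - x t)"
    define F where "F = - kd' \<kappa> \<delta> (L t - x t)"
    define R where "R = rho' ((L t - x t) / \<delta>) (sqrt (m / 2) * (U t - v t))"
    define J where "J = corr_num m \<delta> (L t) (U t) (x t) (v t)"
    define Q where "Q = eff_len \<delta> (L t) E"
    define A where "A = \<delta> / 2 * (beta E - beta Er') * F + \<delta> * (m / 2) * a * R - \<delta> / 2 * beta' E * (F * U t) * (m * v t)"
    define B where "B = J * (U t - \<delta> * beta' E * (F * U t))"
    note x = pos[OF \<delta>(1) E(2)]
    have F: "0 \<le> F" using kd'_nonpos[OF \<delta>(1)] by (simp add: F_def)
    have \<delta>1: "\<delta> \<le> 1" using \<delta> l by simp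
    have v: "\<bar>v t\<bar> \<le> vm" by (rule vbound[OF E(2)])
    have EE: "E \<in> {e0..e1}" using E c by (auto simp: E_def)
    have J: "\<bar>J\<bar> \<le> KJ" unfolding J_def by (intro num) (use \<delta> L E U x in auto)
    have Q: "l / 2 \<le> Q" unfolding Q_def E_def by (intro len) (use \<delta> L E in auto)
    have R: "\<bar>R\<bar> \<le> Kr"
      unfolding R_def using Er[of \<delta> "L t" "x t" "v t" "U t"] \<delta> L E U by (intro Kr(2)[THEN conjunct2]) (simp add: sq kd_def)
    \<comment> \<open>Off the layer the force vanishes. In the layer \<open>beta\<close> is
      Lipschitz and the two energies are \<open>Ke * \<bar>U\<bar>\<close> close, so the large
      factor \<open>F\<close> is accompanied by a small one.\<close>
    have dF: "\<bar>beta E - beta Er'\<bar> * F \<le> Kb * Ke * \<bar>U t\<bar> * F"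
    proof (cases "L t - x t \<le> \<delta>")
      case True
      have "Er' \<in> {e0..e1}" using Er[OF \<delta> L(1) E U True] by (simp add: Er'_def)
      then have "\<bar>beta E - beta Er'\<bar> \<le> Kb * \<bar>E - Er'\<bar>" by (rule Kb(4)[OF EE])
      also have "\<dots> \<le> Kb * (Ke * \<bar>U t\<bar>)"
        by (intro mult_left_mono) (use near[OF \<delta> L(1) E(2) U True] Kb in \<open>auto simp: E_def Er'_def abs_minus_commute\<close>)
      finally show ?thesis using mult_right_mono[OF _ F] by (metis mult.assoc)
    next
      case False
      then show ?thesis using kd'_zero[OF \<delta>(1), of "L t - x t"] by (simp add: F_def)
    qed
    have "\<bar>A\<bar> \<le> \<bar>\<delta> / 2 * (beta E - beta Er') * F\<bar> + \<bar>\<delta> * (m / 2) * a * R\<bar> + \<bar>\<delta> / 2 * beta' E * (F * U t) * (m * v t)\<bar>"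
      unfolding A_def by linarith
    also have "\<dots> = \<delta> * (1/2 * (\<bar>beta E - beta Er'\<bar> * F) + m / 2 * \<bar>a\<bar> * \<bar>R\<bar> + 1/2 * \<bar>beta' E\<bar> * (F * \<bar>U t\<bar>) * (m * \<bar>v t\<bar>))"
      unfolding abs_mult using \<delta> m F by (simp add: distrib_left)
    also have "\<dots> \<le> 1 * (1/2 * (Kb * Ke * \<bar>U t\<bar> * F) + m / 2 * \<bar>a\<bar> * Kr + 1/2 * Kb * (F * \<bar>U t\<bar>) * (m * vm))"
      by (intro mult_mono add_mono order_refl dF R v Kb(3) EE \<delta>1) (use \<delta> m F Kb Kr vm Ke in auto)
    also have "\<dots> \<le> (1/2 * Kb * Ke + m / 2 * Kr + 1/2 * Kb * (m * vm)) * (\<bar>a\<bar> + \<bar>U t\<bar> * (1 + F))"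
    proof -
      define X where "X = \<bar>a\<bar> + \<bar>U t\<bar> * (1 + F)"
      have X: "\<bar>U t\<bar> * F \<le> X" "\<bar>a\<bar> \<le> X" using F by (auto simp: X_def algebra_simps)
      have "Kb * Ke * (\<bar>U t\<bar> * F) \<le> Kb * Ke * X" "m * Kr * \<bar>a\<bar> \<le> m * Kr * X"
        "Kb * (m * vm) * (\<bar>U t\<bar> * F) \<le> Kb * (m * vm) * X"
        using X Kb Ke m Kr vm by (auto intro!: mult_left_mono)
      then show ?thesis unfolding X_def[symmetric] by (simp add: algebra_simps)
    qed
    finally have A: "\<bar>A\<bar> \<le> (1/2 * Kb * Ke + m / 2 * Kr + 1/2 * Kb * (m * vm)) * (\<bar>a\<bar> + \<bar>U t\<bar> * (1 + F))" .
    have "\<bar>U t - \<delta> * beta' E * (F * U t)\<bar> \<le> \<bar>U t\<bar> + \<bar>\<delta> * beta' E * (F * U t)\<bar>" by linarith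
    also have "\<dots> = \<bar>U t\<bar> + \<delta> * (\<bar>beta' E\<bar> * (F * \<bar>U t\<bar>))" using \<delta> F by (simp add: abs_mult)
    also have "\<dots> \<le> \<bar>U t\<bar> + 1 * (Kb * (F * \<bar>U t\<bar>))"
      by (intro add_left_mono mult_mono order_refl Kb(3) EE \<delta>1) (use \<delta> F Kb in auto)
    also have "\<dots> \<le> (1 + Kb) * (\<bar>a\<bar> + \<bar>U t\<bar> * (1 + F))"
    proof -
      have "0 \<le> Kb * \<bar>a\<bar>" "0 \<le> Kb * \<bar>U t\<bar>" "0 \<le> \<bar>U t\<bar> * F" using Kb F by auto
      then show ?thesis by (simp add: algebra_simps)
    qed
    finally have B: "\<bar>B\<bar> \<le> KJ * ((1 + Kb) * (\<bar>a\<bar> + \<bar>U t\<bar> * (1 + F)))"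
      unfolding B_def abs_mult by (intro mult_mono J) (use KJ in auto)
    let ?X = "\<bar>a\<bar> + \<bar>U t\<bar> * (1 + F)"
    have X: "0 \<le> ?X" using F by simp
    have "\<bar>- A / Q + B / Q\<^sup>2\<bar> \<le> \<bar>A\<bar> / Q + \<bar>B\<bar> / Q\<^sup>2"
      by (rule order_trans[OF abs_triangle_ineq]) (use Q l in auto)
    also have "\<dots> \<le> ((1/2 * Kb * Ke + m / 2 * Kr + 1/2 * Kb * (m * vm)) * ?X) / (l / 2) + (KJ * ((1 + Kb) * ?X)) / (l / 2)\<^sup>2"
      by (intro add_mono frac_le A B Q power_mono) (use l X KJ Kb Ke m Kr vm in auto)
    also have "\<dots> = ((1/2 * Kb * Ke + m / 2 * Kr + 1/2 * Kb * (m * vm)) * (2 / l) + KJ * (1 + Kb) * (2 / l)\<^sup>2) * ?X"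
      using l by (simp add: field_simps power2_eq_square)
    also have "\<dots> \<le> K * ?X"
      unfolding K_def by (intro mult_right_mono X) (use K0 in simp)
    finally have "\<bar>- A / Q + B / Q\<^sup>2\<bar> \<le> K * ?X" .
    moreover have "((\<lambda>t. corr m \<delta> (L t) (U t) (x t) (v t)) has_real_derivative F - 2 * E / Q + (- A / Q + B / Q\<^sup>2)) (at t within S)"
      unfolding A_def B_def Q_def J_def R_def F_def E_def Er'_def
      by (rule has_real_derivative_corr[OF m \<delta> t ds L(1)])
        (use E c Er[OF \<delta> L(1) E U] in auto)
    ultimately show "\<exists>err. ((\<lambda>t. corr m \<delta> (L t) (U t) (x t) (v t)) has_real_derivative
             - kd' \<kappa> \<delta> (L t - x t)
             - mean_force \<delta> (L t) (energy m \<delta> (L t) (x t) (v t)) + err) (at t within S)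
           \<and> \<bar>err\<bar> \<le> K * (\<bar>a\<bar> + \<bar>U t\<bar> * (1 - kd' \<kappa> \<delta> (L t - x t)))"
      unfolding F_def E_def Q_def mean_force_def by (intro exI conjI) auto
  qed
qed

end

subsection \<open>The averaged vector field\<close>

text \<open>\<open>l\<close> bounds both cell lengths from below; \<open>c0\<close>,
  \<open>c1\<close> and \<open>wm\<close> bound the energies and the scaled piston velocity on the
  given compact set. The strict inequalities with \<open>e0\<close>, \<open>e1\<close> leave room
  for the change of frame.\<close>

locale piston = soft_core_band \<kappa> e0 e1 for \<kappa> e0 e1 +
  fixes m1 :: "real ^ 'n1::finite" and m2 :: "real ^ 'n2::finite" and l c0 c1 wm :: real
  assumes m1: "0 < m1 $ j" and m2: "0 < m2 $ k"
    and l: "0 < l" "l \<le> 1" and c: "e0 < c0" "c1 < e1" and wm: "0 \<le> wm"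
begin

definition Edom :: "(real ^ 'm) set" where
  "Edom = cbox (\<chi> j. e0) (\<chi> j. e1)"

lemma mem_Edom: "E \<in> Edom \<longleftrightarrow> (\<forall>j. e0 \<le> E $ j \<and> E $ j \<le> e1)"
  by (simp add: Edom_def mem_box_cart)

definition hdom :: "('n1, 'n2) slowvar set" where
  "hdom = {l..1 - l} \<times> UNIV \<times> Edom \<times> Edom"

lemma Hbar_eq:
  assumes "(X, W, E1, E2) \<in> hdom" "0 \<le> \<delta>" "4 * \<delta> \<le> l"
  shows "Hbar \<kappa> m1 m2 \<delta> (X, W, E1, E2) =
    (W, (\<Sum>j\<in>UNIV. mean_force \<delta> X (E1 $ j)) - (\<Sum>j\<in>UNIV. mean_force \<delta> (1 - X) (E2 $ j)),
     (\<chi> j. - W * mean_force \<delta> X (E1 $ j)), (\<chi> j. W * mean_force \<delta> (1 - X) (E2 $ j)))"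
proof -
  have "sqrt (8 * m1 $ j * E1 $ j) / period1 \<kappa> (m1 $ j) \<delta> X (E1 $ j) = mean_force \<delta> X (E1 $ j)" for j
    unfolding mean_force_def eff_len_def
    by (rule mean_force1) (use assms m1 l in \<open>auto simp: hdom_def mem_Edom\<close>)
  moreover have "sqrt (8 * m2 $ j * E2 $ j) / period2 \<kappa> (m2 $ j) \<delta> X (E2 $ j) = mean_force \<delta> (1 - X) (E2 $ j)" for j
    unfolding mean_force_def eff_len_def
    by (rule mean_force2) (use assms m2 l in \<open>auto simp: hdom_def mem_Edom\<close>)
  ultimately show ?thesis by (simp add: Hbar_def flip: times_divide_eq_right)
qed

lemma mean_force_bounds:
  assumes "e0 \<le> E" "E \<le> e1" "0 \<le> \<delta>" "4 * \<delta> \<le> l" "l \<le> L"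
  shows "0 \<le> mean_force \<delta> L E" "mean_force \<delta> L E \<le> 4 * e1 / l"
proof -
  have *: "l / 2 \<le> eff_len \<delta> L E" using assms by (rule eff_len_ge)
  then show "0 \<le> mean_force \<delta> L E" using assms e0 l by (simp add: mean_force_def)
  have "mean_force \<delta> L E \<le> 2 * e1 / (l / 2)"
    unfolding mean_force_def by (rule frac_le) (use * assms e0 e01 l in auto)
  then show "mean_force \<delta> L E \<le> 4 * e1 / l" by simp
qed

lemma C1_on_mean_force:
  assumes d: "C1_on d S" "\<And>p. p \<in> S \<Longrightarrow> 0 \<le> d p \<and> 4 * d p \<le> l"
    and L: "C1_on L S" "\<And>p. p \<in> S \<Longrightarrow> l \<le> L p"
    and E: "C1_on E S" "\<And>p. p \<in> S \<Longrightarrow> e0 \<le> E p \<and> E p \<le> e1"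
  shows "C1_on (\<lambda>p. mean_force (d p) (L p) (E p)) S"
  unfolding mean_force_def
proof (rule C1_on_divide)
  show "C1_on (\<lambda>p. 2 * E p) S" by (intro C1_on_mult C1_on_const E)
  have "C1_on (\<lambda>p. beta (E p)) S"
    by (rule C1_on_real_compose[OF E(1), where T = "{2 * e0 / 3<..<\<kappa> 0}" and g' = beta'])
      (use E(2) e0 e1 DERIV_beta continuous_on_beta' in force)+
  then show "C1_on (\<lambda>p. eff_len (d p) (L p) (E p)) S"
    unfolding eff_len_def by (intro C1_on_add C1_on_mult d L)
  show "eff_len (d p) (L p) (E p) \<noteq> 0" if "p \<in> S" for p
    using eff_len_ge[of "E p" "d p" l "L p"] d(2)[OF that] L(2)[OF that] E(2)[OF that] l by auto
qed

text \<open>In terms of \<open>mean_force\<close> one formula covers all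
  \<open>\<delta> \<ge> 0\<close>, the hard core being the endpoint where
  \<open>\<delta> * beta\<close> vanishes. Regularity thus reduces to that of
  \<open>beta\<close>.\<close>

lemma C1_on_Hbar: "C1_on (\<lambda>(\<delta>, h). Hbar \<kappa> m1 m2 \<delta> h) ({0..l / 4} \<times> hdom)"
proof -
  let ?S = "{0..l / 4} \<times> hdom"
  have proj: "C1_on (\<lambda>p. fst p) ?S" "C1_on (\<lambda>p. fst (snd p)) ?S" "C1_on (\<lambda>p. fst (snd (snd p))) ?S"
    "C1_on (\<lambda>p. fst (snd (snd (snd p))) $ j) ?S" "C1_on (\<lambda>p. snd (snd (snd (snd p))) $ k) ?S" for j k
    by (intro C1_on_linear_compose[OF bounded_linear_fst] C1_on_linear_compose[OF bounded_linear_snd]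
        C1_on_linear_compose[OF bounded_linear_vec_nth] C1_on_linear[OF bounded_linear_ident])+
  have f1: "C1_on (\<lambda>p. mean_force (fst p) (fst (snd p)) (fst (snd (snd (snd p))) $ j)) ?S" for j
    by (intro C1_on_mean_force proj) (auto simp: hdom_def mem_Edom)
  have f2: "C1_on (\<lambda>p. mean_force (fst p) (1 - fst (snd p)) (snd (snd (snd (snd p))) $ j)) ?S" for j
    by (intro C1_on_mean_force proj C1_on_diff C1_on_const) (auto simp: hdom_def mem_Edom)
  show ?thesis
  proof (rule C1_on_cong)
    show "C1_on (\<lambda>p. (fst (snd (snd p)),
        (\<Sum>j\<in>UNIV. mean_force (fst p) (fst (snd p)) (fst (snd (snd (snd p))) $ j))
        - (\<Sum>j\<in>UNIV. mean_force (fst p) (1 - fst (snd p)) (snd (snd (snd (snd p))) $ j)),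
        (\<chi> j. - fst (snd (snd p)) * mean_force (fst p) (fst (snd p)) (fst (snd (snd (snd p))) $ j)),
        (\<chi> j. fst (snd (snd p)) * mean_force (fst p) (1 - fst (snd p)) (snd (snd (snd (snd p))) $ j)))) ?S"
      by (intro C1_on_Pair C1_on_diff C1_on_sum C1_on_vec_lambda C1_on_mult C1_on_minus proj f1 f2)
  next
    fix p :: "real \<times> ('n1, 'n2) slowvar" assume "p \<in> ?S"
    then show "(case p of (\<delta>, h) \<Rightarrow> Hbar \<kappa> m1 m2 \<delta> h) = (fst (snd (snd p)),
        (\<Sum>j\<in>UNIV. mean_force (fst p) (fst (snd p)) (fst (snd (snd (snd p))) $ j))
        - (\<Sum>j\<in>UNIV. mean_force (fst p) (1 - fst (snd p)) (snd (snd (snd (snd p))) $ j)),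
        (\<chi> j. - fst (snd (snd p)) * mean_force (fst p) (fst (snd p)) (fst (snd (snd (snd p))) $ j)),
        (\<chi> j. fst (snd (snd p)) * mean_force (fst p) (1 - fst (snd p)) (snd (snd (snd (snd p))) $ j)))"
      by (cases p) (auto simp: Hbar_eq)
  qed
qed

text \<open>Mean value inequality on a convex compact box, with a derivative bound uniform in
  \<open>\<delta>\<close>. The bound \<open>wm\<close> restores the compactness that
  \<open>hdom\<close> lacks in the direction of \<open>W\<close>.\<close>

lemma Hbar_lipschitz:
  obtains \<Lambda> where "0 \<le> \<Lambda>"
    "\<And>\<delta> h h'. \<delta> \<in> {0..l / 4} \<Longrightarrow> h \<in> hdom \<Longrightarrow> h' \<in> hdom \<Longrightarrow> \<bar>fst (snd h)\<bar> \<le> wm \<Longrightarrow> \<bar>fst (snd h')\<bar> \<le> wm \<Longrightarrow>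
      norm (Hbar \<kappa> m1 m2 \<delta> h - Hbar \<kappa> m1 m2 \<delta> h') \<le> \<Lambda> * norm (h - h')"
proof -
  define K :: "('n1, 'n2) slowvar set" where "K = {l..1 - l} \<times> {- wm..wm} \<times> Edom \<times> Edom"
  have K_hdom: "K \<subseteq> hdom" by (auto simp: K_def hdom_def)
  have comp: "compact ({0..l / 4} \<times> K)" and conv: "convex K"
    unfolding K_def Edom_def by (intro compact_Times compact_Icc compact_cbox convex_Times convex_closed_interval convex_box convex_real_interval)+
  obtain D where D: "\<And>p. p \<in> {0..l / 4} \<times> hdom \<Longrightarrow>
      ((\<lambda>(\<delta>, h). Hbar \<kappa> m1 m2 \<delta> h) has_derivative blinfun_apply (D p)) (at p within {0..l / 4} \<times> hdom)"
      "continuous_on ({0..l / 4} \<times> hdom) D"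
    using C1_on_Hbar unfolding C1_on_def by blast
  have "continuous_on ({0..l / 4} \<times> K) (\<lambda>p. norm (D p))"
    by (intro continuous_intros continuous_on_subset[OF D(2)]) (use K_hdom in auto)
  then obtain \<Lambda> where \<Lambda>: "0 \<le> \<Lambda>" "\<And>p. p \<in> {0..l / 4} \<times> K \<Longrightarrow> \<bar>norm (D p)\<bar> \<le> \<Lambda>"
    using bounded_real_on_compact[OF comp] by blast
  show thesis
  proof (rule that[OF \<Lambda>(1)])
    fix \<delta> and h h' :: "('n1, 'n2) slowvar"
    assume \<delta>: "\<delta> \<in> {0..l / 4}" and h: "h \<in> hdom" "h' \<in> hdom" "\<bar>fst (snd h)\<bar> \<le> wm" "\<bar>fst (snd h')\<bar> \<le> wm"
    have hK: "h \<in> K" "h' \<in> K" using h by (auto simp: K_def hdom_def)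
    show "norm (Hbar \<kappa> m1 m2 \<delta> h - Hbar \<kappa> m1 m2 \<delta> h') \<le> \<Lambda> * norm (h - h')"
    proof (rule differentiable_bound[OF conv _ _ hK])
      fix x assume x: "x \<in> K"
      have "((\<lambda>h. (\<delta>, h)) has_derivative (\<lambda>u. (0, u))) (at x within K)"
        by (auto intro!: derivative_eq_intros)
      moreover have "((\<lambda>(\<delta>, h). Hbar \<kappa> m1 m2 \<delta> h) has_derivative blinfun_apply (D (\<delta>, x))) (at (\<delta>, x) within Pair \<delta> ` K)"
        by (rule has_derivative_subset[OF D(1)]) (use \<delta> x K_hdom in auto)
      ultimately show "(Hbar \<kappa> m1 m2 \<delta> has_derivative (\<lambda>u. D (\<delta>, x) (0, u))) (at x within K)"
        using has_derivative_in_compose[of "Pair \<delta>" _ x K "\<lambda>(\<delta>, h). Hbar \<kappa> m1 m2 \<delta> h"] by simp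
      show "onorm (\<lambda>u. blinfun_apply (D (\<delta>, x)) (0, u)) \<le> \<Lambda>"
      proof (rule onorm_le)
        fix u :: "('n1, 'n2) slowvar"
        have "norm (D (\<delta>, x) (0, u)) \<le> norm (D (\<delta>, x)) * norm (0::real, u)" by (rule norm_blinfun)
        also have "\<dots> \<le> \<Lambda> * norm u" using \<Lambda>(2)[of "(\<delta>, x)"] \<delta> x by (auto intro!: mult_right_mono simp: norm_Pair)
        finally show "norm (D (\<delta>, x) (0, u)) \<le> \<Lambda> * norm u" .
      qed
    qed
  qed
qed

subsection \<open>The corrected slow variables\<close>

lemma norm_slow_le: "norm (a :: real, b :: real, x, y) \<le> \<bar>a\<bar> + \<bar>b\<bar> + (\<Sum>j\<in>UNIV. \<bar>x $ j\<bar>) + (\<Sum>j\<in>UNIV. \<bar>y $ j\<bar>)"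
  for x :: "real ^ 'n1" and y :: "real ^ 'n2"
  using norm_Pair_le[of a "(b, x, y)"] norm_Pair_le[of b "(x, y)"] norm_Pair_le[of x y]
    norm_le_l1_cart[of x] norm_le_l1_cart[of y] by simp

definition nn :: real where "nn = real CARD('n1) + real CARD('n2)"

lemma nn_pos: "0 < nn" by (simp add: nn_def add_pos_pos)

lemma sum_le_nn:
  assumes "\<And>j. f j \<le> b" "\<And>j. g j \<le> b"
  shows "(\<Sum>j\<in>(UNIV::'n1 set). f j) + (\<Sum>j\<in>(UNIV::'n2 set). g j) \<le> nn * b"
  using sum_bounded_above[of "UNIV::'n1 set" f b] sum_bounded_above[of "UNIV::'n2 set" g b] assms
  by (simp add: nn_def algebra_simps)

text \<open>The signs are those that cancel the oscillating forces: \<open>W\<close> is driven by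
  \<open>\<epsilon> * (F1 - F2)\<close>, \<open>E1\<close> by \<open>- V * F1\<close> and
  \<open>E2\<close> by \<open>V * F2\<close>, while a corrector has derivative force minus mean
  force plus a small remainder.\<close>

definition corrected :: "real \<Rightarrow> real \<Rightarrow> real \<Rightarrow> ('n1 \<Rightarrow> real) \<Rightarrow> ('n2 \<Rightarrow> real) \<Rightarrow> ('n1 \<Rightarrow> real) \<Rightarrow> ('n2 \<Rightarrow> real) \<Rightarrow> ('n1, 'n2) slowvar" where
  "corrected \<epsilon> X V E1 E2 P1 P2 =
    (X, V / \<epsilon> - \<epsilon> * ((\<Sum>j\<in>UNIV. P1 j) - (\<Sum>j\<in>UNIV. P2 j)), (\<chi> j. E1 j + V * P1 j), (\<chi> j. E2 j - V * P2 j))"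

lemma corrected_near:
  assumes "0 < \<epsilon>" "0 \<le> b" "\<bar>V\<bar> \<le> \<epsilon> * b" "\<And>j. \<bar>P1 j\<bar> \<le> K" "\<And>j. \<bar>P2 j\<bar> \<le> K"
  shows "norm (corrected \<epsilon> X V E1 E2 P1 P2 - (X, V / \<epsilon>, (\<chi> j. E1 j), (\<chi> j. E2 j))) \<le> \<epsilon> * (nn * (1 + b) * K)"
proof -
  let ?d = "corrected \<epsilon> X V E1 E2 P1 P2 - (X, V / \<epsilon>, (\<chi> j. E1 j), (\<chi> j. E2 j))"
  have "?d = (0, - \<epsilon> * ((\<Sum>j\<in>UNIV. P1 j) - (\<Sum>j\<in>UNIV. P2 j)), (\<chi> j. V * P1 j), (\<chi> j. - V * P2 j))"
    by (simp add: corrected_def vec_eq_iff)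
  then have "norm ?d \<le> \<epsilon> * \<bar>(\<Sum>j\<in>UNIV. P1 j) - (\<Sum>j\<in>UNIV. P2 j)\<bar> + ((\<Sum>j\<in>UNIV. \<bar>V * P1 j\<bar>) + (\<Sum>j\<in>UNIV. \<bar>V * P2 j\<bar>))"
    using norm_slow_le[of 0 "- \<epsilon> * ((\<Sum>j\<in>UNIV. P1 j) - (\<Sum>j\<in>UNIV. P2 j))" "\<chi> j. V * P1 j" "\<chi> j. - V * P2 j"] assms(1)
    by (simp add: abs_mult)
  also have "\<dots> \<le> \<epsilon> * (nn * K) + nn * (\<epsilon> * b * K)"
  proof (intro add_mono mult_left_mono)
    have "\<bar>(\<Sum>j\<in>UNIV. P1 j) - (\<Sum>j\<in>UNIV. P2 j)\<bar> \<le> (\<Sum>j\<in>UNIV. \<bar>P1 j\<bar>) + (\<Sum>j\<in>UNIV. \<bar>P2 j\<bar>)"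
      using sum_abs[of P1 UNIV] sum_abs[of P2 UNIV] by linarith
    also have "\<dots> \<le> nn * K" by (rule sum_le_nn) (use assms in auto)
    finally show "\<bar>(\<Sum>j\<in>UNIV. P1 j) - (\<Sum>j\<in>UNIV. P2 j)\<bar> \<le> nn * K" .
    have "\<bar>V * p\<bar> \<le> \<epsilon> * b * K" if "\<bar>p\<bar> \<le> K" for p
      unfolding abs_mult by (rule mult_mono) (use assms that in auto)
    then show "(\<Sum>j\<in>UNIV. \<bar>V * P1 j\<bar>) + (\<Sum>j\<in>UNIV. \<bar>V * P2 j\<bar>) \<le> nn * (\<epsilon> * b * K)"
      using assms by (intro sum_le_nn) auto
  qed (use assms in auto)
  finally show ?thesis by (simp add: algebra_simps)
qed

text \<open>Soft and hard core share this computation: between collisions of the hard core all \<open>F\<close> vanish.\<close>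

lemma corrected_derivative:
  fixes X V :: "real \<Rightarrow> real" and E1 P1 :: "'n1 \<Rightarrow> real \<Rightarrow> real" and E2 P2 :: "'n2 \<Rightarrow> real \<Rightarrow> real"
    and F1 A1 r1 :: "'n1 \<Rightarrow> real" and F2 A2 r2 :: "'n2 \<Rightarrow> real"
  assumes \<epsilon>: "0 < \<epsilon>" "\<epsilon> \<le> 1"
    and X: "(X has_real_derivative V t) (at t within S)"
    and V: "(V has_real_derivative \<epsilon>\<^sup>2 * ((\<Sum>j\<in>UNIV. F1 j) - (\<Sum>j\<in>UNIV. F2 j))) (at t within S)"
    and E1: "\<And>j. (E1 j has_real_derivative - V t * F1 j) (at t within S)"
    and E2: "\<And>j. (E2 j has_real_derivative V t * F2 j) (at t within S)"
    and P1: "\<And>j. (P1 j has_real_derivative F1 j - A1 j + r1 j) (at t within S)"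
    and P2: "\<And>j. (P2 j has_real_derivative F2 j - A2 j + r2 j) (at t within S)"
    and F: "\<And>j. 0 \<le> F1 j" "\<And>j. 0 \<le> F2 j"
    and A: "\<And>j. A1 j \<le> Ka" "\<And>j. A2 j \<le> Ka" and Ka: "0 \<le> Ka"
    and r: "\<And>j. \<bar>r1 j\<bar> \<le> Kr * \<epsilon> * (1 + ((\<Sum>j\<in>UNIV. F1 j) + (\<Sum>j\<in>UNIV. F2 j)))"
      "\<And>j. \<bar>r2 j\<bar> \<le> Kr * \<epsilon> * (1 + ((\<Sum>j\<in>UNIV. F1 j) + (\<Sum>j\<in>UNIV. F2 j)))"
    and Kr: "0 \<le> Kr" and small: "\<epsilon> * (nn * Kr) \<le> 1 / 2"
    and Vb: "\<bar>V t\<bar> \<le> \<epsilon> * wm"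
    and Pb: "\<And>j. \<bar>P1 j t\<bar> \<le> Kp" "\<And>j. \<bar>P2 j t\<bar> \<le> Kp" and Kp: "0 \<le> Kp"
  obtains z' N' where
    "((\<lambda>t. corrected \<epsilon> (X t) (V t) (\<lambda>j. E1 j t) (\<lambda>j. E2 j t) (\<lambda>j. P1 j t) (\<lambda>j. P2 j t)) has_vector_derivative z') (at t within S)"
    "((\<lambda>t. 2 * ((\<Sum>j\<in>UNIV. P1 j t) + (\<Sum>j\<in>UNIV. P2 j t)) + (2 * nn * Ka + 2) * t) has_real_derivative N') (at t within S)"
    "1 \<le> N'"
    "norm (z' - \<epsilon> *\<^sub>R (V t / \<epsilon>, (\<Sum>j\<in>UNIV. A1 j) - (\<Sum>j\<in>UNIV. A2 j), (\<chi> j. - (V t / \<epsilon>) * A1 j), (\<chi> j. (V t / \<epsilon>) * A2 j)))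
      \<le> \<epsilon>\<^sup>2 * (nn * (Kr + Kp + wm * Kr)) * N'"
proof -
  define Ft where "Ft = (\<Sum>j\<in>UNIV. F1 j) + (\<Sum>j\<in>UNIV. F2 j)"
  define a where "a = \<epsilon>\<^sup>2 * ((\<Sum>j\<in>UNIV. F1 j) - (\<Sum>j\<in>UNIV. F2 j))"
  have sF: "0 \<le> (\<Sum>j\<in>UNIV. F1 j)" "0 \<le> (\<Sum>j\<in>UNIV. F2 j)" by (auto intro: sum_nonneg F)
  then have Ft: "0 \<le> Ft" by (simp add: Ft_def)
  have a: "\<bar>a\<bar> \<le> \<epsilon>\<^sup>2 * (1 + Ft)"
    unfolding a_def abs_mult by (rule mult_mono) (use sF in \<open>auto simp: Ft_def\<close>)
  define B where "B = Kr * \<epsilon> * (1 + Ft)"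
  have B: "0 \<le> B" using Kr \<epsilon> Ft by (simp add: B_def)
  have r': "\<bar>r1 j\<bar> \<le> B" "\<bar>r2 k\<bar> \<le> B" for j k using r by (auto simp: B_def Ft_def)
  define z' where "z' = (V t, a / \<epsilon> - \<epsilon> * ((\<Sum>j\<in>UNIV. F1 j - A1 j + r1 j) - (\<Sum>j\<in>UNIV. F2 j - A2 j + r2 j)),
      (\<chi> j. - V t * F1 j + (a * P1 j t + V t * (F1 j - A1 j + r1 j))),
      (\<chi> j. V t * F2 j - (a * P2 j t + V t * (F2 j - A2 j + r2 j))))"
  define N' where "N' = 2 * ((\<Sum>j\<in>UNIV. F1 j - A1 j + r1 j) + (\<Sum>j\<in>UNIV. F2 j - A2 j + r2 j)) + (2 * nn * Ka + 2)"
  have V': "(V has_real_derivative a) (at t within S)" using V by (simp add: a_def)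
  have 1: "((\<lambda>t. corrected \<epsilon> (X t) (V t) (\<lambda>j. E1 j t) (\<lambda>j. E2 j t) (\<lambda>j. P1 j t) (\<lambda>j. P2 j t)) has_vector_derivative z') (at t within S)"
    unfolding corrected_def z'_def
  proof (intro has_vector_derivative_Pair has_vector_derivative_vec_lambda)
    show "(X has_vector_derivative V t) (at t within S)"
      using X by (simp add: has_real_derivative_iff_has_vector_derivative)
    show "((\<lambda>t. V t / \<epsilon> - \<epsilon> * ((\<Sum>j\<in>UNIV. P1 j t) - (\<Sum>j\<in>UNIV. P2 j t))) has_vector_derivative
        a / \<epsilon> - \<epsilon> * ((\<Sum>j\<in>UNIV. F1 j - A1 j + r1 j) - (\<Sum>j\<in>UNIV. F2 j - A2 j + r2 j))) (at t within S)"
      unfolding has_real_derivative_iff_has_vector_derivative[symmetric]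
      by (intro DERIV_diff DERIV_cdivide V' DERIV_cmult DERIV_sum P1 P2)
    show "((\<lambda>t. E1 j t + V t * P1 j t) has_real_derivative
        - V t * F1 j + (a * P1 j t + V t * (F1 j - A1 j + r1 j))) (at t within S)" for j
      by (rule DERIV_cong[OF DERIV_add[OF E1 DERIV_mult[OF V' P1]]]) (simp add: algebra_simps)
    show "((\<lambda>t. E2 j t - V t * P2 j t) has_real_derivative
        V t * F2 j - (a * P2 j t + V t * (F2 j - A2 j + r2 j))) (at t within S)" for j
      by (rule DERIV_cong[OF DERIV_diff[OF E2 DERIV_mult[OF V' P2]]]) (simp add: algebra_simps)
  qed
  have 2: "((\<lambda>t. 2 * ((\<Sum>j\<in>UNIV. P1 j t) + (\<Sum>j\<in>UNIV. P2 j t)) + (2 * nn * Ka + 2) * t) has_real_derivative N') (at t within S)"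
    unfolding N'_def
    by (rule DERIV_cong[OF DERIV_add[OF DERIV_cmult[OF DERIV_add[OF DERIV_sum[OF P1] DERIV_sum[OF P2]]] DERIV_cmult[OF DERIV_ident]]])
      simp
  have nB: "nn * B \<le> 1 / 2 * (1 + Ft)"
    using mult_right_mono[OF small, of "1 + Ft"] Ft by (simp add: B_def algebra_simps)
  \<comment> \<open>Of the available \<open>2 * Ft + 2\<close> the remainders use up at most
    \<open>1 + Ft\<close>, and \<open>2 * nn * Ka\<close> offsets the mean forces. This explains the
    coefficients of the clock.\<close>
  have 3: "1 + Ft \<le> N'"
  proof -
    have "(\<Sum>j\<in>UNIV. A1 j - r1 j) + (\<Sum>j\<in>UNIV. A2 j - r2 j) \<le> nn * (Ka + B)"
      by (rule sum_le_nn) (use A r' in \<open>smt (verit)\<close>)+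
    then have "Ft - nn * (Ka + B) \<le> (\<Sum>j\<in>UNIV. F1 j - A1 j + r1 j) + (\<Sum>j\<in>UNIV. F2 j - A2 j + r2 j)"
      by (simp add: Ft_def sum.distrib sum_subtractf)
    then show ?thesis using nB by (simp add: N'_def algebra_simps)
  qed
  \<comment> \<open>All terms with a bare force cancel. There remain the remainders and the
    product-rule terms \<open>a * P\<close>, small because the acceleration \<open>a\<close> of the
    piston carries the factor \<open>\<epsilon>\<^sup>2\<close>.\<close>
  have "z' - \<epsilon> *\<^sub>R (V t / \<epsilon>, (\<Sum>j\<in>UNIV. A1 j) - (\<Sum>j\<in>UNIV. A2 j), (\<chi> j. - (V t / \<epsilon>) * A1 j), (\<chi> j. (V t / \<epsilon>) * A2 j))
    = (0, - \<epsilon> * ((\<Sum>j\<in>UNIV. r1 j) - (\<Sum>j\<in>UNIV. r2 j)), (\<chi> j. a * P1 j t + V t * r1 j), (\<chi> j. - (a * P2 j t + V t * r2 j)))"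
    (is "?d = _")
  proof -
    have "a / \<epsilon> = \<epsilon> * (\<Sum>j\<in>UNIV. F1 j) - \<epsilon> * (\<Sum>j\<in>UNIV. F2 j)"
      using \<epsilon> by (simp add: a_def power2_eq_square field_simps)
    then show ?thesis
      using \<epsilon> by (simp add: z'_def vec_eq_iff sum.distrib sum_subtractf algebra_simps)
  qed
  then have "norm ?d \<le> \<epsilon> * \<bar>(\<Sum>j\<in>UNIV. r1 j) - (\<Sum>j\<in>UNIV. r2 j)\<bar>
      + ((\<Sum>j\<in>UNIV. \<bar>a * P1 j t + V t * r1 j\<bar>) + (\<Sum>j\<in>UNIV. \<bar>a * P2 j t + V t * r2 j\<bar>))"
    using norm_slow_le[of 0 "- \<epsilon> * ((\<Sum>j\<in>UNIV. r1 j) - (\<Sum>j\<in>UNIV. r2 j))"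
        "\<chi> j. a * P1 j t + V t * r1 j" "\<chi> j. - (a * P2 j t + V t * r2 j)"] \<epsilon>
    by (simp only: vec_lambda_beta abs_minus_cancel abs_mult abs_zero abs_of_pos)
  also have "\<dots> \<le> \<epsilon> * (nn * B) + nn * (\<epsilon>\<^sup>2 * (1 + Ft) * Kp + \<epsilon> * wm * B)"
  proof (intro add_mono mult_left_mono)
    have "\<bar>(\<Sum>j\<in>UNIV. r1 j) - (\<Sum>j\<in>UNIV. r2 j)\<bar> \<le> (\<Sum>j\<in>UNIV. \<bar>r1 j\<bar>) + (\<Sum>j\<in>UNIV. \<bar>r2 j\<bar>)"
      using sum_abs[of r1 UNIV] sum_abs[of r2 UNIV] by linarith
    also have "\<dots> \<le> nn * B" by (rule sum_le_nn) (use r' in auto)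
    finally show "\<bar>(\<Sum>j\<in>UNIV. r1 j) - (\<Sum>j\<in>UNIV. r2 j)\<bar> \<le> nn * B" .
    have bd: "\<bar>a * p + V t * q\<bar> \<le> \<epsilon>\<^sup>2 * (1 + Ft) * Kp + \<epsilon> * wm * B" if "\<bar>p\<bar> \<le> Kp" "\<bar>q\<bar> \<le> B" for p q
      by (rule order_trans[OF abs_triangle_ineq], unfold abs_mult, intro add_mono mult_mono)
        (use a Vb that B Kp Ft \<epsilon> wm in auto)
    show "(\<Sum>j\<in>UNIV. \<bar>a * P1 j t + V t * r1 j\<bar>) + (\<Sum>j\<in>UNIV. \<bar>a * P2 j t + V t * r2 j\<bar>)
       \<le> nn * (\<epsilon>\<^sup>2 * (1 + Ft) * Kp + \<epsilon> * wm * B)"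
      by (intro sum_le_nn bd Pb r')
  qed (use \<epsilon> in auto)
  also have "\<dots> = \<epsilon>\<^sup>2 * (nn * (Kr + Kp + wm * Kr)) * (1 + Ft)"
    by (simp add: B_def power2_eq_square algebra_simps)
  also have "\<dots> \<le> \<epsilon>\<^sup>2 * (nn * (Kr + Kp + wm * Kr)) * N'"
    by (rule mult_left_mono[OF 3]) (use nn_pos Kr Kp wm in simp)
  finally show thesis using that[OF 1 2] 3 Ft by linarith
qed

end

section \<open>From full states to single cells\<close>

lemma pstate_components:
  fixes y :: "real \<Rightarrow> ('a::finite, 'b::finite) pstate"
  obtains X V x1 v1 x2 v2 where "y = (\<lambda>t. (X t, V t, x1 t, v1 t, x2 t, v2 t))"
proof
  show "y = (\<lambda>t. (fst (y t), fst (snd (y t)), fst (snd (snd (y t))), fst (snd (snd (snd (y t)))),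
      fst (snd (snd (snd (snd (y t))))), snd (snd (snd (snd (snd (y t)))))))"
    by simp
qed

lemma pstate_derivatives:
  fixes t :: real
  assumes "((\<lambda>t. (X t, V t, x1 t, v1 t, x2 t, v2 t)) has_vector_derivative (X', V', x1', v1', x2', v2')) (at t within S)"
  shows "(X has_real_derivative X') (at t within S)" "(V has_real_derivative V') (at t within S)"
    "((\<lambda>t. x1 t $ i) has_real_derivative x1' $ i) (at t within S)"
    "((\<lambda>t. v1 t $ i) has_real_derivative v1' $ i) (at t within S)"
    "((\<lambda>t. x2 t $ j) has_real_derivative x2' $ j) (at t within S)"
    "((\<lambda>t. v2 t $ j) has_real_derivative v2' $ j) (at t within S)"
proof -
  note fs = bounded_linear.has_vector_derivative[OF bounded_linear_fst]
    and sn = bounded_linear.has_vector_derivative[OF bounded_linear_snd]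
    and nt = bounded_linear.has_vector_derivative[OF bounded_linear_vec_nth]
  note a = assms and b = sn[OF assms] 
  note c = sn[OF b] 
  note d = sn[OF c]
  note e = sn[OF d]
  show "(X has_real_derivative X') (at t within S)" "(V has_real_derivative V') (at t within S)"
    "((\<lambda>t. x1 t $ i) has_real_derivative x1' $ i) (at t within S)"
    "((\<lambda>t. v1 t $ i) has_real_derivative v1' $ i) (at t within S)"
    "((\<lambda>t. x2 t $ j) has_real_derivative x2' $ j) (at t within S)"
    "((\<lambda>t. v2 t $ j) has_real_derivative v2' $ j) (at t within S)"
    using fs[OF a] fs[OF b] nt[OF fs[OF c], of i] nt[OF fs[OF d], of i] nt[OF fs[OF e], of j] nt[OF sn[OF e], of j]
    by (simp_all add: has_real_derivative_iff_has_vector_derivative)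
qed

context piston
begin

definition Gset :: "('n1, 'n2) slowvar set" where
  "Gset = {l..1 - l} \<times> {- wm..wm} \<times> cbox (\<chi> j. c0) (\<chi> j. c1) \<times> cbox (\<chi> j. c0) (\<chi> j. c1)"

lemma mem_Gset: "(X, W, E1, E2) \<in> Gset \<longleftrightarrow> l \<le> X \<and> X \<le> 1 - l \<and> \<bar>W\<bar> \<le> wm \<and>
    (\<forall>j. c0 \<le> E1 $ j \<and> E1 $ j \<le> c1) \<and> (\<forall>j. c0 \<le> E2 $ j \<and> E2 $ j \<le> c1)"
  by (auto simp: Gset_def mem_box_cart)

lemma closed_Gset: "closed Gset"
  unfolding Gset_def by (intro closed_Times closed_cbox closed_atLeastAtMost)

lemma Gset_hdom: "Gset \<subseteq> hdom"
proof
  fix h assume "h \<in> Gset"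
  moreover obtain X W E1 E2 where "h = (X, W, E1, E2)" by (metis surj_pair)
  ultimately show "h \<in> hdom"
    using c by (auto simp: mem_Gset hdom_def mem_Edom intro: order_trans[OF less_imp_le] order_trans[OF _ less_imp_le])
qed

definition ener1 where "ener1 \<delta> X (x1 :: real ^ 'n1) (v1 :: real ^ 'n1) j = energy (m1 $ j) \<delta> X (x1 $ j) (v1 $ j)"
text \<open>Reflection at the midpoint of the unit interval turns the right gas into a left one: the
  cell has length \<open>1 - X\<close>, its fixed wall is at 0, and all velocities change sign. The
  single-cell results then serve both sides.\<close>

definition ener2 where "ener2 \<delta> X (x2 :: real ^ 'n2) (v2 :: real ^ 'n2) j = energy (m2 $ j) \<delta> (1 - X) (1 - x2 $ j) (- v2 $ j)"
definition corr1 where "corr1 \<delta> X V (x1 :: real ^ 'n1) (v1 :: real ^ 'n1) j = corr (m1 $ j) \<delta> X V (x1 $ j) (v1 $ j)"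
definition corr2 where "corr2 \<delta> X V (x2 :: real ^ 'n2) (v2 :: real ^ 'n2) j = corr (m2 $ j) \<delta> (1 - X) (- V) (1 - x2 $ j) (- v2 $ j)"

lemma slow_eq: "slow \<kappa> m1 m2 \<epsilon> \<delta> (X, V, x1, v1, x2, v2) =
    (X, V / \<epsilon>, (\<chi> j. ener1 \<delta> X x1 v1 j), (\<chi> j. ener2 \<delta> X x2 v2 j))"
proof -
  have "kd \<kappa> \<delta> (1 - X - (1 - x2 $ j)) = kd \<kappa> \<delta> (x2 $ j - X)" for j by (rule arg_cong) simp
  then show ?thesis
    by (simp only: slow_def ener1_def ener2_def energy_def split) (simp add: fun_eq_iff add.commute)
qed

definition corr_slow :: "real \<Rightarrow> real \<Rightarrow> ('n1, 'n2) pstate \<Rightarrow> ('n1, 'n2) slowvar" where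
  "corr_slow \<epsilon> \<delta> = (\<lambda>(X, V, x1, v1, x2, v2). corrected \<epsilon> X V (ener1 \<delta> X x1 v1) (ener2 \<delta> X x2 v2)
     (corr1 \<delta> X V x1 v1) (corr2 \<delta> X V x2 v2))"

definition corr_sum :: "real \<Rightarrow> ('n1, 'n2) pstate \<Rightarrow> real" where
  "corr_sum \<delta> = (\<lambda>(X, V, x1, v1, x2, v2). (\<Sum>j\<in>UNIV. corr1 \<delta> X V x1 v1 j) + (\<Sum>j\<in>UNIV. corr2 \<delta> X V x2 v2 j))"

lemma abs_corr_sum_le:
  assumes "\<And>j. \<bar>corr1 \<delta> X V x1 v1 j\<bar> \<le> K" "\<And>j. \<bar>corr2 \<delta> X V x2 v2 j\<bar> \<le> K"
  shows "\<bar>corr_sum \<delta> (X, V, x1, v1, x2, v2)\<bar> \<le> nn * K"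
proof -
  have "\<bar>corr_sum \<delta> (X, V, x1, v1, x2, v2)\<bar> \<le> (\<Sum>j\<in>UNIV. \<bar>corr1 \<delta> X V x1 v1 j\<bar>) + (\<Sum>j\<in>UNIV. \<bar>corr2 \<delta> X V x2 v2 j\<bar>)"
    unfolding corr_sum_def by (auto intro!: order_trans[OF abs_triangle_ineq] add_mono sum_abs)
  also have "\<dots> \<le> nn * K" by (rule sum_le_nn) (use assms in auto)
  finally show ?thesis .
qed

lemma slow_in_Gset:
  assumes "slow \<kappa> m1 m2 \<epsilon> \<delta> (X, V, x1, v1, x2, v2) \<in> Gset" "0 < \<epsilon>"
  shows "l \<le> X" "X \<le> 1 - l" "\<bar>V\<bar> \<le> \<epsilon> * wm" "c0 \<le> ener1 \<delta> X x1 v1 j" "ener1 \<delta> X x1 v1 j \<le> c1"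
    "c0 \<le> ener2 \<delta> X x2 v2 k" "ener2 \<delta> X x2 v2 k \<le> c1"
  using assms by (auto simp: slow_eq mem_Gset abs_divide field_simps)

lemma Hbar_slow:
  assumes "slow \<kappa> m1 m2 \<epsilon> \<delta> (X, V, x1, v1, x2, v2) \<in> Gset" "0 \<le> \<delta>" "4 * \<delta> \<le> l"
  shows "Hbar \<kappa> m1 m2 \<delta> (slow \<kappa> m1 m2 \<epsilon> \<delta> (X, V, x1, v1, x2, v2)) =
    (V / \<epsilon>, (\<Sum>j\<in>UNIV. mean_force \<delta> X (ener1 \<delta> X x1 v1 j)) - (\<Sum>j\<in>UNIV. mean_force \<delta> (1 - X) (ener2 \<delta> X x2 v2 j)),
     (\<chi> j. - (V / \<epsilon>) * mean_force \<delta> X (ener1 \<delta> X x1 v1 j)),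
     (\<chi> j. (V / \<epsilon>) * mean_force \<delta> (1 - X) (ener2 \<delta> X x2 v2 j)))"
  using Hbar_eq[of X "V / \<epsilon>" "\<chi> j. ener1 \<delta> X x1 v1 j" "\<chi> j. ener2 \<delta> X x2 v2 j" \<delta>] assms Gset_hdom
  by (auto simp: slow_eq)

subsection \<open>Soft core\<close>

text \<open>With finitely many masses, the largest \<open>K\<close> and the smallest
  \<open>\<nu>\<close> serve all particles.\<close>

lemma corr_est_finite:
  assumes "finite S" "\<And>m. m \<in> S \<Longrightarrow> 0 < m"
  shows "\<exists>K \<nu>. 0 \<le> K \<and> 0 < \<nu> \<and> (\<forall>m\<in>S. corr_est l c0 c1 m K \<nu>)"
  using assms
proof (induction S rule: finite_induct)
  case empty
  show ?case by (rule exI[of _ 0], rule exI[of _ 1]) simp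
next
  case (insert m S)
  then obtain K \<nu> where K: "0 \<le> K" "0 < \<nu>" "\<And>m. m \<in> S \<Longrightarrow> corr_est l c0 c1 m K \<nu>" by auto
  obtain K' \<nu>' where K': "corr_est l c0 c1 m K' \<nu>'"
    using corr_estimates[OF _ l c, of m] insert.prems by auto
  then have \<nu>': "0 < \<nu>'" by (simp add: corr_est_def)
  have "corr_est l c0 c1 n (max K K') (min \<nu> \<nu>')" if "n \<in> insert m S" for n
  proof (cases "n = m")
    case True
    show ?thesis unfolding True by (rule corr_est_mono[OF K']) (use K \<nu>' in auto)
  next
    case False
    then have "n \<in> S" using that by simp
    show ?thesis by (rule corr_est_mono[OF K(3)[OF \<open>n \<in> S\<close>]]) (use K \<nu>' in auto)
  qed
  with K \<nu>' show ?case by (intro exI[of _ "max K K'"] exI[of _ "min \<nu> \<nu>'"]) auto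
qed

definition Ka :: real where "Ka = 4 * e1 / l"

lemma Ka_nonneg: "0 \<le> Ka" using e0 e01 l by (simp add: Ka_def)

text \<open>Bounded correctors leave the linear part as the main growth of the clock, and
  \<open>1 \<le> 1 / \<epsilon>\<close> absorbs the boundary terms. This is the bound on the total
  momentum transfer.\<close>

lemma momentum_budget:
  assumes \<epsilon>: "0 < \<epsilon>" "\<epsilon> \<le> 1" and S: "\<bar>S0\<bar> \<le> nn * K" "\<bar>S1\<bar> \<le> nn * K" and \<tau>: "\<tau> \<le> T"
  shows "2 * S1 + (2 * nn * Ka + 2) * (\<tau> / \<epsilon>) - 2 * S0 \<le> (4 * nn * K + (2 * nn * Ka + 2) * T) / \<epsilon>"
proof -
  have nK: "0 \<le> nn * K" using S(1) by (rule order_trans[OF abs_ge_zero])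
  have "2 * S1 + (2 * nn * Ka + 2) * (\<tau> / \<epsilon>) - 2 * S0 \<le> 4 * (nn * K) + (2 * nn * Ka + 2) * (\<tau> / \<epsilon>)"
    using S by (simp add: abs_le_iff)
  also have "\<dots> \<le> 4 * (nn * K) / \<epsilon> + (2 * nn * Ka + 2) * (T / \<epsilon>)"
  proof (intro add_mono mult_left_mono)
    show "4 * (nn * K) \<le> 4 * (nn * K) / \<epsilon>"
      using mult_left_mono[OF \<epsilon>(2) nK] \<epsilon>(1) by (simp add: pos_le_divide_eq algebra_simps)
    show "\<tau> / \<epsilon> \<le> T / \<epsilon>" using \<tau> \<epsilon> by (simp add: divide_right_mono)
  qed (use nn_pos Ka_nonneg in simp)
  also have "\<dots> = (4 * nn * K + (2 * nn * Ka + 2) * T) / \<epsilon>" by (simp add: add_divide_distrib)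
  finally show ?thesis .
qed

lemma soft_averaging:
  fixes y :: "real \<Rightarrow> ('n1, 'n2) pstate" and hb :: "real \<Rightarrow> ('n1, 'n2) slowvar"
  assumes est: "\<And>j. corr_est l c0 c1 (m1 $ j) K \<nu>" "\<And>j. corr_est l c0 c1 (m2 $ j) K \<nu>"
    and \<Lambda>: "0 \<le> \<Lambda>" and lip: "\<And>h h'. h \<in> Gset \<Longrightarrow> h' \<in> Gset \<Longrightarrow>
      norm (Hbar \<kappa> m1 m2 \<delta> h - Hbar \<kappa> m1 m2 \<delta> h') \<le> \<Lambda> * norm (h - h')"
    and \<epsilon>: "0 < \<epsilon>" "\<epsilon> \<le> 1" "\<epsilon> * wm \<le> \<nu>" "\<epsilon> * (nn * (K * (1 + wm))) \<le> 1 / 2"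
    and \<delta>: "0 < \<delta>" "4 * \<delta> \<le> l" and \<tau>: "0 < \<tau>" "\<tau> \<le> T"
    and traj: "\<And>t. t \<in> {0..\<tau> / \<epsilon>} \<Longrightarrow> (y has_vector_derivative sc_field \<kappa> m1 m2 \<epsilon> \<delta> (y t)) (at t within {0..\<tau> / \<epsilon>})"
    and hb0: "hb 0 = slow \<kappa> m1 m2 \<epsilon> \<delta> (y 0)"
    and hb: "\<And>\<sigma>. \<sigma> \<in> {0..\<tau>} \<Longrightarrow> (hb has_vector_derivative Hbar \<kappa> m1 m2 \<delta> (hb \<sigma>)) (at \<sigma> within {0..\<tau>})"
    and G: "\<And>\<sigma>. 0 \<le> \<sigma> \<Longrightarrow> \<sigma> < \<tau> \<Longrightarrow> hb \<sigma> \<in> Gset \<and> slow \<kappa> m1 m2 \<epsilon> \<delta> (y (\<sigma> / \<epsilon>)) \<in> Gset"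
  defines "K1 \<equiv> nn * (1 + wm) * K"
    and "K2 \<equiv> nn * (K * (1 + wm) + K + wm * (K * (1 + wm)))"
    and "K3 \<equiv> 4 * nn * K + (2 * nn * Ka + 2) * T"
  shows "norm (slow \<kappa> m1 m2 \<epsilon> \<delta> (y (\<tau> / \<epsilon>)) - hb \<tau>) \<le> (exp (\<Lambda> * T) * (K1 + 1 + (\<Lambda> * K1 + K2) * \<bar>K3\<bar>) + K1) * \<epsilon>"
proof -
  define t1 where "t1 = \<tau> / \<epsilon>"
  have t1: "0 < t1" using \<tau> \<epsilon> by (simp add: t1_def)
  obtain X V x1 v1 x2 v2 where y: "y = (\<lambda>t. (X t, V t, x1 t, v1 t, x2 t, v2 t))"
    by (rule pstate_components)
  have dX: "\<And>t. t \<in> {0..t1} \<Longrightarrow> (X has_real_derivative V t) (at t within {0..t1})"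
    and dV: "\<And>t. t \<in> {0..t1} \<Longrightarrow> (V has_real_derivative
       \<epsilon>\<^sup>2 * ((\<Sum>j\<in>UNIV. - kd' \<kappa> \<delta> (X t - x1 t $ j)) - (\<Sum>j\<in>UNIV. - kd' \<kappa> \<delta> (x2 t $ j - X t)))) (at t within {0..t1})"
    and dx1: "\<And>t j. t \<in> {0..t1} \<Longrightarrow> ((\<lambda>t. x1 t $ j) has_real_derivative v1 t $ j) (at t within {0..t1})"
    and dv1: "\<And>t j. t \<in> {0..t1} \<Longrightarrow> ((\<lambda>t. v1 t $ j) has_real_derivative
       (- kd' \<kappa> \<delta> (x1 t $ j) + kd' \<kappa> \<delta> (X t - x1 t $ j)) / m1 $ j) (at t within {0..t1})"
    and dx2: "\<And>t j. t \<in> {0..t1} \<Longrightarrow> ((\<lambda>t. x2 t $ j) has_real_derivative v2 t $ j) (at t within {0..t1})"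
    and dv2: "\<And>t j. t \<in> {0..t1} \<Longrightarrow> ((\<lambda>t. v2 t $ j) has_real_derivative
       (- kd' \<kappa> \<delta> (x2 t $ j - X t) + kd' \<kappa> \<delta> (1 - x2 t $ j)) / m2 $ j) (at t within {0..t1})"
    using pstate_derivatives[OF traj[folded t1_def, unfolded y sc_field_def split]]
    by (simp_all add: sum_negf)
  let ?F1 = "\<lambda>t j. - kd' \<kappa> \<delta> (X t - x1 t $ j)" and ?F2 = "\<lambda>t j. - kd' \<kappa> \<delta> (x2 t $ j - X t)"
  define Ft where "Ft t = (\<Sum>j\<in>UNIV. ?F1 t j) + (\<Sum>j\<in>UNIV. ?F2 t j)" for t
  define h where "h t = slow \<kappa> m1 m2 \<epsilon> \<delta> (y t)" for t
  have refl: "1 - X t - (1 - x2 t $ j) = x2 t $ j - X t" for t j by simp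
  have dX': "((\<lambda>t. 1 - X t) has_real_derivative - V t) (at t within {0..t1})" if "t \<in> {0..t1}" for t
    using dX[OF that] by (auto intro!: derivative_eq_intros)
  have dx2': "((\<lambda>t. 1 - x2 t $ j) has_real_derivative - v2 t $ j) (at t within {0..t1})" if "t \<in> {0..t1}" for t j
    using dx2[OF that] by (auto intro!: derivative_eq_intros)
  have dv2': "((\<lambda>t. - v2 t $ j) has_real_derivative
      (- kd' \<kappa> \<delta> (1 - x2 t $ j) + kd' \<kappa> \<delta> (1 - X t - (1 - x2 t $ j))) / m2 $ j) (at t within {0..t1})"
    if "t \<in> {0..t1}" for t j
    unfolding refl by (rule DERIV_cong[OF DERIV_minus[OF dv2[OF that]]]) (simp add: divide_inverse algebra_simps)
  have dE1: "((\<lambda>t. ener1 \<delta> (X t) (x1 t) (v1 t) j) has_real_derivative - V t * ?F1 t j) (at t within {0..t1})"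
    if "t \<in> {0..t1}" for t j
    unfolding ener1_def
    by (rule DERIV_cong[OF has_real_derivative_energy[OF m1 \<delta>(1) dX[OF that] dx1[OF that] dv1[OF that]]]) simp
  have dE2: "((\<lambda>t. ener2 \<delta> (X t) (x2 t) (v2 t) j) has_real_derivative V t * ?F2 t j) (at t within {0..t1})"
    if "t \<in> {0..t1}" for t j
    unfolding ener2_def
    by (rule DERIV_cong[OF has_real_derivative_energy[OF m2 \<delta>(1) dX'[OF that] dx2'[OF that] dv2'[OF that]]]) (simp add: refl)
  have hG: "h t \<in> Gset" if "0 \<le> t" "t < t1" for t
    using G[of "\<epsilon> * t"] that \<epsilon> by (simp add: h_def t1_def field_simps)
  \<comment> \<open>Membership in \<open>Gset\<close> is known only before \<open>t1\<close>.
    Differentiability at \<open>t1\<close> gives left continuity of \<open>h\<close>, and closedness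
    carries membership to the endpoint.\<close>
  have "(h has_vector_derivative (V t1, \<epsilon>\<^sup>2 * ((\<Sum>j\<in>UNIV. ?F1 t1 j) - (\<Sum>j\<in>UNIV. ?F2 t1 j)) / \<epsilon>,
      (\<chi> j. - V t1 * ?F1 t1 j), (\<chi> j. V t1 * ?F2 t1 j))) (at t1 within {0..t1})"
    unfolding h_def y slow_eq
  proof (intro has_vector_derivative_Pair has_vector_derivative_vec_lambda dE1 dE2)
    have "t1 \<in> {0..t1}" using t1 by simp
    from dX[OF this] DERIV_cdivide[OF dV[OF this], of \<epsilon>]
    show "(X has_vector_derivative V t1) (at t1 within {0..t1})"
      "((\<lambda>t. V t / \<epsilon>) has_vector_derivative \<epsilon>\<^sup>2 * ((\<Sum>j\<in>UNIV. ?F1 t1 j) - (\<Sum>j\<in>UNIV. ?F2 t1 j)) / \<epsilon>)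
        (at t1 within {0..t1})"
      by (simp_all only: has_real_derivative_iff_has_vector_derivative)
  qed (use t1 in auto)
  then have "(h \<longlongrightarrow> h t1) (at_left t1)"
    using t1 has_vector_derivative_continuous by (fastforce simp: continuous_within at_within_Icc_at_left)
  then have "h t1 \<in> Gset"
    by (rule left_limit_in_closed[OF closed_Gset _ t1]) (use hG in auto)
  with hG have hG: "h t \<in> Gset" if "t \<in> {0..t1}" for t
    using that by (cases "t = t1") auto
  note inG = slow_in_Gset[OF hG[unfolded h_def y] \<epsilon>(1)]
  have Vb: "\<bar>V t\<bar> \<le> \<nu>" if "t \<in> {0..t1}" for t using inG(3)[OF that] \<epsilon> by simp
  have K0: "0 \<le> K" using est(1) by (simp add: corr_est_def)
  have P1b: "\<bar>corr1 \<delta> (X t) (V t) (x1 t) (v1 t) j\<bar> \<le> K" if "t \<in> {0..t1}" for t j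
    unfolding corr1_def
    by (rule corr_est_bound[OF est(1)])
      (use inG(1,2,4,5)[OF that] Vb[OF that] \<delta> l in \<open>auto simp: ener1_def\<close>)
  have P2b: "\<bar>corr2 \<delta> (X t) (V t) (x2 t) (v2 t) j\<bar> \<le> K" if "t \<in> {0..t1}" for t j
    unfolding corr2_def
    by (rule corr_est_bound[OF est(2)])
      (use inG(1,2,6,7)[OF that] Vb[OF that] \<delta> l in \<open>auto simp: ener2_def\<close>)
  let ?z = "\<lambda>t. corr_slow \<epsilon> \<delta> (y t)"
  let ?N = "\<lambda>t. 2 * corr_sum \<delta> (y t) + (2 * nn * Ka + 2) * t"
  have der: "\<exists>z' N'. (?z has_vector_derivative z') (at t within {0..t1}) \<and> (?N has_real_derivative N') (at t within {0..t1}) \<and>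
      1 \<le> N' \<and> norm (z' - \<epsilon> *\<^sub>R Hbar \<kappa> m1 m2 \<delta> (h t)) \<le> \<epsilon>\<^sup>2 * K2 * N'" if t: "t \<in> {0..t1}" for t
  proof -
    let ?a = "\<epsilon>\<^sup>2 * ((\<Sum>j\<in>UNIV. ?F1 t j) - (\<Sum>j\<in>UNIV. ?F2 t j))"
    have F: "0 \<le> ?F1 t j" "0 \<le> ?F2 t k" for j k using kd'_nonpos[OF \<delta>(1)] by auto
    have sF: "0 \<le> (\<Sum>j\<in>UNIV. ?F1 t j)" "0 \<le> (\<Sum>j\<in>UNIV. ?F2 t j)" using F by (auto intro: sum_nonneg)
    have Fle: "?F1 t j \<le> Ft t" "?F2 t k \<le> Ft t" for j k
      using member_le_sum[of j UNIV "?F1 t"] member_le_sum[of k UNIV "?F2 t"] F sF by (auto simp: Ft_def)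
    have Ft: "0 \<le> Ft t" using sF by (simp add: Ft_def)
    \<comment> \<open>One power of \<open>\<epsilon>\<close> is given away. The rest is enough,
      because a remainder enters the corrected variables only multiplied by
      \<open>\<epsilon>\<close> or \<open>V\<close>.\<close>
    have a: "\<bar>?a\<bar> \<le> \<epsilon> * (1 + Ft t)"
    proof -
      have "\<bar>?a\<bar> \<le> \<epsilon>\<^sup>2 * Ft t" unfolding abs_mult by (rule mult_mono) (use sF in \<open>auto simp: Ft_def\<close>)
      also have "\<dots> \<le> \<epsilon> * (1 + Ft t)"
        by (rule mult_mono) (use \<epsilon> Ft in \<open>auto simp: power2_eq_square mult_left_le\<close>)
      finally show ?thesis .
    qed
    \<comment> \<open>Stated through absolute values so as to cover the reflected right cells too,
      where acceleration and wall velocity change sign.\<close>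
    have eb: "K * (\<bar>b\<bar> + \<bar>U\<bar> * (1 - f)) \<le> K * (1 + wm) * \<epsilon> * (1 + Ft t)"
      if "\<bar>b\<bar> = \<bar>?a\<bar>" "\<bar>U\<bar> = \<bar>V t\<bar>" "- f \<le> Ft t" "f \<le> 0" for b U f
    proof -
      have "\<bar>U\<bar> * (1 - f) \<le> (\<epsilon> * wm) * (1 + Ft t)"
        by (rule mult_mono) (use inG(3)[OF t] that \<epsilon> wm in auto)
      then have "\<bar>b\<bar> + \<bar>U\<bar> * (1 - f) \<le> (1 + wm) * \<epsilon> * (1 + Ft t)"
        using a that by (simp add: algebra_simps)
      from mult_left_mono[OF this K0] show ?thesis by (simp add: mult.assoc)
    qed
    have "\<exists>r. ((\<lambda>t. corr1 \<delta> (X t) (V t) (x1 t) (v1 t) j) has_real_derivative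
        ?F1 t j - mean_force \<delta> (X t) (ener1 \<delta> (X t) (x1 t) (v1 t) j) + r) (at t within {0..t1}) \<and>
        \<bar>r\<bar> \<le> K * (1 + wm) * \<epsilon> * (1 + Ft t)" for j
    proof (rule corr_est_deriv[OF est(1)[of j] \<delta> t dX[OF t] dV[OF t] dx1[OF t, of j] dv1[OF t, of j]], goal_cases)
      case (6 r)
      have "\<bar>r\<bar> \<le> K * (1 + wm) * \<epsilon> * (1 + Ft t)"
        by (rule order_trans[OF 6(2) eb]) (use Fle(1)[of j] F(1)[of j] in auto)
      with 6 show ?case unfolding corr1_def ener1_def by blast
    qed (use inG(1,2,4,5)[OF t] Vb[OF t] l in \<open>auto simp: ener1_def\<close>)
    then have "\<forall>j. \<exists>r. ((\<lambda>t. corr1 \<delta> (X t) (V t) (x1 t) (v1 t) j) has_real_derivative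
        ?F1 t j - mean_force \<delta> (X t) (ener1 \<delta> (X t) (x1 t) (v1 t) j) + r) (at t within {0..t1}) \<and>
        \<bar>r\<bar> \<le> K * (1 + wm) * \<epsilon> * (1 + Ft t)" ..
    from choice[OF this] obtain r1 where r1: "\<And>j. ((\<lambda>t. corr1 \<delta> (X t) (V t) (x1 t) (v1 t) j) has_real_derivative
        ?F1 t j - mean_force \<delta> (X t) (ener1 \<delta> (X t) (x1 t) (v1 t) j) + r1 j) (at t within {0..t1})"
        "\<And>j. \<bar>r1 j\<bar> \<le> K * (1 + wm) * \<epsilon> * (1 + Ft t)" by auto
    have "\<exists>r. ((\<lambda>t. corr2 \<delta> (X t) (V t) (x2 t) (v2 t) j) has_real_derivative
        ?F2 t j - mean_force \<delta> (1 - X t) (ener2 \<delta> (X t) (x2 t) (v2 t) j) + r) (at t within {0..t1}) \<and>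
        \<bar>r\<bar> \<le> K * (1 + wm) * \<epsilon> * (1 + Ft t)" for j
    proof (rule corr_est_deriv[where v = "\<lambda>t. - v2 t $ j" and U = "\<lambda>t. - V t",
          OF est(2)[of j] \<delta> t dX'[OF t] DERIV_minus[OF dV[OF t]] dx2'[OF t, of j] dv2'[OF t, of j]], goal_cases)
      case (6 r)
      have "\<bar>r\<bar> \<le> K * (1 + wm) * \<epsilon> * (1 + Ft t)"
        by (rule order_trans[OF 6(2) eb]) (use Fle(2)[of j] F(2)[of j] in \<open>auto simp: refl\<close>)
      with 6 show ?case unfolding corr2_def ener2_def refl by blast
    qed (use inG(1,2,6,7)[OF t] Vb[OF t] l in \<open>auto simp: ener2_def\<close>)
    then have "\<forall>j. \<exists>r. ((\<lambda>t. corr2 \<delta> (X t) (V t) (x2 t) (v2 t) j) has_real_derivative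
        ?F2 t j - mean_force \<delta> (1 - X t) (ener2 \<delta> (X t) (x2 t) (v2 t) j) + r) (at t within {0..t1}) \<and>
        \<bar>r\<bar> \<le> K * (1 + wm) * \<epsilon> * (1 + Ft t)" ..
    from choice[OF this] obtain r2 where r2: "\<And>j. ((\<lambda>t. corr2 \<delta> (X t) (V t) (x2 t) (v2 t) j) has_real_derivative
        ?F2 t j - mean_force \<delta> (1 - X t) (ener2 \<delta> (X t) (x2 t) (v2 t) j) + r2 j) (at t within {0..t1})"
        "\<And>j. \<bar>r2 j\<bar> \<le> K * (1 + wm) * \<epsilon> * (1 + Ft t)" by auto
    have A: "mean_force \<delta> (X t) (ener1 \<delta> (X t) (x1 t) (v1 t) j) \<le> Ka"
      "mean_force \<delta> (1 - X t) (ener2 \<delta> (X t) (x2 t) (v2 t) k) \<le> Ka" for j k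
      unfolding Ka_def
      by (intro mean_force_bounds; use inG[OF t] \<delta> c in \<open>force intro: order_trans[OF less_imp_le] order_trans[OF _ less_imp_le]\<close>)+
    show ?thesis
    proof (rule corrected_derivative[OF \<epsilon>(1,2) dX[OF t] dV[OF t] dE1[OF t] dE2[OF t] r1(1) r2(1) F A Ka_nonneg
          r1(2)[unfolded Ft_def] r2(2)[unfolded Ft_def] _ \<epsilon>(4) inG(3)[OF t] P1b[OF t] P2b[OF t] K0], goal_cases)
      case 1
      show ?case using K0 wm by simp
    next
      case (2 z' N')
      have "norm (z' - \<epsilon> *\<^sub>R Hbar \<kappa> m1 m2 \<delta> (h t)) \<le> \<epsilon>\<^sup>2 * K2 * N'"
        using 2(4) Hbar_slow[OF hG[OF t, unfolded h_def y] less_imp_le[OF \<delta>(1)] \<delta>(2)]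
        unfolding h_def y K2_def by simp
      with 2(1-3) show ?case
        unfolding y corr_slow_def corr_sum_def split by blast
    qed
  qed
  have cont: "(?z \<longlongrightarrow> ?z t) (at t within {0..t1})" "(?N \<longlongrightarrow> ?N t) (at t within {0..t1})" if t: "t \<in> {0..t1}" for t
    using der[OF t] has_vector_derivative_continuous[of ?z] DERIV_continuous[of ?N]
    unfolding continuous_within by blast+
  have NT: "?N t1 - ?N 0 \<le> K3 / \<epsilon>"
  proof -
    have S: "\<bar>corr_sum \<delta> (y t)\<bar> \<le> nn * K" if "t \<in> {0..t1}" for t
      unfolding y by (rule abs_corr_sum_le) (use P1b P2b that in auto)
    show ?thesis
      using momentum_budget[OF \<epsilon>(1,2) S[of 0] S[of t1], of \<tau> T] \<tau> t1 by (simp add: K3_def t1_def)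
  qed
  have "norm (h (\<tau> / \<epsilon>) - hb \<tau>) \<le> (exp (\<Lambda> * T) * (K1 + 1 + (\<Lambda> * K1 + K2) * \<bar>K3\<bar>) + K1) * \<epsilon>"
  proof (rule averaging_estimate[where G = Gset and H = "Hbar \<kappa> m1 m2 \<delta>" and C = "{}" and z = ?z and N = ?N, OF \<Lambda> lip \<epsilon>(1)])
    show "0 \<le> K1" "0 \<le> K2" using nn_pos wm K0 by (auto simp: K1_def K2_def)
    show "norm (?z t - h t) \<le> \<epsilon> * K1" if "0 \<le> t" "t \<le> \<tau> / \<epsilon>" for t
      unfolding K1_def h_def y corr_slow_def split slow_eq
      by (rule corrected_near[OF \<epsilon>(1) wm]) (use inG(3) P1b P2b that in \<open>auto simp: t1_def\<close>)
    show "\<exists>z' N'. (?z has_vector_derivative z') (at t) \<and> (?N has_real_derivative N') (at t) \<and> 1 \<le> N' \<and>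
        norm (z' - \<epsilon> *\<^sub>R Hbar \<kappa> m1 m2 \<delta> (h t)) \<le> \<epsilon>\<^sup>2 * K2 * N'" if "0 < t" "t < \<tau> / \<epsilon>" for t
      using der[of t] that at_within_interior[of t "{0..t1}"] by (simp add: t1_def)
    show "(?z \<longlongrightarrow> ?z t) (at_right t) \<and> (?N \<longlongrightarrow> ?N t) (at_right t)" if "0 \<le> t" "t < \<tau> / \<epsilon>" for t
    proof -
      have "t \<in> {0..t1}" and sub: "{t..t1} \<subseteq> {0..t1}" and ar: "at_right t = at t within {t..t1}"
        using that by (auto simp: t1_def at_within_Icc_at_right)
      then show ?thesis unfolding ar by (auto intro: tendsto_within_subset[OF cont(1)] tendsto_within_subset[OF cont(2)])
    qed
    show "\<exists>zl Nl. (?z \<longlongrightarrow> zl) (at_left t) \<and> (?N \<longlongrightarrow> Nl) (at_left t) \<and>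
        norm (?z t - zl) \<le> \<epsilon>\<^sup>2 * K2 * (?N t - Nl) \<and> Nl \<le> ?N t" if "0 < t" "t \<le> \<tau> / \<epsilon>" for t
    proof -
      have t: "t \<in> {0..t1}" and sub: "{0..t} \<subseteq> {0..t1}" and al: "at_left t = at t within {0..t}"
        using that by (auto simp: t1_def at_within_Icc_at_left)
      show ?thesis unfolding al
        by (rule exI[of _ "?z t"], rule exI[of _ "?N t"])
          (auto intro: tendsto_within_subset[OF cont(1)[OF t] sub] tendsto_within_subset[OF cont(2)[OF t] sub])
    qed
    show "hb 0 = h 0" using hb0 by (simp add: h_def)
    show "?N (\<tau> / \<epsilon>) - ?N 0 \<le> K3 / \<epsilon>" using NT by (simp add: t1_def)
  qed (use \<tau> hG hb G in \<open>auto simp: t1_def\<close>)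
  then show ?thesis by (simp add: h_def)
qed

end

text \<open>\<open>D\<close> is the momentum passed from particle to piston. The particle gains
  \<open>- D\<close> times the mean of the piston velocities before and after, the discrete form of
  energy change as minus velocity times impulse.\<close>

lemma collision_algebra:
  fixes m M V v :: real
  assumes "0 < m" "0 < M"
  defines "D \<equiv> 2 * m * M * (v - V) / (m + M)"
  shows "((M - m) * V + 2 * m * v) / (m + M) = V + D / M"
    "((m - M) * v + 2 * M * V) / (m + M) = v - D / m"
    "m * (v - D / m)\<^sup>2 / 2 = m * v\<^sup>2 / 2 - (V + (V + D / M)) / 2 * D"
proof -
  have s: "m + M \<noteq> 0" "m \<noteq> 0" "M \<noteq> 0" using assms by auto
  have DM: "D / M = 2 * m * (v - V) / (m + M)" "D / m = 2 * M * (v - V) / (m + M)"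
    using s by (auto simp: D_def)
  show "((M - m) * V + 2 * m * v) / (m + M) = V + D / M"
    "((m - M) * v + 2 * M * V) / (m + M) = v - D / m"
    unfolding DM using s by (simp_all add: add_divide_eq_iff diff_divide_eq_iff) (simp_all add: algebra_simps)
  have "D / m + D / M = 2 * (v - V)"
  proof -
    have "D / m + D / M = 2 * (v - V) * (m + M) / (m + M)"
      unfolding DM by (simp add: add_divide_distrib[symmetric] algebra_simps)
    then show ?thesis using s by simp
  qed
  then have "D * (D / m + D / M) = D * (2 * (v - V))" by simp
  then have 1: "D * (D / m) + D * (D / M) = 2 * (v * D) - 2 * (V * D)"
    unfolding distrib_left by (simp add: algebra_simps)
  have 2: "m * (v - D / m)\<^sup>2 = m * v\<^sup>2 - 2 * (v * D) + D * (D / m)"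
    using s by (simp add: power2_eq_square field_simps)
  have 3: "(V + (V + D / M)) / 2 * D = V * D + D * (D / M) / 2"
    by (simp add: add_divide_distrib distrib_right)
  have "a / 2 = r / 2 - y" if "b + c = 2 * p - 2 * q" "a = r - 2 * p + b" "y = q + c / 2" for a b c p q r y :: real
    using that by simp
  from this[OF 1 2 3] show "m * (v - D / m)\<^sup>2 / 2 = m * v\<^sup>2 / 2 - (V + (V + D / M)) / 2 * D" .
qed

subsection \<open>Hard core\<close>

context piston
begin

text \<open>The jump of the corrector by \<open>D\<close> cancels that of \<open>W\<close> exactly.
  In the energy of particle \<open>j\<close>, the mean of old and new piston velocity leaves just
  \<open>\<epsilon>\<^sup>2 * D * (P1 j + D / 2)\<close>; the other energies change only through the
  factor \<open>V\<close> in front of their correctors.\<close>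

lemma corrected_jump1:
  assumes \<epsilon>: "0 < \<epsilon>" and D: "0 \<le> D"
    and P: "\<And>k. \<bar>P1 k\<bar> \<le> K" "\<And>k. \<bar>P2 k\<bar> \<le> K" "\<bar>P1 j + D\<bar> \<le> K"
  shows "norm (corrected \<epsilon> X (V + \<epsilon>\<^sup>2 * D) (E1(j := E1 j - (V + (V + \<epsilon>\<^sup>2 * D)) / 2 * D)) E2 (P1(j := P1 j + D)) P2
      - corrected \<epsilon> X V E1 E2 P1 P2) \<le> \<epsilon>\<^sup>2 * (nn * K) * D" (is "norm ?d \<le> _")
proof -
  define e where "e = \<epsilon>\<^sup>2 * D"
  have e: "0 \<le> e" "e / \<epsilon> = \<epsilon> * D" using \<epsilon> D by (auto simp: e_def power2_eq_square)
  have "?d = (0, 0, (\<chi> k. e * (if k = j then P1 j + D / 2 else P1 k)), (\<chi> k. - e * P2 k))"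
    using e(2) unfolding corrected_def e_def[symmetric] sum_fun_upd_UNIV
    by (simp add: vec_eq_iff add_divide_distrib) (simp add: algebra_simps)
  then have "norm ?d \<le> (\<Sum>k\<in>UNIV. \<bar>e * (if k = j then P1 j + D / 2 else P1 k)\<bar>) + (\<Sum>k\<in>UNIV. \<bar>- e * P2 k\<bar>)"
    using norm_slow_le[of 0 0 "\<chi> k. e * (if k = j then P1 j + D / 2 else P1 k)" "\<chi> k. - e * P2 k"]
    by (simp only: vec_lambda_beta abs_zero add_0)
  also have "\<dots> \<le> nn * (e * K)"
  proof (rule sum_le_nn)
    \<comment> \<open>The midpoint of the corrector's values before and after the collision, both
      bounded by \<open>K\<close>.\<close>
    have "\<bar>P1 j + D / 2\<bar> \<le> K" using P(1)[of j] P(3) by (auto simp: abs_le_iff)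
    then show "\<bar>e * (if k = j then P1 j + D / 2 else P1 k)\<bar> \<le> e * K" for k
      unfolding abs_mult using e P by (auto intro: mult_left_mono)
    show "\<bar>- e * P2 k\<bar> \<le> e * K" for k
      unfolding abs_mult using e P by (auto intro: mult_left_mono)
  qed
  finally show ?thesis by (simp add: e_def algebra_simps)
qed

lemma corrected_jump2:
  assumes \<epsilon>: "0 < \<epsilon>" and D: "0 \<le> D"
    and P: "\<And>k. \<bar>P1 k\<bar> \<le> K" "\<And>k. \<bar>P2 k\<bar> \<le> K" "\<bar>P2 j + D\<bar> \<le> K"
  shows "norm (corrected \<epsilon> X (V - \<epsilon>\<^sup>2 * D) E1 (E2(j := E2 j + (V + (V - \<epsilon>\<^sup>2 * D)) / 2 * D)) P1 (P2(j := P2 j + D))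
      - corrected \<epsilon> X V E1 E2 P1 P2) \<le> \<epsilon>\<^sup>2 * (nn * K) * D" (is "norm ?d \<le> _")
proof -
  define e where "e = \<epsilon>\<^sup>2 * D"
  have e: "0 \<le> e" "e / \<epsilon> = \<epsilon> * D" using \<epsilon> D by (auto simp: e_def power2_eq_square)
  have "?d = (0, 0, (\<chi> k. - e * P1 k), (\<chi> k. e * (if k = j then P2 j + D / 2 else P2 k)))"
    using e(2) unfolding corrected_def e_def[symmetric] sum_fun_upd_UNIV
    by (simp add: vec_eq_iff diff_divide_distrib) (simp add: algebra_simps)
  then have "norm ?d \<le> (\<Sum>k\<in>UNIV. \<bar>- e * P1 k\<bar>) + (\<Sum>k\<in>UNIV. \<bar>e * (if k = j then P2 j + D / 2 else P2 k)\<bar>)"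
    using norm_slow_le[of 0 0 "\<chi> k. - e * P1 k" "\<chi> k. e * (if k = j then P2 j + D / 2 else P2 k)"]
    by (simp only: vec_lambda_beta abs_zero add_0)
  also have "\<dots> \<le> nn * (e * K)"
  proof (rule sum_le_nn)
    have "\<bar>P2 j + D / 2\<bar> \<le> K" using P(2)[of j] P(3) by (auto simp: abs_le_iff)
    then show "\<bar>e * (if k = j then P2 j + D / 2 else P2 k)\<bar> \<le> e * K" for k
      unfolding abs_mult using e P by (auto intro: mult_left_mono)
    show "\<bar>- e * P1 k\<bar> \<le> e * K" for k
      unfolding abs_mult using e P by (auto intro: mult_left_mono)
  qed
  finally show ?thesis by (simp add: e_def algebra_simps)
qed

lemma corr_hard: "corr m 0 L U x v = - (m * v * x) / L"
  by (simp add: corr_def corr_num_def eff_len_def)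

lemma hard_core_simps:
  "ener1 0 X x1 v1 = (\<lambda>j. m1 $ j * (v1 $ j)\<^sup>2 / 2)"
  "ener2 0 X x2 v2 = (\<lambda>j. m2 $ j * (v2 $ j)\<^sup>2 / 2)"
  "corr1 0 X V x1 v1 = (\<lambda>j. - (m1 $ j * v1 $ j * x1 $ j) / X)"
  "corr2 0 X V x2 v2 = (\<lambda>j. m2 $ j * v2 $ j * (1 - x2 $ j) / (1 - X))"
  by (auto simp: ener1_def ener2_def energy_def corr1_def corr2_def corr_hard)

text \<open>The conserved energy; the piston has mass \<open>1 / \<epsilon>\<^sup>2\<close>.
  Intermediate states of simultaneous collisions, and the state reached at the stopping time, may
  lie outside \<open>Gset\<close>, so their bounds have to come from here.\<close>

definition total :: "real \<Rightarrow> ('n1, 'n2) pstate \<Rightarrow> real" where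
  "total \<epsilon> = (\<lambda>(X, V, x1, v1, x2, v2). V\<^sup>2 / (2 * \<epsilon>\<^sup>2) + (\<Sum>j\<in>UNIV. ener1 0 X x1 v1 j) + (\<Sum>j\<in>UNIV. ener2 0 X x2 v2 j))"

definition total_max :: real where "total_max = wm\<^sup>2 / 2 + nn * \<bar>c1\<bar>"

text \<open>A sum standing in for a maximum: it dominates the momentum of any particle whose kinetic
  energy is at most \<open>total_max\<close>.\<close>

definition Kh :: real where
  "Kh = (\<Sum>j\<in>UNIV. sqrt (2 * m1 $ j * total_max)) + (\<Sum>j\<in>UNIV. sqrt (2 * m2 $ j * total_max))"

definition wh :: real where "wh = sqrt (2 * total_max)"

definition admissible :: "('n1, 'n2) pstate \<Rightarrow> bool" where
  "admissible = (\<lambda>(X, V, x1, v1, x2, v2). l \<le> X \<and> X \<le> 1 - l \<and>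
     (\<forall>j. 0 \<le> x1 $ j \<and> x1 $ j \<le> X) \<and> (\<forall>j. X \<le> x2 $ j \<and> x2 $ j \<le> 1))"

lemma total_max_nonneg: "0 \<le> total_max"
  using nn_pos by (simp add: total_max_def)

lemma Kh_nonneg: "0 \<le> Kh"
  unfolding Kh_def using m1 m2 total_max_nonneg by (intro add_nonneg_nonneg sum_nonneg) (auto simp: less_imp_le)

lemma wh_nonneg: "0 \<le> wh"
  by (simp add: wh_def total_max_nonneg)

lemma total_le:
  assumes "slow \<kappa> m1 m2 \<epsilon> 0 (X, V, x1, v1, x2, v2) \<in> Gset" "0 < \<epsilon>"
  shows "total \<epsilon> (X, V, x1, v1, x2, v2) \<le> total_max"
proof -
  note G = slow_in_Gset[OF assms]
  have "(V / \<epsilon>)\<^sup>2 \<le> wm\<^sup>2"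
    using G(3) assms(2) wm by (intro abs_le_square_iff[THEN iffD1]) (simp add: abs_divide field_simps)
  then have "V\<^sup>2 / (2 * \<epsilon>\<^sup>2) \<le> wm\<^sup>2 / 2" by (simp add: power_divide)
  moreover have "(\<Sum>j\<in>UNIV. ener1 0 X x1 v1 j) + (\<Sum>j\<in>UNIV. ener2 0 X x2 v2 j) \<le> nn * \<bar>c1\<bar>"
    by (rule sum_le_nn) (use G(5,7) in \<open>auto intro: order_trans[OF _ abs_ge_self]\<close>)
  ultimately show ?thesis by (simp add: total_def total_max_def)
qed

text \<open>Each kinetic energy is at most the total. A hard core corrector is a momentum times a
  ratio in \<open>[0, 1]\<close> up to sign, so it inherits the momentum bound.\<close>

lemma hard_bounds:
  assumes t: "total \<epsilon> (X, V, x1, v1, x2, v2) \<le> total_max" and a: "admissible (X, V, x1, v1, x2, v2)" and \<epsilon>: "0 < \<epsilon>"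
  shows "\<bar>V\<bar> \<le> \<epsilon> * wh" "\<bar>m1 $ j * v1 $ j\<bar> \<le> Kh" "\<bar>m2 $ k * v2 $ k\<bar> \<le> Kh"
    "\<bar>corr1 0 X V x1 v1 j\<bar> \<le> Kh" "\<bar>corr2 0 X V x2 v2 k\<bar> \<le> Kh"
proof -
  have n1: "0 \<le> m1 $ i * (v1 $ i)\<^sup>2 / 2" and n2: "0 \<le> m2 $ i' * (v2 $ i')\<^sup>2 / 2" for i i'
    using m1[of i] m2[of i'] by auto
  have t': "V\<^sup>2 / (2 * \<epsilon>\<^sup>2) + (\<Sum>j\<in>UNIV. m1 $ j * (v1 $ j)\<^sup>2 / 2) + (\<Sum>j\<in>UNIV. m2 $ j * (v2 $ j)\<^sup>2 / 2) \<le> total_max"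
    using t by (simp add: total_def hard_core_simps)
  have s: "0 \<le> (\<Sum>j\<in>UNIV. m1 $ j * (v1 $ j)\<^sup>2 / 2)" "0 \<le> (\<Sum>j\<in>UNIV. m2 $ j * (v2 $ j)\<^sup>2 / 2)" "0 \<le> V\<^sup>2 / (2 * \<epsilon>\<^sup>2)"
    using n1 n2 by (auto intro!: sum_nonneg simp del: times_divide_eq_right)
  have "V\<^sup>2 / (2 * \<epsilon>\<^sup>2) \<le> total_max" using t' s by linarith
  then have "V\<^sup>2 \<le> (\<epsilon> * wh)\<^sup>2"
    using \<epsilon> total_max_nonneg by (simp add: wh_def power_mult_distrib field_simps)
  then show "\<bar>V\<bar> \<le> \<epsilon> * wh"
    using abs_le_square_iff[of V "\<epsilon> * wh"] \<epsilon> wh_nonneg by simp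
  have sq: "\<bar>m * v\<bar> \<le> sqrt (2 * m * total_max)" if "0 < m" "m * v\<^sup>2 / 2 \<le> total_max" for m v
  proof (rule real_le_rsqrt)
    show "\<bar>m * v\<bar>\<^sup>2 \<le> 2 * m * total_max"
      using mult_left_mono[OF that(2), of "2 * m"] that(1) by (simp add: power2_eq_square algebra_simps)
  qed
  have K1: "sqrt (2 * m1 $ i * total_max) \<le> Kh" and K2: "sqrt (2 * m2 $ i' * total_max) \<le> Kh" for i i'
  proof -
    have nn1: "0 \<le> sqrt (2 * m1 $ i * total_max)" for i
      using m1 total_max_nonneg by (auto simp: less_imp_le)
    have nn2: "0 \<le> sqrt (2 * m2 $ i * total_max)" for i
      using m2 total_max_nonneg by (auto simp: less_imp_le)
    show "sqrt (2 * m1 $ i * total_max) \<le> Kh"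
      using member_le_sum[of i UNIV "\<lambda>i. sqrt (2 * m1 $ i * total_max)"] nn1
        sum_nonneg[of UNIV "\<lambda>i. sqrt (2 * m2 $ i * total_max)"] nn2 by (simp add: Kh_def)
    show "sqrt (2 * m2 $ i' * total_max) \<le> Kh"
      using member_le_sum[of i' UNIV "\<lambda>i. sqrt (2 * m2 $ i * total_max)"] nn2
        sum_nonneg[of UNIV "\<lambda>i. sqrt (2 * m1 $ i * total_max)"] nn1 by (simp add: Kh_def)
  qed
  show b1: "\<bar>m1 $ j * v1 $ j\<bar> \<le> Kh"
  proof (rule order_trans[OF sq[OF m1] K1])
    show "m1 $ j * (v1 $ j)\<^sup>2 / 2 \<le> total_max"
      using member_le_sum[of j UNIV "\<lambda>j. m1 $ j * (v1 $ j)\<^sup>2 / 2", OF UNIV_I n1 finite] t' s by linarith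
  qed
  show b2: "\<bar>m2 $ k * v2 $ k\<bar> \<le> Kh"
  proof (rule order_trans[OF sq[OF m2] K2])
    show "m2 $ k * (v2 $ k)\<^sup>2 / 2 \<le> total_max"
      using member_le_sum[of k UNIV "\<lambda>j. m2 $ j * (v2 $ j)\<^sup>2 / 2", OF UNIV_I n2 finite] t' s by linarith
  qed
  have frac: "\<bar>p * x / L\<bar> \<le> Kh" if "\<bar>p\<bar> \<le> Kh" "0 \<le> x" "x \<le> L" "0 < L" for p x L
  proof -
    have "\<bar>p * x / L\<bar> = \<bar>p\<bar> * (x / L)" using that by (simp add: abs_mult)
    also have "\<dots> \<le> Kh * 1" by (rule mult_mono) (use that Kh_nonneg in auto)
    finally show ?thesis by simp
  qed
  have "0 \<le> x1 $ j" "x1 $ j \<le> X" "0 < X" "0 \<le> 1 - x2 $ k" "1 - x2 $ k \<le> 1 - X" "0 < 1 - X"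
    using a l unfolding admissible_def split by (auto intro: less_le_trans) 
  then show "\<bar>corr1 0 X V x1 v1 j\<bar> \<le> Kh" "\<bar>corr2 0 X V x2 v2 k\<bar> \<le> Kh"
    using frac[OF b1] frac[OF b2] by (simp_all add: hard_core_simps abs_divide abs_mult)
qed

lemma vupd_fun:
  "(\<lambda>k. m $ k * (vupd v j a $ k)\<^sup>2 / 2) = (\<lambda>k. m $ k * (v $ k)\<^sup>2 / 2)(j := m $ j * a\<^sup>2 / 2)"
  "(\<lambda>k. - (m $ k * vupd v j a $ k * x $ k) / L) = (\<lambda>k. - (m $ k * v $ k * x $ k) / L)(j := - (m $ j * a * x $ j) / L)"
  "(\<lambda>k. m $ k * vupd v j a $ k * (1 - x $ k) / L) = (\<lambda>k. m $ k * v $ k * (1 - x $ k) / L)(j := m $ j * a * (1 - x $ j) / L)"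
  by (auto simp: vupd_def)

text \<open>Bounces off the outer walls leave the corrector unchanged, because it contains the
  distance to that wall as a factor. A piston collision raises \<open>corr_sum\<close> by exactly
  the transferred momentum, so the clock itself measures the jumps.\<close>

lemma hc_step_effect:
  assumes step: "hc_step m1 m2 (1 / \<epsilon>\<^sup>2) (X, x1, x2) (V, v1, v2) (V', v1', v2')"
    and a: "admissible (X, V, x1, v1, x2, v2)" and \<epsilon>: "0 < \<epsilon>"
    and t: "total \<epsilon> (X, V, x1, v1, x2, v2) \<le> total_max"
  shows "total \<epsilon> (X, V', x1, v1', x2, v2') = total \<epsilon> (X, V, x1, v1, x2, v2)"
    "corr_sum 0 (X, V, x1, v1, x2, v2) \<le> corr_sum 0 (X, V', x1, v1', x2, v2')"
    "norm (corr_slow \<epsilon> 0 (X, V', x1, v1', x2, v2') - corr_slow \<epsilon> 0 (X, V, x1, v1, x2, v2))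
      \<le> \<epsilon>\<^sup>2 * (nn * Kh) * (corr_sum 0 (X, V', x1, v1', x2, v2') - corr_sum 0 (X, V, x1, v1, x2, v2))"
proof -
  have X: "X \<noteq> 0" "1 - X \<noteq> 0" using a l by (auto simp: admissible_def)
  have a': "admissible (X, V', x1, v1', x2, v2')" using a by (simp add: admissible_def)
  define M where "M = 1 / \<epsilon>\<^sup>2"
  have M: "0 < M" using \<epsilon> by (simp add: M_def)
  let ?P1 = "corr1 0 X V x1 v1" and ?P2 = "corr2 0 X V x2 v2" and ?E1 = "ener1 0 X x1 v1" and ?E2 = "ener2 0 X x2 v2"
  note b = hard_bounds[OF t a \<epsilon>]
  from step[folded M_def, unfolded hc_step_def split] consider
      (wall1) j where "x1 $ j = 0" "v1' = vupd v1 j (- v1 $ j)" "V' = V" "v2' = v2"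
    | (left) j where "x1 $ j = X" "v1 $ j > V" "V' = ((M - m1 $ j) * V + 2 * m1 $ j * v1 $ j) / (m1 $ j + M)"
       "v1' = vupd v1 j (((m1 $ j - M) * v1 $ j + 2 * M * V) / (m1 $ j + M))" "v2' = v2"
    | (right) j where "x2 $ j = X" "V > v2 $ j" "V' = ((M - m2 $ j) * V + 2 * m2 $ j * v2 $ j) / (m2 $ j + M)"
       "v1' = v1" "v2' = vupd v2 j (((m2 $ j - M) * v2 $ j + 2 * M * V) / (m2 $ j + M))"
    | (wall2) j where "x2 $ j = 1" "v2' = vupd v2 j (- v2 $ j)" "V' = V" "v1' = v1"
    by blast
  then have "total \<epsilon> (X, V', x1, v1', x2, v2') = total \<epsilon> (X, V, x1, v1, x2, v2) \<and>
    corr_sum 0 (X, V, x1, v1, x2, v2) \<le> corr_sum 0 (X, V', x1, v1', x2, v2') \<and>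
    norm (corr_slow \<epsilon> 0 (X, V', x1, v1', x2, v2') - corr_slow \<epsilon> 0 (X, V, x1, v1, x2, v2))
      \<le> \<epsilon>\<^sup>2 * (nn * Kh) * (corr_sum 0 (X, V', x1, v1', x2, v2') - corr_sum 0 (X, V, x1, v1, x2, v2))"
  proof cases
    case wall1
    have "ener1 0 X x1 v1' = ?E1" "corr1 0 X V x1 v1' = ?P1"
      unfolding hard_core_simps wall1 vupd_fun using wall1(1) by (auto simp: fun_eq_iff)
    then show ?thesis using wall1 by (simp add: total_def corr_sum_def corr_slow_def)
  next
    case wall2
    have "ener2 0 X x2 v2' = ?E2" "corr2 0 X V x2 v2' = ?P2"
      unfolding hard_core_simps wall2 vupd_fun using wall2(1) by (auto simp: fun_eq_iff)
    then show ?thesis using wall2 by (simp add: total_def corr_sum_def corr_slow_def)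
  next
    case left
    define D where "D = 2 * m1 $ j * M * (v1 $ j - V) / (m1 $ j + M)"
    have D: "0 \<le> D" using left(2) M m1[of j] by (simp add: D_def)
    note ca = collision_algebra[OF m1[of j] M, where v = "v1 $ j" and V = V, folded D_def]
    have V': "V' = V + \<epsilon>\<^sup>2 * D" using left(3) ca(1) \<epsilon> by (simp add: M_def)
    have v1': "v1' = vupd v1 j (v1 $ j - D / m1 $ j)" using left(4) ca(2) by simp
    have E: "ener1 0 X x1 v1' = ?E1(j := ?E1 j - (V + (V + \<epsilon>\<^sup>2 * D)) / 2 * D)"
      unfolding hard_core_simps v1' vupd_fun ca(3) by (simp add: M_def mult.commute)
    have P: "corr1 0 X V' x1 v1' = ?P1(j := ?P1 j + D)"
    proof -
      have "- (m1 $ j * (v1 $ j - D / m1 $ j) * x1 $ j) / X = - (m1 $ j * v1 $ j * x1 $ j) / X + D"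
        using left(1) X m1[of j] by (simp add: field_simps)
      then show ?thesis unfolding hard_core_simps v1' vupd_fun by (simp only:)
    qed
    have P2: "corr2 0 X V' x2 v2' = ?P2" "ener2 0 X x2 v2' = ?E2" using left by (simp_all add: hard_core_simps)
    have S: "corr_sum 0 (X, V', x1, v1', x2, v2') - corr_sum 0 (X, V, x1, v1, x2, v2) = D"
      unfolding corr_sum_def split P P2 sum_fun_upd_UNIV by simp
    have tot: "total \<epsilon> (X, V', x1, v1', x2, v2') = total \<epsilon> (X, V, x1, v1, x2, v2)"
      unfolding total_def split E P2 sum_fun_upd_UNIV V' using \<epsilon> by (simp add: field_simps power2_eq_square)
    \<comment> \<open>Energy conservation makes the a priori bound available for the state after the
      collision as well.\<close>
    have "\<bar>?P1 j + D\<bar> \<le> Kh"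
      using hard_bounds(4)[OF _ a' \<epsilon>, of j] tot t P by (metis fun_upd_same)
    from corrected_jump1[where ?P1.0 = ?P1 and ?P2.0 = ?P2 and K = Kh and j = j, OF \<epsilon> D b(4,5) this, of X V ?E1 ?E2]
    show ?thesis using tot S D unfolding corr_slow_def split E P P2 V'[symmetric] by simp
  next
    case right
    define D where "D = - (2 * m2 $ j * M * (v2 $ j - V) / (m2 $ j + M))"
    have D: "0 \<le> D" using right(2) M m2[of j] by (simp add: D_def field_simps)
    have D': "2 * m2 $ j * M * (v2 $ j - V) / (m2 $ j + M) = - D" by (simp add: D_def)
    note ca = collision_algebra[OF m2[of j] M, where v = "v2 $ j" and V = V, unfolded D']
    have V': "V' = V - \<epsilon>\<^sup>2 * D" using right(3) ca(1) \<epsilon> by (simp add: M_def)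
    have v2': "v2' = vupd v2 j (v2 $ j - - D / m2 $ j)" using right(5) ca(2) by simp
    have E: "ener2 0 X x2 v2' = ?E2(j := ?E2 j + (V + (V - \<epsilon>\<^sup>2 * D)) / 2 * D)"
      unfolding hard_core_simps v2' vupd_fun ca(3) by (simp add: M_def mult.commute)
    have P: "corr2 0 X V' x2 v2' = ?P2(j := ?P2 j + D)"
    proof -
      have "m2 $ j * (v2 $ j - - D / m2 $ j) * (1 - x2 $ j) / (1 - X) = m2 $ j * v2 $ j * (1 - x2 $ j) / (1 - X) + D"
        using right(1) X m2[of j] by (simp add: field_simps)
      then show ?thesis unfolding hard_core_simps v2' vupd_fun by (simp only:)
    qed
    have P1: "corr1 0 X V' x1 v1' = ?P1" "ener1 0 X x1 v1' = ?E1" using right by (simp_all add: hard_core_simps)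
    have S: "corr_sum 0 (X, V', x1, v1', x2, v2') - corr_sum 0 (X, V, x1, v1, x2, v2) = D"
      unfolding corr_sum_def split P P1 sum_fun_upd_UNIV by simp
    have tot: "total \<epsilon> (X, V', x1, v1', x2, v2') = total \<epsilon> (X, V, x1, v1, x2, v2)"
      unfolding total_def split E P1 sum_fun_upd_UNIV V' using \<epsilon> by (simp add: field_simps power2_eq_square)
    have "\<bar>?P2 j + D\<bar> \<le> Kh"
      using hard_bounds(5)[OF _ a' \<epsilon>, of j] tot t P by (metis fun_upd_same)
    from corrected_jump2[where ?P1.0 = ?P1 and ?P2.0 = ?P2 and K = Kh and j = j, OF \<epsilon> D b(4,5) this, of X V ?E1 ?E2]
    show ?thesis using tot S D unfolding corr_slow_def split E P P1 V'[symmetric] by simp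
  qed
  then show "total \<epsilon> (X, V', x1, v1', x2, v2') = total \<epsilon> (X, V, x1, v1, x2, v2)"
    "corr_sum 0 (X, V, x1, v1, x2, v2) \<le> corr_sum 0 (X, V', x1, v1', x2, v2')"
    "norm (corr_slow \<epsilon> 0 (X, V', x1, v1', x2, v2') - corr_slow \<epsilon> 0 (X, V, x1, v1, x2, v2))
      \<le> \<epsilon>\<^sup>2 * (nn * Kh) * (corr_sum 0 (X, V', x1, v1', x2, v2') - corr_sum 0 (X, V, x1, v1, x2, v2))"
    by auto
qed

section \<open>Simultaneous collisions and one-sided limits of hard core trajectories\<close>

definition join :: "real \<times> (real ^ 'n1) \<times> (real ^ 'n2) \<Rightarrow> real \<times> (real ^ 'n1) \<times> (real ^ 'n2) \<Rightarrow> ('n1, 'n2) pstate" where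
  "join p w = (fst p, fst w, fst (snd p), fst (snd w), snd (snd p), snd (snd w))"

text \<open>Energy conservation keeps every intermediate state within the scope of
  \<open>hc_step_effect\<close>. The increments of \<open>corr_sum\<close> telescope, so the
  estimate does not depend on the number of collisions in the chain.\<close>

lemma hc_steps_effect:
  assumes "(hc_step m1 m2 (1 / \<epsilon>\<^sup>2) p)\<^sup>*\<^sup>* w w'"
    and a: "admissible (join p w)" and \<epsilon>: "0 < \<epsilon>" and t: "total \<epsilon> (join p w) \<le> total_max"
  shows "total \<epsilon> (join p w') = total \<epsilon> (join p w) \<and> corr_sum 0 (join p w) \<le> corr_sum 0 (join p w') \<and>
    norm (corr_slow \<epsilon> 0 (join p w') - corr_slow \<epsilon> 0 (join p w))
      \<le> \<epsilon>\<^sup>2 * (nn * Kh) * (corr_sum 0 (join p w') - corr_sum 0 (join p w))"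
  using assms(1)
proof (induction rule: rtranclp_induct)
  case (step u u')
  obtain X x1 x2 where p: "p = (X, x1, x2)" by (cases p)
  obtain V v1 v2 where u: "u = (V, v1, v2)" by (cases u)
  obtain V' v1' v2' where u': "u' = (V', v1', v2')" by (cases u')
  have au: "admissible (join p u)" using a by (simp add: admissible_def join_def)
  have tu: "total \<epsilon> (join p u) \<le> total_max" using step.IH t by simp
  note e = hc_step_effect[OF step.hyps(2)[unfolded p u u'] _ \<epsilon>]
  have j: "join p u = (X, V, x1, v1, x2, v2)" "join p u' = (X, V', x1, v1', x2, v2')"
    by (simp_all add: join_def p u u')
  have e1: "total \<epsilon> (join p u') = total \<epsilon> (join p u)" "corr_sum 0 (join p u) \<le> corr_sum 0 (join p u')"
    "norm (corr_slow \<epsilon> 0 (join p u') - corr_slow \<epsilon> 0 (join p u)) \<le> \<epsilon>\<^sup>2 * (nn * Kh) * (corr_sum 0 (join p u') - corr_sum 0 (join p u))"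
    using e au tu unfolding j by auto
  have "norm (corr_slow \<epsilon> 0 (join p u') - corr_slow \<epsilon> 0 (join p w))
     \<le> norm (corr_slow \<epsilon> 0 (join p u') - corr_slow \<epsilon> 0 (join p u)) + norm (corr_slow \<epsilon> 0 (join p u) - corr_slow \<epsilon> 0 (join p w))"
    using norm_triangle_ineq[of "corr_slow \<epsilon> 0 (join p u') - corr_slow \<epsilon> 0 (join p u)" "corr_slow \<epsilon> 0 (join p u) - corr_slow \<epsilon> 0 (join p w)"]
    by simp
  then show ?case using e1 step.IH by (simp add: algebra_simps)
qed simp

lemma tendsto_hard:
  assumes "(y \<longlongrightarrow> y0) F" "fst y0 \<noteq> 0" "fst y0 \<noteq> 1"
  shows "((\<lambda>t. corr_slow \<epsilon> 0 (y t)) \<longlongrightarrow> corr_slow \<epsilon> 0 y0) F"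
    "((\<lambda>t. corr_sum 0 (y t)) \<longlongrightarrow> corr_sum 0 y0) F"
    "\<epsilon> \<noteq> 0 \<Longrightarrow> ((\<lambda>t. slow \<kappa> m1 m2 \<epsilon> 0 (y t)) \<longlongrightarrow> slow \<kappa> m1 m2 \<epsilon> 0 y0) F"
proof -
  have y: "y t = (fst (y t), fst (snd (y t)), fst (snd (snd (y t))), fst (snd (snd (snd (y t)))),
      fst (snd (snd (snd (snd (y t))))), snd (snd (snd (snd (snd (y t))))))" for t by simp
  have y0: "y0 = (fst y0, fst (snd y0), fst (snd (snd y0)), fst (snd (snd (snd y0))),
      fst (snd (snd (snd (snd y0)))), snd (snd (snd (snd (snd y0)))))" by simp
  have cs: "corr_slow \<epsilon> 0 y = corrected \<epsilon> (fst y) (fst (snd y)) (\<lambda>j. m1 $ j * (fst (snd (snd (snd y))) $ j)\<^sup>2 / 2)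
      (\<lambda>j. m2 $ j * (snd (snd (snd (snd (snd y)))) $ j)\<^sup>2 / 2)
      (\<lambda>j. - (m1 $ j * fst (snd (snd (snd y))) $ j * fst (snd (snd y)) $ j) / fst y)
      (\<lambda>j. m2 $ j * snd (snd (snd (snd (snd y)))) $ j * (1 - fst (snd (snd (snd (snd y)))) $ j) / (1 - fst y))" for y
    by (simp add: corr_slow_def hard_core_simps split_beta)
  have su: "corr_sum 0 y = (\<Sum>j\<in>UNIV. - (m1 $ j * fst (snd (snd (snd y))) $ j * fst (snd (snd y)) $ j) / fst y)
      + (\<Sum>j\<in>UNIV. m2 $ j * snd (snd (snd (snd (snd y)))) $ j * (1 - fst (snd (snd (snd (snd y)))) $ j) / (1 - fst y))" for y
    by (simp add: corr_sum_def hard_core_simps split_beta)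
  have sl: "slow \<kappa> m1 m2 \<epsilon> 0 y = (fst y, fst (snd y) / \<epsilon>, (\<chi> j. m1 $ j * (fst (snd (snd (snd y))) $ j)\<^sup>2 / 2),
      (\<chi> j. m2 $ j * (snd (snd (snd (snd (snd y)))) $ j)\<^sup>2 / 2))" for y
    by (simp add: slow_def split_beta)
  show "((\<lambda>t. corr_slow \<epsilon> 0 (y t)) \<longlongrightarrow> corr_slow \<epsilon> 0 y0) F"
    unfolding cs corrected_def divide_inverse using assms
    by (intro tendsto_Pair tendsto_vec_lambda tendsto_intros) auto
  show "((\<lambda>t. corr_sum 0 (y t)) \<longlongrightarrow> corr_sum 0 y0) F"
    unfolding su divide_inverse using assms by (intro tendsto_intros) auto
  show "((\<lambda>t. slow \<kappa> m1 m2 \<epsilon> 0 (y t)) \<longlongrightarrow> slow \<kappa> m1 m2 \<epsilon> 0 y0) F" if "\<epsilon> \<noteq> 0"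
    unfolding sl divide_inverse using assms by (intro tendsto_Pair tendsto_vec_lambda tendsto_intros) auto
qed

lemma join_pos_vel: "join (hc_pos y) (hc_vel y) = y"
  by (cases y) (simp add: join_def hc_pos_def hc_vel_def)

lemma hc_trajE:
  assumes "hc_traj m1 m2 M t1 y"
  obtains C where "finite C"
    "\<forall>t\<in>{0..t1} - C. (y has_vector_derivative hc_free (y t)) (at t within {0..t1})"
    "\<forall>t\<in>C. (y \<longlongrightarrow> y t) (at t within {t..t1})"
    "\<forall>t\<in>C. \<exists>w. ((\<lambda>s. hc_vel (y s)) \<longlongrightarrow> w) (at_left t) \<and> hc_collide m1 m2 M (hc_pos (y t)) w (hc_vel (y t))"
    "continuous_on {0..t1} (\<lambda>t. hc_pos (y t))"
    "\<forall>t\<in>{0..t1}. (case y t of (X, V, x1, v1, x2, v2) \<Rightarrow>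
           (\<forall>j. 0 \<le> x1$j \<and> x1$j \<le> X) \<and> (\<forall>j. X \<le> x2$j \<and> x2$j \<le> 1))"
proof (rule exE[OF assms[unfolded hc_traj_def]], elim conjE)
  fix C
  assume a: "finite C" "continuous_on {0..t1} (\<lambda>t. hc_pos (y t))"
    and b: "\<forall>t\<in>{0..t1} - C. (y has_vector_derivative hc_free (y t)) (at t within {0..t1})"
    and c: "\<forall>t\<in>C. (y \<longlongrightarrow> y t) (at t within {t..t1}) \<and>
      (\<exists>w. ((\<lambda>s. hc_vel (y s)) \<longlongrightarrow> w) (at_left t) \<and> hc_collide m1 m2 M (hc_pos (y t)) w (hc_vel (y t)))"
    and d: "\<forall>t\<in>{0..t1}. case y t of (X, V, x1, v1, x2, v2) \<Rightarrow>
           (\<forall>j. 0 \<le> x1$j \<and> x1$j \<le> X) \<and> (\<forall>j. X \<le> x2$j \<and> x2$j \<le> 1)"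
  show thesis
    by (rule that[OF a(1) b _ _ a(2) d]) (use c in auto)
qed

lemma hc_traj_right_limit:
  assumes "hc_traj m1 m2 M t1 y" "0 \<le> t" "t < t1"
  shows "(y \<longlongrightarrow> y t) (at_right t)"
proof -
  obtain C where C: "finite C"
    "\<forall>t\<in>{0..t1} - C. (y has_vector_derivative hc_free (y t)) (at t within {0..t1})"
    "\<forall>t\<in>C. (y \<longlongrightarrow> y t) (at t within {t..t1})"
    "\<forall>t\<in>C. \<exists>w. ((\<lambda>s. hc_vel (y s)) \<longlongrightarrow> w) (at_left t) \<and> hc_collide m1 m2 M (hc_pos (y t)) w (hc_vel (y t))"
    "continuous_on {0..t1} (\<lambda>t. hc_pos (y t))"
    "\<forall>t\<in>{0..t1}. (case y t of (X, V, x1, v1, x2, v2) \<Rightarrow>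
           (\<forall>j. 0 \<le> x1$j \<and> x1$j \<le> X) \<and> (\<forall>j. X \<le> x2$j \<and> x2$j \<le> 1))"
    by (rule hc_trajE[OF assms(1)])
  have "(y \<longlongrightarrow> y t) (at t within {t..t1})"
  proof (cases "t \<in> C")
    case False
    then have "(y \<longlongrightarrow> y t) (at t within {0..t1})"
      using has_vector_derivative_continuous[OF bspec[OF C(2)]] assms(2,3) by (simp add: continuous_within)
    then show ?thesis by (rule tendsto_within_subset) (use assms in auto)
  qed (rule bspec[OF C(3)])
  then show ?thesis using assms(3) by (simp add: at_within_Icc_at_right)
qed

text \<open>With the reflexive closure a regular time counts as a chain of no collisions, so all
  times are treated alike. Positions are continuous; only velocities have a left limit of their
  own.\<close>

lemma hc_traj_left_limit:
  assumes "hc_traj m1 m2 M t1 y" "0 < t" "t \<le> t1"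
  obtains w where "(y \<longlongrightarrow> join (hc_pos (y t)) w) (at_left t)" "(hc_step m1 m2 M (hc_pos (y t)))\<^sup>*\<^sup>* w (hc_vel (y t))"
proof -
  obtain C where C: "finite C"
    "\<forall>t\<in>{0..t1} - C. (y has_vector_derivative hc_free (y t)) (at t within {0..t1})"
    "\<forall>t\<in>C. (y \<longlongrightarrow> y t) (at t within {t..t1})"
    "\<forall>t\<in>C. \<exists>w. ((\<lambda>s. hc_vel (y s)) \<longlongrightarrow> w) (at_left t) \<and> hc_collide m1 m2 M (hc_pos (y t)) w (hc_vel (y t))"
    "continuous_on {0..t1} (\<lambda>t. hc_pos (y t))"
    "\<forall>t\<in>{0..t1}. (case y t of (X, V, x1, v1, x2, v2) \<Rightarrow>
           (\<forall>j. 0 \<le> x1$j \<and> x1$j \<le> X) \<and> (\<forall>j. X \<le> x2$j \<and> x2$j \<le> 1))"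
    by (rule hc_trajE[OF assms(1)])
  have al: "at_left t = at t within {0..t}" using assms by (simp add: at_within_Icc_at_left)
  show thesis
  proof (cases "t \<in> C")
    case False
    then have "(y \<longlongrightarrow> y t) (at t within {0..t1})"
      using has_vector_derivative_continuous[OF bspec[OF C(2)]] assms(2,3) by (simp add: continuous_within)
    then have "(y \<longlongrightarrow> y t) (at_left t)"
      unfolding al by (rule tendsto_within_subset) (use assms in auto)
    then show thesis using that[of "hc_vel (y t)"] by (simp add: join_pos_vel)
  next
    case True
    then obtain w where w: "((\<lambda>s. hc_vel (y s)) \<longlongrightarrow> w) (at_left t)" "hc_collide m1 m2 M (hc_pos (y t)) w (hc_vel (y t))"
      using C(4) by blast
    have "((\<lambda>t. hc_pos (y t)) \<longlongrightarrow> hc_pos (y t)) (at t within {0..t1})"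
      using C(5) assms by (simp add: continuous_on_def)
    then have p: "((\<lambda>t. hc_pos (y t)) \<longlongrightarrow> hc_pos (y t)) (at_left t)"
      unfolding al by (rule tendsto_within_subset) (use assms in auto)
    have "((\<lambda>s. join (hc_pos (y s)) (hc_vel (y s))) \<longlongrightarrow> join (hc_pos (y t)) w) (at_left t)"
      unfolding join_def using p w(1) by (intro tendsto_intros)
    moreover have "(hc_step m1 m2 M (hc_pos (y t)))\<^sup>*\<^sup>* w (hc_vel (y t))"
      using w(2) by (auto simp: hc_collide_def dest: tranclp_into_rtranclp)
    ultimately show thesis using that by (simp add: join_pos_vel)
  qed
qed

lemma hard_averaging:
  fixes y :: "real \<Rightarrow> ('n1, 'n2) pstate" and hb :: "real \<Rightarrow> ('n1, 'n2) slowvar"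
  assumes \<Lambda>: "0 \<le> \<Lambda>" and lip: "\<And>h h'. h \<in> Gset \<Longrightarrow> h' \<in> Gset \<Longrightarrow>
      norm (Hbar \<kappa> m1 m2 0 h - Hbar \<kappa> m1 m2 0 h') \<le> \<Lambda> * norm (h - h')"
    and \<epsilon>: "0 < \<epsilon>" "\<epsilon> \<le> 1" "\<epsilon> * (nn * (Kh * wm / l)) \<le> 1 / 2"
    and \<tau>: "0 < \<tau>" "\<tau> \<le> T"
    and traj: "hc_traj m1 m2 (1 / \<epsilon>\<^sup>2) (\<tau> / \<epsilon>) y"
    and hb0: "hb 0 = slow \<kappa> m1 m2 \<epsilon> 0 (y 0)"
    and hb: "\<And>\<sigma>. \<sigma> \<in> {0..\<tau>} \<Longrightarrow> (hb has_vector_derivative Hbar \<kappa> m1 m2 0 (hb \<sigma>)) (at \<sigma> within {0..\<tau>})"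
    and G: "\<And>\<sigma>. 0 \<le> \<sigma> \<Longrightarrow> \<sigma> < \<tau> \<Longrightarrow> hb \<sigma> \<in> Gset \<and> slow \<kappa> m1 m2 \<epsilon> 0 (y (\<sigma> / \<epsilon>)) \<in> Gset"
  defines "K1 \<equiv> nn * (1 + wh) * Kh"
    and "K2 \<equiv> nn * (Kh * wm / l + Kh + wm * (Kh * wm / l)) + nn * Kh"
    and "K3 \<equiv> 4 * nn * Kh + (2 * nn * Ka + 2) * T"
  shows "norm (slow \<kappa> m1 m2 \<epsilon> 0 (y (\<tau> / \<epsilon>)) - hb \<tau>) \<le> (exp (\<Lambda> * T) * (K1 + 1 + (\<Lambda> * K1 + K2) * \<bar>K3\<bar>) + K1) * \<epsilon>"
proof -
  define t1 where "t1 = \<tau> / \<epsilon>"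
  have t1: "0 < t1" using \<tau> \<epsilon> by (simp add: t1_def)
  note traj = traj[folded t1_def]
  obtain C where C: "finite C"
    and free: "\<forall>t\<in>{0..t1} - C. (y has_vector_derivative hc_free (y t)) (at t within {0..t1})"
    "\<forall>t\<in>C. (y \<longlongrightarrow> y t) (at t within {t..t1})"
    "\<forall>t\<in>C. \<exists>w. ((\<lambda>s. hc_vel (y s)) \<longlongrightarrow> w) (at_left t) \<and> hc_collide m1 m2 (1 / \<epsilon>\<^sup>2) (hc_pos (y t)) w (hc_vel (y t))"
    and "continuous_on {0..t1} (\<lambda>t. hc_pos (y t))"
    and conf: "\<forall>t\<in>{0..t1}. (case y t of (X, V, x1, v1, x2, v2) \<Rightarrow>
           (\<forall>j. 0 \<le> x1$j \<and> x1$j \<le> X) \<and> (\<forall>j. X \<le> x2$j \<and> x2$j \<le> 1))"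
    by (rule hc_trajE[OF traj])
  define h where "h t = slow \<kappa> m1 m2 \<epsilon> 0 (y t)" for t
  let ?z = "\<lambda>t. corr_slow \<epsilon> 0 (y t)"
  let ?N = "\<lambda>t. 2 * corr_sum 0 (y t) + (2 * nn * Ka + 2) * t"
  have hG: "h t \<in> Gset" if "0 \<le> t" "t < t1" for t
    using G[of "\<epsilon> * t"] that \<epsilon> by (simp add: h_def t1_def field_simps)
  have adm: "admissible (y t) \<and> total \<epsilon> (y t) \<le> total_max" if "0 \<le> t" "t < t1" for t
  proof -
    obtain X V x1 v1 x2 v2 where y: "y t = (X, V, x1, v1, x2, v2)" by (metis surj_pair)
    have "slow \<kappa> m1 m2 \<epsilon> 0 (X, V, x1, v1, x2, v2) \<in> Gset" using hG[OF that] by (simp add: h_def y)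
    then show ?thesis
      using slow_in_Gset(1,2)[of \<epsilon> 0 X V x1 v1 x2 v2] total_le[of \<epsilon> X V x1 v1 x2 v2] bspec[OF conf, of t] \<epsilon> that
      by (simp add: admissible_def y)
  qed
  \<comment> \<open>Admissibility and the energy bound at \<open>t\<close> belong to the claim: at
    \<open>t = t1\<close> the state after the collisions need not be in \<open>Gset\<close>, but its
    left limit is, and collisions conserve the total energy.\<close>
  have jump: "\<exists>zl Nl. (?z \<longlongrightarrow> zl) (at_left t) \<and> (?N \<longlongrightarrow> Nl) (at_left t) \<and>
      norm (?z t - zl) \<le> \<epsilon>\<^sup>2 * K2 * (?N t - Nl) \<and> Nl \<le> ?N t \<and> admissible (y t) \<and> total \<epsilon> (y t) \<le> total_max"
    if t: "0 < t" "t \<le> t1" for t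
  proof -
    obtain w where w: "(y \<longlongrightarrow> join (hc_pos (y t)) w) (at_left t)"
        "(hc_step m1 m2 (1 / \<epsilon>\<^sup>2) (hc_pos (y t)))\<^sup>*\<^sup>* w (hc_vel (y t))"
      using hc_traj_left_limit[OF traj t] by blast
    let ?y = "join (hc_pos (y t)) w"
    have "((\<lambda>t. fst (y t)) \<longlongrightarrow> fst ?y) (at_left t)" by (rule tendsto_fst[OF w(1)])
    then have Xl: "fst ?y \<in> {l..1 - l}"
    proof (rule left_limit_in_closed[OF closed_atLeastAtMost _ t(1)])
      show "fst (y s) \<in> {l..1 - l}" if "0 \<le> s" "s < t" for s
        using adm[of s] that t by (auto simp: admissible_def split_beta)
    qed
    then have X01: "fst ?y \<noteq> 0" "fst ?y \<noteq> 1" using l by auto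
    note lim = tendsto_hard[OF w(1) X01]
    have "(h \<longlongrightarrow> slow \<kappa> m1 m2 \<epsilon> 0 ?y) (at_left t)" using lim(3) \<epsilon>(1) by (simp add: h_def[abs_def])
    then have "slow \<kappa> m1 m2 \<epsilon> 0 ?y \<in> Gset"
      by (rule left_limit_in_closed[OF closed_Gset _ t(1)]) (use hG t in auto)
    then have tl: "total \<epsilon> ?y \<le> total_max"
      using total_le[OF _ \<epsilon>(1)] by (simp add: join_def)
    have yt: "fst (y t) = fst ?y" by (cases "y t") (simp add: join_def hc_pos_def)
    have at: "admissible (y t)"
      using bspec[OF conf, of t] t Xl unfolding yt[symmetric] by (cases "y t") (simp add: admissible_def)
    have al: "admissible ?y"
      using at by (cases "y t") (simp add: admissible_def join_def hc_pos_def)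
    from hc_steps_effect[OF w(2) al \<epsilon>(1) tl]
    have e: "total \<epsilon> (y t) = total \<epsilon> ?y" "corr_sum 0 ?y \<le> corr_sum 0 (y t)"
      "norm (?z t - corr_slow \<epsilon> 0 ?y) \<le> \<epsilon>\<^sup>2 * (nn * Kh) * (corr_sum 0 (y t) - corr_sum 0 ?y)"
      by (simp_all add: join_pos_vel)
    \<comment> \<open>The last summand of \<open>K2\<close> is there for the jumps.\<close>
    have K2': "nn * Kh \<le> K2" using nn_pos Kh_nonneg wm l by (simp add: K2_def)
    have "\<epsilon>\<^sup>2 * (nn * Kh) * (corr_sum 0 (y t) - corr_sum 0 ?y) \<le> \<epsilon>\<^sup>2 * K2 * (2 * (corr_sum 0 (y t) - corr_sum 0 ?y))"
      by (intro mult_mono mult_left_mono K2') (use e(2) K2' nn_pos Kh_nonneg order_trans[OF _ K2'] in auto)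
    with e have "norm (?z t - corr_slow \<epsilon> 0 ?y) \<le> \<epsilon>\<^sup>2 * K2 * (?N t - (2 * corr_sum 0 ?y + (2 * nn * Ka + 2) * t))"
      by (simp add: algebra_simps)
    moreover have "(?N \<longlongrightarrow> 2 * corr_sum 0 ?y + (2 * nn * Ka + 2) * t) (at_left t)"
      by (intro tendsto_intros lim)
    ultimately show ?thesis using lim(1) e(1,2) tl at
      by (intro exI[of _ "corr_slow \<epsilon> 0 ?y"] exI[of _ "2 * corr_sum 0 ?y + (2 * nn * Ka + 2) * t"]) auto
  qed
  have adm: "admissible (y t)" "total \<epsilon> (y t) \<le> total_max" if "0 \<le> t" "t \<le> t1" for t
    using adm[of t] jump[of t] that t1 by (cases "t = t1"; auto)+
  have X01: "fst (y t) \<noteq> 0" "fst (y t) \<noteq> 1" if "0 \<le> t" "t \<le> t1" for t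
    using adm(1)[OF that] l by (auto simp: admissible_def split_beta)
  obtain X V x1 v1 x2 v2 where y: "y = (\<lambda>t. (X t, V t, x1 t, v1 t, x2 t, v2 t))"
    by (rule pstate_components)
  note bnd = hard_bounds[OF adm(2)[unfolded y] adm(1)[unfolded y] \<epsilon>(1)]
  have der: "\<exists>z' N'. (?z has_vector_derivative z') (at t) \<and> (?N has_real_derivative N') (at t) \<and>
      1 \<le> N' \<and> norm (z' - \<epsilon> *\<^sub>R Hbar \<kappa> m1 m2 0 (h t)) \<le> \<epsilon>\<^sup>2 * K2 * N'" if t: "0 < t" "t < t1" "t \<notin> C" for t
  proof -
    have t': "0 \<le> t" "t \<le> t1" using t by auto
    note inG = slow_in_Gset[OF hG[unfolded h_def y, OF t'(1) t(2)] \<epsilon>(1)]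
    have "(y has_vector_derivative hc_free (y t)) (at t)"
      using bspec[OF free(1), of t] t at_within_interior[of t "{0..t1}"] by simp
    note d = pstate_derivatives[OF this[unfolded y hc_free_def split]]
    have ad: "l \<le> X t" "X t \<le> 1 - l" "0 \<le> x1 t $ j" "x1 t $ j \<le> X t" "X t \<le> x2 t $ k" "x2 t $ k \<le> 1" for j k
      using adm(1)[OF t'] by (auto simp: y admissible_def)
    have X: "0 < X t" "0 < 1 - X t" using ad(1,2) l by auto
    \<comment> \<open>The only remainder stems from differentiating the factor \<open>1 / L\<close>
      of the corrector. Forces vanish between collisions, hence the literal \<open>1 + 0\<close> in
      place of one plus the total force.\<close>
    have resid: "\<bar>p * x / L * (U / L)\<bar> \<le> Kh * wm / l * \<epsilon> * (1 + 0)"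
      if "\<bar>p\<bar> \<le> Kh" "0 \<le> x" "x \<le> L" "l \<le> L" "\<bar>U\<bar> = \<bar>V t\<bar>" for p x L U
    proof -
      have L: "0 < L" using that l by simp
      have "\<bar>p * x / L * (U / L)\<bar> = (\<bar>p\<bar> * (x / L)) * (\<bar>V t\<bar> / L)" using that L by (simp add: abs_mult)
      also have "\<dots> \<le> (Kh * 1) * ((\<epsilon> * wm) / l)"
        by (intro mult_mono frac_le inG(3)) (use that L Kh_nonneg l \<epsilon> wm in auto)
      finally show ?thesis by (simp add: algebra_simps)
    qed
    have P1: "((\<lambda>t. corr1 0 (X t) (V t) (x1 t) (v1 t) j) has_real_derivative
        0 - mean_force 0 (X t) (ener1 0 (X t) (x1 t) (v1 t) j) + (m1 $ j * v1 t $ j) * x1 t $ j / X t * (V t / X t)) (at t)" for j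
    proof -
      have "((\<lambda>t. - (m1 $ j * v1 t $ j * x1 t $ j) / X t) has_real_derivative
         (- (m1 $ j * v1 t $ j * v1 t $ j) * X t - - (m1 $ j * v1 t $ j * x1 t $ j) * V t) / (X t * X t)) (at t)"
        by (rule derivative_eq_intros d refl)+ (use X in \<open>simp_all\<close>)
      then show ?thesis
        unfolding hard_core_simps
        by (rule DERIV_cong) (use X in \<open>simp add: mean_force_def eff_len_def field_simps power2_eq_square\<close>)
    qed
    have P2: "((\<lambda>t. corr2 0 (X t) (V t) (x2 t) (v2 t) j) has_real_derivative
        0 - mean_force 0 (1 - X t) (ener2 0 (X t) (x2 t) (v2 t) j) + (m2 $ j * v2 t $ j) * (1 - x2 t $ j) / (1 - X t) * (V t / (1 - X t))) (at t)" for j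
    proof -
      have "((\<lambda>t. m2 $ j * v2 t $ j * (1 - x2 t $ j) / (1 - X t)) has_real_derivative
         (- (m2 $ j * v2 t $ j * v2 t $ j) * (1 - X t) - m2 $ j * v2 t $ j * (1 - x2 t $ j) * - V t) / ((1 - X t) * (1 - X t))) (at t)"
        by (rule derivative_eq_intros d refl)+ (use X in \<open>simp_all\<close>)
      then show ?thesis
        unfolding hard_core_simps
      proof (rule DERIV_cong)
        have "(- (p * v) * L - p * z * - U) / (L * L) = 0 - 2 * (p * v / 2) / L + p * z / L * (U / L)" if "0 < L" for p v L z U :: real
          using that by (simp add: field_simps)
        from this[OF X(2), of "m2 $ j * v2 t $ j" "v2 t $ j" "1 - x2 t $ j" "V t"]
        show "(- (m2 $ j * v2 t $ j * v2 t $ j) * (1 - X t) - m2 $ j * v2 t $ j * (1 - x2 t $ j) * - V t) / ((1 - X t) * (1 - X t))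
          = 0 - mean_force 0 (1 - X t) (m2 $ j * (v2 t $ j)\<^sup>2 / 2) + m2 $ j * v2 t $ j * (1 - x2 t $ j) / (1 - X t) * (V t / (1 - X t))"
          by (simp add: mean_force_def eff_len_def power2_eq_square mult.assoc)
      qed
    qed
    have E1: "((\<lambda>t. ener1 0 (X t) (x1 t) (v1 t) j) has_real_derivative - V t * 0) (at t)" for j
      unfolding hard_core_simps
      by (rule DERIV_cong[OF DERIV_cdivide[OF DERIV_cmult[OF DERIV_power[OF d(4)]]]]) simp
    have E2: "((\<lambda>t. ener2 0 (X t) (x2 t) (v2 t) j) has_real_derivative V t * 0) (at t)" for j
      unfolding hard_core_simps
      by (rule DERIV_cong[OF DERIV_cdivide[OF DERIV_cmult[OF DERIV_power[OF d(6)]]]]) simp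
    have A: "mean_force 0 (X t) (ener1 0 (X t) (x1 t) (v1 t) j) \<le> Ka"
      "mean_force 0 (1 - X t) (ener2 0 (X t) (x2 t) (v2 t) k) \<le> Ka" for j k
      unfolding Ka_def
      by (intro mean_force_bounds; use inG l c in \<open>force intro: order_trans[OF less_imp_le] order_trans[OF _ less_imp_le]\<close>)+
    have V0: "(V has_real_derivative \<epsilon>\<^sup>2 * ((\<Sum>j\<in>(UNIV::'n1 set). 0) - (\<Sum>j\<in>(UNIV::'n2 set). 0))) (at t)"
      using d(2) by simp
    have R0: "0 \<le> Kh * wm / l" using Kh_nonneg wm l by simp
    show ?thesis
    proof (rule corrected_derivative[where X = X and V = V and t = t and S = UNIV
          and ?E1.0 = "\<lambda>j t. ener1 0 (X t) (x1 t) (v1 t) j" and ?E2.0 = "\<lambda>j t. ener2 0 (X t) (x2 t) (v2 t) j"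
          and ?P1.0 = "\<lambda>j t. corr1 0 (X t) (V t) (x1 t) (v1 t) j" and ?P2.0 = "\<lambda>j t. corr2 0 (X t) (V t) (x2 t) (v2 t) j"
          and ?F1.0 = "\<lambda>_. 0" and ?F2.0 = "\<lambda>_. 0"
          and ?A1.0 = "\<lambda>j. mean_force 0 (X t) (ener1 0 (X t) (x1 t) (v1 t) j)"
          and ?A2.0 = "\<lambda>j. mean_force 0 (1 - X t) (ener2 0 (X t) (x2 t) (v2 t) j)"
          and ?r1.0 = "\<lambda>j. (m1 $ j * v1 t $ j) * x1 t $ j / X t * (V t / X t)"
          and ?r2.0 = "\<lambda>j. (m2 $ j * v2 t $ j) * (1 - x2 t $ j) / (1 - X t) * (V t / (1 - X t))",
          OF \<epsilon>(1,2) d(1) V0 E1 E2 P1 P2 order_refl order_refl A Ka_nonneg _ _ R0 \<epsilon>(3) inG(3)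
          bnd(4)[OF t' t'] bnd(5)[OF t' t'] Kh_nonneg], goal_cases)
      case (1 j)
      show ?case using resid[OF bnd(2)[OF t' t'], of "x1 t $ j" "X t" "V t"] ad by simp
    next
      case (2 j)
      show ?case using resid[OF bnd(3)[OF t' t'], of "1 - x2 t $ j" "1 - X t" "V t"] ad by simp
    next
      case (3 z' N')
      have "norm (z' - \<epsilon> *\<^sub>R Hbar \<kappa> m1 m2 0 (h t)) \<le> \<epsilon>\<^sup>2 * (nn * (Kh * wm / l + Kh + wm * (Kh * wm / l))) * N'"
        using 3(4) Hbar_slow[OF hG[unfolded h_def y, OF t'(1) t(2)] order_refl] l
        unfolding h_def y by simp
      also have "\<dots> \<le> \<epsilon>\<^sup>2 * K2 * N'"
        by (intro mult_right_mono mult_left_mono) (use 3(3) nn_pos Kh_nonneg in \<open>auto simp: K2_def\<close>)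
      finally show ?case using 3(1-3) unfolding y corr_slow_def corr_sum_def split by blast
    qed
  qed
  have NT: "?N t1 - ?N 0 \<le> K3 / \<epsilon>"
  proof -
    have S: "\<bar>corr_sum 0 (y t)\<bar> \<le> nn * Kh" if "0 \<le> t" "t \<le> t1" for t
      unfolding y by (rule abs_corr_sum_le) (use bnd(4,5) that in auto)
    show ?thesis
      using momentum_budget[OF \<epsilon>(1,2) S[of 0] S[of t1], of \<tau> T] \<tau> t1 by (simp add: K3_def t1_def)
  qed
  have "norm (h (\<tau> / \<epsilon>) - hb \<tau>) \<le> (exp (\<Lambda> * T) * (K1 + 1 + (\<Lambda> * K1 + K2) * \<bar>K3\<bar>) + K1) * \<epsilon>"
  proof (rule averaging_estimate[where G = Gset and H = "Hbar \<kappa> m1 m2 0" and C = C and z = ?z and N = ?N, OF \<Lambda> lip \<epsilon>(1)])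
    show "0 \<le> K1" "0 \<le> K2" using nn_pos wm wh_nonneg Kh_nonneg l by (auto simp: K1_def K2_def)
    show "norm (?z t - h t) \<le> \<epsilon> * K1" if "0 \<le> t" "t \<le> \<tau> / \<epsilon>" for t
      unfolding K1_def h_def y corr_slow_def split slow_eq
      by (rule corrected_near[OF \<epsilon>(1) wh_nonneg]) (use bnd(1,4,5) that in \<open>auto simp: t1_def\<close>)
    show "\<exists>z' N'. (?z has_vector_derivative z') (at t) \<and> (?N has_real_derivative N') (at t) \<and> 1 \<le> N' \<and>
        norm (z' - \<epsilon> *\<^sub>R Hbar \<kappa> m1 m2 0 (h t)) \<le> \<epsilon>\<^sup>2 * K2 * N'" if "0 < t" "t < \<tau> / \<epsilon>" "t \<notin> C" for t
      using der[of t] that by (simp add: t1_def)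
    show "(?z \<longlongrightarrow> ?z t) (at_right t) \<and> (?N \<longlongrightarrow> ?N t) (at_right t)" if t: "0 \<le> t" "t < \<tau> / \<epsilon>" for t
    proof -
      have "(y \<longlongrightarrow> y t) (at_right t)" using hc_traj_right_limit[OF traj] t by (simp add: t1_def)
      note lim = tendsto_hard[OF this X01[of t]]
      show ?thesis using t by (intro conjI tendsto_intros lim) (auto simp: t1_def)
    qed
    show "\<exists>zl Nl. (?z \<longlongrightarrow> zl) (at_left t) \<and> (?N \<longlongrightarrow> Nl) (at_left t) \<and>
        norm (?z t - zl) \<le> \<epsilon>\<^sup>2 * K2 * (?N t - Nl) \<and> Nl \<le> ?N t" if "0 < t" "t \<le> \<tau> / \<epsilon>" for t
      using jump[of t] that unfolding t1_def by blast
    show "hb 0 = h 0" using hb0 by (simp add: h_def)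
    show "?N (\<tau> / \<epsilon>) - ?N 0 \<le> K3 / \<epsilon>" using NT by (simp add: t1_def)
  qed (use \<tau> hG hb G C in \<open>auto simp: t1_def\<close>)
  then show ?thesis by (simp add: h_def)
qed

end

subsection \<open>The averaging theorem\<close>

lemma (in piston) averaging:
  assumes T: "0 < T"
  obtains K \<epsilon>0 where "0 < K" "0 < \<epsilon>0"
    "\<And>\<epsilon> \<delta> \<tau> y hb. \<lbrakk>\<epsilon> \<in> {0<..\<epsilon>0}; \<delta> \<in> {0..l / 4}; 0 < \<tau>; \<tau> \<le> T; piston_traj \<kappa> m1 m2 \<epsilon> \<delta> (\<tau> / \<epsilon>) y;
      hb 0 = slow \<kappa> m1 m2 \<epsilon> \<delta> (y 0);
      \<And>\<sigma>. \<sigma> \<in> {0..\<tau>} \<Longrightarrow> (hb has_vector_derivative Hbar \<kappa> m1 m2 \<delta> (hb \<sigma>)) (at \<sigma> within {0..\<tau>});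
      \<And>\<sigma>. 0 \<le> \<sigma> \<Longrightarrow> \<sigma> < \<tau> \<Longrightarrow> hb \<sigma> \<in> Gset \<and> slow \<kappa> m1 m2 \<epsilon> \<delta> (y (\<sigma> / \<epsilon>)) \<in> Gset\<rbrakk>
      \<Longrightarrow> norm (slow \<kappa> m1 m2 \<epsilon> \<delta> (y (\<tau> / \<epsilon>)) - hb \<tau>) \<le> K * \<epsilon>"
proof -
  obtain \<Lambda> where \<Lambda>: "0 \<le> \<Lambda>" and lip:
    "\<And>\<delta> h h'. \<delta> \<in> {0..l / 4} \<Longrightarrow> h \<in> hdom \<Longrightarrow> h' \<in> hdom \<Longrightarrow> \<bar>fst (snd h)\<bar> \<le> wm \<Longrightarrow> \<bar>fst (snd h')\<bar> \<le> wm \<Longrightarrow>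
      norm (Hbar \<kappa> m1 m2 \<delta> h - Hbar \<kappa> m1 m2 \<delta> h') \<le> \<Lambda> * norm (h - h')"
    using Hbar_lipschitz by metis
  have lipG: "norm (Hbar \<kappa> m1 m2 \<delta> h - Hbar \<kappa> m1 m2 \<delta> h') \<le> \<Lambda> * norm (h - h')"
    if "\<delta> \<in> {0..l / 4}" "h \<in> Gset" "h' \<in> Gset" for \<delta> h h'
    by (rule lip) (use that Gset_hdom in \<open>auto simp: Gset_def\<close>)
  obtain Ks \<nu> where Ks: "0 \<le> Ks" "0 < \<nu>" "\<And>j. corr_est l c0 c1 (m1 $ j) Ks \<nu>" "\<And>j. corr_est l c0 c1 (m2 $ j) Ks \<nu>"
  proof -
    have "\<exists>K \<nu>. 0 \<le> K \<and> 0 < \<nu> \<and> (\<forall>m\<in>range (($) m1) \<union> range (($) m2). corr_est l c0 c1 m K \<nu>)"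
      by (rule corr_est_finite) (use m1 m2 in auto)
    then show thesis using that by blast
  qed
  define c where "c a b d = exp (\<Lambda> * T) * (a + 1 + (\<Lambda> * a + b) * \<bar>d\<bar>) + a" for a b d :: real
  define cs where "cs = c (nn * (1 + wm) * Ks) (nn * (Ks * (1 + wm) + Ks + wm * (Ks * (1 + wm))))
    (4 * nn * Ks + (2 * nn * Ka + 2) * T)"
  define ch where "ch = c (nn * (1 + wh) * Kh) (nn * (Kh * wm / l + Kh + wm * (Kh * wm / l)) + nn * Kh)
    (4 * nn * Kh + (2 * nn * Ka + 2) * T)"
  define K where "K = max 1 (max cs ch)"
  have K: "1 \<le> K" "cs \<le> K" "ch \<le> K" by (auto simp: K_def)
  define b where "b = nn * (Ks * (1 + wm)) + nn * (Kh * wm / l)"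
  have b: "0 \<le> nn * (Ks * (1 + wm))" "0 \<le> nn * (Kh * wm / l)" "0 \<le> b"
    using nn_pos Ks wm Kh_nonneg l by (auto simp: b_def)
  \<comment> \<open>The second bound keeps \<open>\<epsilon> * wm\<close> below the speed limit
    \<open>\<nu>\<close>, the third lets the clock absorb the remainders of both models. The added
    1s prevent division by zero.\<close>
  define \<epsilon>0 where "\<epsilon>0 = min 1 (min (\<nu> / (wm + 1)) (1 / (2 * (b + 1))))"
  have \<epsilon>0: "0 < \<epsilon>0" using Ks wm b by (simp add: \<epsilon>0_def)
  show thesis
  proof (rule that[of K \<epsilon>0])
    fix \<epsilon> \<delta> \<tau> :: real and y :: "real \<Rightarrow> ('n1, 'n2) pstate" and hb
    assume \<epsilon>: "\<epsilon> \<in> {0<..\<epsilon>0}" and \<delta>: "\<delta> \<in> {0..l / 4}" and \<tau>: "0 < \<tau>" "\<tau> \<le> T"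
      and traj: "piston_traj \<kappa> m1 m2 \<epsilon> \<delta> (\<tau> / \<epsilon>) y" and hb0: "hb 0 = slow \<kappa> m1 m2 \<epsilon> \<delta> (y 0)"
      and hb: "\<And>\<sigma>. \<sigma> \<in> {0..\<tau>} \<Longrightarrow> (hb has_vector_derivative Hbar \<kappa> m1 m2 \<delta> (hb \<sigma>)) (at \<sigma> within {0..\<tau>})"
      and G: "\<And>\<sigma>. 0 \<le> \<sigma> \<Longrightarrow> \<sigma> < \<tau> \<Longrightarrow> hb \<sigma> \<in> Gset \<and> slow \<kappa> m1 m2 \<epsilon> \<delta> (y (\<sigma> / \<epsilon>)) \<in> Gset"
    have e: "0 < \<epsilon>" "\<epsilon> \<le> 1" "\<epsilon> \<le> \<nu> / (wm + 1)" "\<epsilon> \<le> 1 / (2 * (b + 1))"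
      using \<epsilon> by (auto simp: \<epsilon>0_def)
    have "\<epsilon> * (wm + 1) \<le> \<nu>" using e(3) wm by (simp add: field_simps)
    then have e1: "\<epsilon> * wm \<le> \<nu>" using e(1) by (simp add: algebra_simps)
    have "\<epsilon> * (b + 1) \<le> 1 / 2" using e(4) b by (simp add: field_simps)
    then have eb: "\<epsilon> * b \<le> 1 / 2" using e(1) by (simp add: algebra_simps)
    have e2: "\<epsilon> * (nn * (Ks * (1 + wm))) \<le> 1 / 2"
      by (rule order_trans[OF mult_left_mono eb]) (use b e in \<open>auto simp: b_def\<close>)
    have e3: "\<epsilon> * (nn * (Kh * wm / l)) \<le> 1 / 2"
      by (rule order_trans[OF mult_left_mono eb]) (use b e in \<open>auto simp: b_def\<close>)
    show "norm (slow \<kappa> m1 m2 \<epsilon> \<delta> (y (\<tau> / \<epsilon>)) - hb \<tau>) \<le> K * \<epsilon>"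
    proof (cases "\<delta> = 0")
      case True
      have "norm (slow \<kappa> m1 m2 \<epsilon> 0 (y (\<tau> / \<epsilon>)) - hb \<tau>) \<le> ch * \<epsilon>"
        unfolding ch_def c_def
        by (rule hard_averaging[OF \<Lambda> lipG e(1,2) e3 \<tau>])
          (use True traj hb0 hb G l in \<open>auto simp: piston_traj_def\<close>)
      also have "\<dots> \<le> K * \<epsilon>" using K e by (intro mult_right_mono) auto
      finally show ?thesis using True by simp
    next
      case False
      then have \<delta>': "0 < \<delta>" "4 * \<delta> \<le> l" using \<delta> by auto
      have "norm (slow \<kappa> m1 m2 \<epsilon> \<delta> (y (\<tau> / \<epsilon>)) - hb \<tau>) \<le> cs * \<epsilon>"
        unfolding cs_def c_def
        by (rule soft_averaging[OF Ks(3,4) \<Lambda> lipG[OF \<delta>] e(1,2) e1 e2 \<delta>' \<tau>])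
          (use False traj hb0 hb G in \<open>auto simp: piston_traj_def\<close>)
      also have "\<dots> \<le> K * \<epsilon>" using K e by (intro mult_right_mono) auto
      finally show ?thesis .
    qed
  qed (use K \<epsilon>0 in auto)
qed

text \<open>The stopping time is encoded by hypotheses: \<open>\<tau>\<close> does not exceed it
  exactly when both curves stay in \<open>V\<close> on \<open>[0, \<tau>)\<close>, so the bound for
  all such \<open>\<tau>\<close> is the supremum bound. Regularity is stated on an open
  neighbourhood \<open>U\<close>, as \<open>V\<close> may be too thin to determine
  derivatives.\<close>

theorem theorem2:
  fixes \<kappa> :: "real \<Rightarrow> real"
    and m1 :: "real ^ 'n1::finite" and m2 :: "real ^ 'n2::finite"
    and V :: "('n1, 'n2) slowvar set"
    and A B C :: "real set"
  assumes kappa: "kappa_ok \<kappa>"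
    and masses: "\<forall>j. m1$j > 0" "\<forall>j. m2$j > 0"
    and V_compact: "compact V"
    and A: "compact A" "A \<subseteq> {0<..<1}"
    and B: "compact B"
    and C: "compact C" "C \<subseteq> {0<..<\<kappa> 0}"
    and V_sub: "\<forall>h\<in>V. case h of (X, W, E1, E2) \<Rightarrow>
                   X \<in> A \<and> W \<in> B \<and> (\<forall>j. E1$j \<in> C) \<and> (\<forall>j. E2$j \<in> C)"
  shows "\<exists>\<delta>0>0.
     (\<exists>U D. open U \<and> V \<subseteq> U \<and>
        (\<forall>p\<in>{0..\<delta>0} \<times> U.
           ((\<lambda>(\<delta>, h). Hbar \<kappa> m1 m2 \<delta> h) has_derivative blinfun_apply (D p))
             (at p within {0..\<delta>0} \<times> U)) \<and>
        continuous_on ({0..\<delta>0} \<times> U) D) \<and>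
     (\<forall>T>0. \<exists>K>0. \<exists>\<epsilon>0>0.
        \<forall>\<epsilon>\<in>{0<..\<epsilon>0}. \<forall>\<delta>\<in>{0..\<delta>0}. \<forall>\<tau>\<in>{0..T}.
        \<forall>y hb.
          piston_traj \<kappa> m1 m2 \<epsilon> \<delta> (\<tau> / \<epsilon>) y \<and>
          slow \<kappa> m1 m2 \<epsilon> \<delta> (y 0) \<in> V \<and>
          hb 0 = slow \<kappa> m1 m2 \<epsilon> \<delta> (y 0) \<and>
          (\<forall>\<sigma>\<in>{0..\<tau>}. (hb has_vector_derivative Hbar \<kappa> m1 m2 \<delta> (hb \<sigma>)) (at \<sigma> within {0..\<tau>})) \<and>
          (\<forall>\<sigma>\<in>{0..<\<tau>}. hb \<sigma> \<in> V \<and> slow \<kappa> m1 m2 \<epsilon> \<delta> (y (\<sigma> / \<epsilon>)) \<in> V)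
          \<longrightarrow> norm (slow \<kappa> m1 m2 \<epsilon> \<delta> (y (\<tau> / \<epsilon>)) - hb \<tau>) \<le> K * \<epsilon>)"
proof -
  interpret soft_core \<kappa> by unfold_locales (rule kappa)
  have k0: "0 < \<kappa> 0" by (rule kappa_pos) simp
  obtain a0 a1 where ha: "0 < a0" "a0 \<le> a1" "a1 < 1" "A \<subseteq> {a0..a1}"
    using compact_subset_Icc[OF A] by auto
  obtain c0 c1 where hc: "0 < c0" "c0 \<le> c1" "c1 < \<kappa> 0" "C \<subseteq> {c0..c1}"
    using compact_subset_Icc[OF C k0] by auto
  obtain wm where hw: "0 \<le> wm" "\<And>w. w \<in> B \<Longrightarrow> \<bar>w\<bar> \<le> wm"
    using bounded_real_on_compact[OF B continuous_on_id] by auto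
  \<comment> \<open>Half of the smaller distance to the outer walls, so that the range of
    \<open>X\<close> lies strictly inside \<open>l..1 - l\<close> and leaves room for
    \<open>U\<close>.\<close>
  define l where "l = min a0 (1 - a1) / 2"
  \<comment> \<open>\<open>e0\<close> and \<open>e1\<close> lie halfway between the energy range
    \<open>c0..c1\<close> and the ends of \<open>(0, \<kappa> 0)\<close>.\<close>
  define e0 where "e0 = c0 / 2"
  define e1 where "e1 = (c1 + \<kappa> 0) / 2"
  have "l \<le> a0 / 2" "l \<le> (1 - a1) / 2" "0 < l" using ha by (auto simp: l_def)
  then have "0 < l \<and> l \<le> 1 \<and> l < a0 \<and> a1 < 1 - l" using ha(1-3) by argo
  then have hl: "0 < l" "l \<le> 1" "l < a0" "a1 < 1 - l" by auto
  interpret piston \<kappa> e0 e1 m1 m2 l c0 c1 wm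
    by unfold_locales (use masses hl hc hw in \<open>auto simp: e0_def e1_def\<close>)
  have V: "l < a0 \<and> a0 \<le> X \<and> X \<le> a1 \<and> a1 < 1 - l \<and> \<bar>W\<bar> \<le> wm \<and> (\<forall>j. c0 \<le> E1 $ j \<and> E1 $ j \<le> c1) \<and> (\<forall>j. c0 \<le> E2 $ j \<and> E2 $ j \<le> c1)"
    if "(X, W, E1, E2) \<in> V" for X W E1 E2
    using V_sub that ha(4) hc(4) hw(2) hl by fastforce
  have VG: "V \<subseteq> Gset"
  proof
    fix h assume "h \<in> V"
    moreover obtain X W E1 E2 where "h = (X, W, E1, E2)" by (metis surj_pair)
    ultimately show "h \<in> Gset" using V[of X W E1 E2] by (auto simp: mem_Gset)
  qed
  define U :: "('n1, 'n2) slowvar set" where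
    "U = {l<..<1 - l} \<times> UNIV \<times> box (\<chi> j. e0) (\<chi> j. e1) \<times> box (\<chi> j. e0) (\<chi> j. e1)"
  have U_open: "open U" unfolding U_def by (intro open_Times open_box open_greaterThanLessThan open_UNIV)
  have VU: "V \<subseteq> U"
  proof
    fix h assume "h \<in> V"
    moreover obtain X W E1 E2 where h: "h = (X, W, E1, E2)" by (metis surj_pair)
    ultimately have "l < X" "X < 1 - l" "\<And>j. c0 \<le> E1 $ j \<and> E1 $ j \<le> c1" "\<And>j. c0 \<le> E2 $ j \<and> E2 $ j \<le> c1"
      using V[of X W E1 E2] by auto
    moreover have "e0 < c0" "c1 < e1" using hc by (auto simp: e0_def e1_def)
    ultimately show "h \<in> U" unfolding U_def h by (auto simp: mem_box_cart intro: less_le_trans le_less_trans)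
  qed
  have "{0..l / 4} \<times> U \<subseteq> {0..l / 4} \<times> hdom"
    by (auto simp: U_def hdom_def mem_Edom mem_box_cart less_imp_le)
  from C1_on_subset[OF C1_on_Hbar this]
  have C1: "\<exists>U D. open U \<and> V \<subseteq> U \<and>
        (\<forall>p\<in>{0..l / 4} \<times> U.
           ((\<lambda>(\<delta>, h). Hbar \<kappa> m1 m2 \<delta> h) has_derivative blinfun_apply (D p))
             (at p within {0..l / 4} \<times> U)) \<and>
        continuous_on ({0..l / 4} \<times> U) D"
    unfolding C1_on_def using U_open VU by blast
  have av: "\<exists>K>0. \<exists>\<epsilon>0>0.
        \<forall>\<epsilon>\<in>{0<..\<epsilon>0}. \<forall>\<delta>\<in>{0..l / 4}. \<forall>\<tau>\<in>{0..T}.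
        \<forall>y hb.
          piston_traj \<kappa> m1 m2 \<epsilon> \<delta> (\<tau> / \<epsilon>) y \<and>
          slow \<kappa> m1 m2 \<epsilon> \<delta> (y 0) \<in> V \<and>
          hb 0 = slow \<kappa> m1 m2 \<epsilon> \<delta> (y 0) \<and>
          (\<forall>\<sigma>\<in>{0..\<tau>}. (hb has_vector_derivative Hbar \<kappa> m1 m2 \<delta> (hb \<sigma>)) (at \<sigma> within {0..\<tau>})) \<and>
          (\<forall>\<sigma>\<in>{0..<\<tau>}. hb \<sigma> \<in> V \<and> slow \<kappa> m1 m2 \<epsilon> \<delta> (y (\<sigma> / \<epsilon>)) \<in> V)
          \<longrightarrow> norm (slow \<kappa> m1 m2 \<epsilon> \<delta> (y (\<tau> / \<epsilon>)) - hb \<tau>) \<le> K * \<epsilon>" if "0 < T" for T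
  proof (rule averaging[OF that], goal_cases)
    case (1 K \<epsilon>0)
    show ?case
    proof (rule exI[of _ K], rule conjI[OF 1(1)], rule exI[of _ \<epsilon>0], rule conjI[OF 1(2)],
        intro ballI allI impI, elim conjE)
      fix \<epsilon> \<delta> \<tau> y hb
      assume \<epsilon>: "\<epsilon> \<in> {0<..\<epsilon>0}" and \<delta>: "\<delta> \<in> {0..l / 4}" and \<tau>: "\<tau> \<in> {0..T}"
        and traj: "piston_traj \<kappa> m1 m2 \<epsilon> \<delta> (\<tau> / \<epsilon>) y" and hb0: "hb 0 = slow \<kappa> m1 m2 \<epsilon> \<delta> (y 0)"
        and hb: "\<forall>\<sigma>\<in>{0..\<tau>}. (hb has_vector_derivative Hbar \<kappa> m1 m2 \<delta> (hb \<sigma>)) (at \<sigma> within {0..\<tau>})"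
        and inV: "\<forall>\<sigma>\<in>{0..<\<tau>}. hb \<sigma> \<in> V \<and> slow \<kappa> m1 m2 \<epsilon> \<delta> (y (\<sigma> / \<epsilon>)) \<in> V"
      show "norm (slow \<kappa> m1 m2 \<epsilon> \<delta> (y (\<tau> / \<epsilon>)) - hb \<tau>) \<le> K * \<epsilon>"
      proof (cases "\<tau> = 0")
        case True
        then show ?thesis using hb0 1(1) \<epsilon> by simp
      next
        case False
        then show ?thesis
          using \<tau> inV VG by (intro 1(3)[OF \<epsilon> \<delta> _ _ traj hb0 bspec[OF hb]]) auto
      qed
    qed
  qed
  \<comment> \<open>The witness is the largest \<open>\<delta>\<close> with
    \<open>4 * \<delta> \<le> l\<close>, the condition for disjoint layers and a positive effective
    length.\<close>
  show ?thesis
    by (rule exI[of _ "l / 4"]) (use hl C1 av in auto)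
qed

end
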